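(* Suppose $z\in\widetilde Z_{ab}$. Then $$\Phi_{\mathfrak i_z}=-v_z^{-1}(\Delta_z^{-2})\cup v_z^{-1}(\Delta_z^{1}),$$ i.e. the ad-nilpotent ideal $\mathfrak i_z$ is the sum of the root spaces $\mathfrak g_\alpha$ with $\alpha\in -v_z^{-1}(\Delta_z^{-2})\cup v_z^{-1}(\Delta_z^{1})$.
   Context: $\mathfrak g$ is a finite-dimensional complex simple Lie algebra, $\mathfrak b=\mathfrak h\oplus\mathfrak n$ a Borel subalgebra with Cartan subalgebra $\mathfrak h$ and nilradical $\mathfrak n$, $\Delta$ the root system, $\Delta^+$ the positive roots (roots of $\mathfrak n$), $\Delta^-=-\Delta^+$, $\Pi=\{\alpha_1,\dots,\alpha_n\}$ the simple roots, $\theta$ the highest root, $\mathfrak g_\alpha$ the root spaces, $h$ the Coxeter number. $\mathfrak h_{\mathbb R}$ is the real span of the coroots, identified with $\mathfrak h_{\mathbb R}^*$ via the Killing form; $(\cdot,\cdot)$ denotes the form and the pairing. $Q^\vee\subset P^\vee$ are the coroot and coweight lattices, $W$ the Weyl group, $t_x$ translation by $x$, $\widehat W=W\ltimes T(Q^\vee)$ with $T(Q^\vee)$ the translations by $Q^\vee$. For $r\ge1$, $C_r=\{x\in\mathfrak h_{\mathbb R}^*\mid(x,\alpha)>0\ \forall\alpha\in\Pi,\ (x,\theta)<r\}$. $\mathcal I$ is the set of ideals of $\mathfrak b$ contained in $\mathfrak n$ (ad-nilpotent ideals); for $\mathfrak i\in\mathcal I$, $\Phi_{\mathfrak i}=\{\alpha\in\Delta^+\mid\mathfrak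 g_\alpha\subset\mathfrak i\}$. Let $\widehat\Delta=\Delta+\mathbb Z\delta$, $\widehat\Delta^+=(\Delta^++\mathbb N\delta)\cup(\Delta^-+\mathbb N^+\delta)$; $\alpha+k\delta$ is viewed as the affine function $x\mapsto(\alpha,x)+k$, so $\widehat W$ acts on $\widehat\Delta$ by $(wa)(x)=a(w^{-1}x)$. $N(w)=\{a\in\widehat\Delta^+\mid w^{-1}(a)<0\}$ for $w\in\widehat W$. For $\mathfrak i\in\mathcal I$ with $\Phi=\Phi_{\mathfrak i}$ put $\Phi^1=\Phi$, $\Phi^k=(\Phi^{k-1}+\Phi)\cap\Delta$ ($k\ge2$), $L_{\mathfrak i}=\bigcup_{k\ge1}(-\Phi^k+k\delta)$. It is known that there is a unique $w_{\mathfrak i}\in\widehat W$ with $N(w_{\mathfrak i})=L_{\mathfrak i}$; let $f(\mathfrak i)=w_{\mathfrak i}$ (an injective map $\mathcal I\to\widehat W$). $\widetilde Z=\{\sigma\in P^\vee\mid(\sigma,\alpha_i)\le1\ \forall i,\ (\sigma,\theta)\ge-2\}$ and $\widetilde Z_{ab}=\{\sigma\in P^\vee\mid(\sigma,\beta)\in\{0,-1,1,-2\}\ \forall\beta\in\Delta^+\}\subset\widetilde Z$. For $z\in\widetilde Z$ there is a unique $v\in W$ with $v(z+\overline C_1)\subset\overline C_h$; put $v_z=v^{-1}$, let $F(z)$ be the unique $w\in\widehat W$ with $v(z+\overline C_1)=w(\overline C_1)$ (it is known that $F(z)\in f(\mathcal I)$), and $\mathfrak i_z=f^{-1}(F(z))$.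 For $z\in\mathfrak h_{\mathbb R}^*$ and $i\in\mathbb Z$, $\Delta_z^i=\{\alpha\in\Delta^+\mid(\alpha,z)=i\}$. *)

theory Defs
  imports "HOL-Analysis.Analysis"
begin

section \<open>Finite-dimensional complex Lie algebras\<close>

text \<open>The underlying vector space is the whole type \<open>'g\<close>. \<open>basis\<close> is some finite basis, as in
  \<^locale>\<open>finite_dimensional_vector_space\<close>; it only serves to express finite-dimensionality and to
  write down traces.\<close>

record 'g lie_algebra =
  scale :: "complex \<Rightarrow> 'g \<Rightarrow> 'g" (infixr "\<cdot>\<index>" 75)
  basis :: "'g set"
  bracket :: "'g \<Rightarrow> 'g \<Rightarrow> 'g" ("\<lbrace>_,/ _\<rbrace>\<index>")

locale lie_algebra = finite_dimensional_vector_space "scale L" "basis L"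
  for L :: "('g::ab_group_add, 'm) lie_algebra_scheme" (structure) +
  assumes bracket_add_left: "\<lbrace>x + y, z\<rbrace> = \<lbrace>x, z\<rbrace> + \<lbrace>y, z\<rbrace>"
    and bracket_add_right: "\<lbrace>x, y + z\<rbrace> = \<lbrace>x, y\<rbrace> + \<lbrace>x, z\<rbrace>"
    and bracket_scale_left: "\<lbrace>c \<cdot> x, y\<rbrace> = c \<cdot> \<lbrace>x, y\<rbrace>"
    and bracket_scale_right: "\<lbrace>x, c \<cdot> y\<rbrace> = c \<cdot> \<lbrace>x, y\<rbrace>"
    and bracket_self: "\<lbrace>x, x\<rbrace> = 0"
    and jacobi: "\<lbrace>x, \<lbrace>y, z\<rbrace>\<rbrace> + \<lbrace>y, \<lbrace>z, x\<rbrace>\<rbrace> + \<lbrace>z, \<lbrace>x, y\<rbrace>\<rbrace> = 0"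
begin

definition subalgebra :: "'g set \<Rightarrow> bool" where
  "subalgebra S \<longleftrightarrow> subspace S \<and> (\<forall>x\<in>S. \<forall>y\<in>S. \<lbrace>x, y\<rbrace> \<in> S)"

definition ideal_of :: "'g set \<Rightarrow> 'g set \<Rightarrow> bool" where
  "ideal_of I K \<longleftrightarrow> subspace I \<and> I \<subseteq> K \<and> (\<forall>x\<in>K. \<forall>y\<in>I. \<lbrace>x, y\<rbrace> \<in> I)"

definition bracket_span :: "'g set \<Rightarrow> 'g set \<Rightarrow> 'g set" where
  "bracket_span A B = span {\<lbrace>x, y\<rbrace> | x y. x \<in> A \<and> y \<in> B}"

primrec derived_series :: "nat \<Rightarrow> 'g set \<Rightarrow> 'g set" where
  "derived_series 0 S = S"
| "derived_series (Suc k) S = bracket_span (derived_series k S) (derived_series k S)"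

primrec lower_central_series :: "nat \<Rightarrow> 'g set \<Rightarrow> 'g set" where
  "lower_central_series 0 S = S"
| "lower_central_series (Suc k) S = bracket_span S (lower_central_series k S)"

definition solvable :: "'g set \<Rightarrow> bool" where
  "solvable S \<longleftrightarrow> (\<exists>k. derived_series k S = {0})"

definition nilpotent :: "'g set \<Rightarrow> bool" where
  "nilpotent S \<longleftrightarrow> (\<exists>k. lower_central_series k S = {0})"

definition simple :: bool where
  "simple \<longleftrightarrow> (\<exists>x y. \<lbrace>x, y\<rbrace> \<noteq> 0) \<and> (\<forall>I. ideal_of I UNIV \<longrightarrow> I = {0} \<or> I = UNIV)"

definition borel_subalgebra :: "'g set \<Rightarrow> bool" where
  "borel_subalgebra B \<longleftrightarrow> subalgebra B \<and> solvable B \<and>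
     (\<forall>K. subalgebra K \<and> solvable K \<and> B \<subseteq> K \<longrightarrow> K = B)"

definition nilradical_of :: "'g set \<Rightarrow> 'g set \<Rightarrow> bool" where
  "nilradical_of N K \<longleftrightarrow> ideal_of N K \<and> nilpotent N \<and>
     (\<forall>I. ideal_of I K \<and> nilpotent I \<longrightarrow> I \<subseteq> N)"

definition diagonalizable :: "('g \<Rightarrow> 'g) \<Rightarrow> bool" where
  "diagonalizable f \<longleftrightarrow> span {x. \<exists>c. f x = c \<cdot> x} = UNIV"

text \<open>The usual definition of a Cartan subalgebra for semisimple complex Lie algebras: a maximal
  commutative subalgebra all of whose elements act diagonalizably in the adjoint representation.\<close>

definition cartan_subalgebra :: "'g set \<Rightarrow> bool" where
  "cartan_subalgebra H \<longleftrightarrow> subalgebra H \<and> (\<forall>x\<in>H. \<forall>y\<in>H. \<lbrace>x, y\<rbrace> = 0) \<and>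
     (\<forall>x. (\<forall>y\<in>H. \<lbrace>y, x\<rbrace> = 0) \<longrightarrow> x \<in> H) \<and>
     (\<forall>x\<in>H. diagonalizable (\<lambda>y. \<lbrace>x, y\<rbrace>))"

definition trace :: "('g \<Rightarrow> 'g) \<Rightarrow> complex" where
  "trace f = (\<Sum>b\<in>basis L. representation (basis L) (f b) b)"

definition killing :: "'g \<Rightarrow> 'g \<Rightarrow> complex" where
  "killing x y = trace (\<lambda>z. \<lbrace>x, \<lbrace>y, z\<rbrace>\<rbrace>)"

end


section \<open>A simple Lie algebra with Borel subalgebra \<open>\<bb> = \<hh> \<oplus> \<nn>\<close>\<close>

record 'g borel_lie_algebra = "'g lie_algebra" +
  cartan :: "'g set" ("\<hh>\<index>")
  borel :: "'g set" ("\<bb>\<index>")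
  nilrad :: "'g set" ("\<nn>\<index>")

locale simple_lie_borel = lie_algebra L
  for L :: "('g::ab_group_add, 'm) borel_lie_algebra_scheme" (structure) +
  assumes simple: simple
    and cartan: "cartan_subalgebra \<hh>"
    and borel: "borel_subalgebra \<bb>"
    and nilradical: "nilradical_of \<nn> \<bb>"
    and borel_decomp: "\<bb> = {x + y | x y. x \<in> \<hh> \<and> y \<in> \<nn>}" "\<hh> \<inter> \<nn> = {0}"
begin

text \<open>The Killing form identifies \<open>\<hh>\<^sup>*\<close> with \<open>\<hh>\<close> (and the real span of the roots with that of the
  coroots). Throughout, a linear functional on \<open>\<hh>\<close> is represented by the \<open>t \<in> \<hh>\<close> with
  \<open>killing t = \<close> that functional; in particular roots are elements of \<open>\<hh>\<close>.\<close>

definition root_space :: "'g \<Rightarrow> 'g set" where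
  "root_space t = {x. \<forall>H\<in>\<hh>. \<lbrace>H, x\<rbrace> = killing t H \<cdot> x}"

definition roots :: "'g set" where
  "roots = {t \<in> \<hh>. t \<noteq> 0 \<and> root_space t \<noteq> {0}}"

definition pos_roots :: "'g set" where
  "pos_roots = {\<alpha> \<in> roots. root_space \<alpha> \<subseteq> \<nn>}"

definition neg_roots :: "'g set" where
  "neg_roots = uminus ` pos_roots"

definition simple_roots :: "'g set" where
  "simple_roots = {\<alpha> \<in> pos_roots. \<not> (\<exists>\<beta>\<in>pos_roots. \<exists>\<gamma>\<in>pos_roots. \<alpha> = \<beta> + \<gamma>)}"

definition highest_root :: 'g where
  "highest_root = (THE \<theta>. \<theta> \<in> roots \<and>
     (\<forall>\<beta>\<in>roots. \<exists>c :: 'g \<Rightarrow> nat. \<theta> - \<beta> = (\<Sum>\<alpha>\<in>simple_roots. of_nat (c \<alpha>) \<cdot> \<alpha>)))"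

definition coroot :: "'g \<Rightarrow> 'g" where
  "coroot \<alpha> = (2 / killing \<alpha> \<alpha>) \<cdot> \<alpha>"

text \<open>\<open>\<hh>\<^sub>\<real>\<close>, with the Killing form, which is real (and positive definite) on it.\<close>

definition h_real :: "'g set" where
  "h_real = module.span (\<lambda>r x. complex_of_real r \<cdot> x) (coroot ` roots)"

definition pair :: "'g \<Rightarrow> 'g \<Rightarrow> real" where
  "pair x y = Re (killing x y)"

definition coroot_lattice :: "'g set" where
  "coroot_lattice = module.span (\<lambda>(k::int) x. of_int k \<cdot> x) (coroot ` roots)"

definition coweight_lattice :: "'g set" where
  "coweight_lattice = {x \<in> h_real. \<forall>\<alpha>\<in>roots. pair x \<alpha> \<in> \<int>}"


subsection \<open>Weyl group and affine Weyl group\<close>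

text \<open>Elements of the Weyl group act on all of \<open>'g\<close>: the reflection in a root \<open>\<alpha>\<close> is extended by
  the same formula, so that it is the identity on the orthogonal complement of \<open>\<alpha>\<close> with respect to
  the Killing form. Similarly for translations. Such an extension is determined by its
  restriction to \<^const>\<open>h_real\<close>, so the groups are the usual ones.\<close>

definition reflection :: "'g \<Rightarrow> 'g \<Rightarrow> 'g" where
  "reflection \<alpha> x = x - killing x (coroot \<alpha>) \<cdot> \<alpha>"

inductive_set weyl :: "('g \<Rightarrow> 'g) set" where
  weyl_id: "id \<in> weyl"
| weyl_step: "\<alpha> \<in> roots \<Longrightarrow> w \<in> weyl \<Longrightarrow> reflection \<alpha> \<circ> w \<in> weyl"

definition translation :: "'g \<Rightarrow> 'g \<Rightarrow> 'g" where
  "translation x y = y + x"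

definition affine_weyl :: "('g \<Rightarrow> 'g) set" where
  "affine_weyl = {v \<circ> translation x | v x. v \<in> weyl \<and> x \<in> coroot_lattice}"

text \<open>The Coxeter number is the order of a Coxeter element, i.e. of the product of the simple
  reflections in some order.\<close>

definition coxeter_element :: "'g \<Rightarrow> 'g" where
  "coxeter_element =
     foldr (\<lambda>\<alpha> w. reflection \<alpha> \<circ> w) (SOME as. distinct as \<and> set as = simple_roots) id"

definition coxeter_number :: nat where
  "coxeter_number = (LEAST m. m > 0 \<and> coxeter_element ^^ m = id)"

definition alcove :: "nat \<Rightarrow> 'g set" where
  "alcove r = {x \<in> h_real. (\<forall>\<alpha>\<in>simple_roots. pair x \<alpha> > 0) \<and> pair x highest_root < real r}"

text \<open>Closure in the Euclidean space \<open>\<hh>\<^sub>\<real>\<close>.\<close>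

definition eclosure :: "'g set \<Rightarrow> 'g set" where
  "eclosure S = {x \<in> h_real. \<forall>e>0. \<exists>y\<in>S. pair (x - y) (x - y) < e}"


subsection \<open>Affine roots\<close>

definition affine_root :: "'g \<Rightarrow> int \<Rightarrow> 'g \<Rightarrow> real" where
  "affine_root \<alpha> k = (\<lambda>x. pair \<alpha> x + of_int k)"

definition pos_affine_roots :: "('g \<Rightarrow> real) set" where
  "pos_affine_roots = {affine_root \<alpha> k | \<alpha> k. \<alpha> \<in> pos_roots \<and> k \<ge> 0} \<union>
                      {affine_root \<alpha> k | \<alpha> k. \<alpha> \<in> neg_roots \<and> k > 0}"

definition neg_affine_roots :: "('g \<Rightarrow> real) set" where
  "neg_affine_roots = {\<lambda>x. - a x | a. a \<in> pos_affine_roots}"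

definition affine_act :: "('g \<Rightarrow> 'g) \<Rightarrow> ('g \<Rightarrow> real) \<Rightarrow> ('g \<Rightarrow> real)" where
  "affine_act w a = (\<lambda>x. a (inv w x))"

definition inversions :: "('g \<Rightarrow> 'g) \<Rightarrow> ('g \<Rightarrow> real) set" where
  "inversions w = {a \<in> pos_affine_roots. affine_act (inv w) a \<in> neg_affine_roots}"


subsection \<open>Ad-nilpotent ideals\<close>

definition ad_nilpotent_ideals :: "'g set set" where
  "ad_nilpotent_ideals = {I. ideal_of I \<bb> \<and> I \<subseteq> \<nn>}"

definition ideal_roots :: "'g set \<Rightarrow> 'g set" where
  "ideal_roots I = {\<alpha> \<in> pos_roots. root_space \<alpha> \<subseteq> I}"

text \<open>\<open>root_power \<Phi> k\<close> is \<open>\<Phi>\<^sup>k\<close> for \<open>k \<ge> 1\<close>; the value at \<open>0\<close> is never used.\<close>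

fun root_power :: "'g set \<Rightarrow> nat \<Rightarrow> 'g set" where
  "root_power \<Phi> 0 = {}"
| "root_power \<Phi> (Suc 0) = \<Phi>"
| "root_power \<Phi> (Suc (Suc k)) = {\<alpha> + \<beta> | \<alpha> \<beta>. \<alpha> \<in> root_power \<Phi> (Suc k) \<and> \<beta> \<in> \<Phi>} \<inter> roots"

definition ideal_inversions :: "'g set \<Rightarrow> ('g \<Rightarrow> real) set" where
  "ideal_inversions I =
     (\<Union>k\<in>{1..}. {affine_root (- \<alpha>) (int k) | \<alpha>. \<alpha> \<in> root_power (ideal_roots I) k})"

text \<open>The injective map \<open>f\<close> from ad-nilpotent ideals to the affine Weyl group. It is a partial
  map so that it does not take arbitrary values; its domain is in fact all of
  \<^const>\<open>ad_nilpotent_ideals\<close>.\<close>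

definition ideal_elt :: "'g set \<Rightarrow> ('g \<Rightarrow> 'g) option" where
  "ideal_elt I =
     (if I \<in> ad_nilpotent_ideals \<and> (\<exists>!w. w \<in> affine_weyl \<and> inversions w = ideal_inversions I)
      then Some (THE w. w \<in> affine_weyl \<and> inversions w = ideal_inversions I) else None)"


subsection \<open>The set \<open>Z\<^sub>a\<^sub>b\<close> and the ideals attached to its elements\<close>

definition Z_ab :: "'g set" where
  "Z_ab = {\<sigma> \<in> coweight_lattice. \<forall>\<beta>\<in>pos_roots. pair \<sigma> \<beta> \<in> {0, -1, 1, -2}}"

text \<open>\<open>chamber_elt z\<close> is the unique \<open>v \<in> W\<close> moving \<open>z +\<close> (closed fundamental alcove) into the
  closed dilated alcove; \<open>v_elt z\<close> is its inverse, \<open>v\<^sub>z\<close>.\<close>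

definition chamber_elt :: "'g \<Rightarrow> ('g \<Rightarrow> 'g)" where
  "chamber_elt z = (THE v. v \<in> weyl \<and>
     v ` translation z ` eclosure (alcove 1) \<subseteq> eclosure (alcove coxeter_number))"

definition v_elt :: "'g \<Rightarrow> ('g \<Rightarrow> 'g)" where
  "v_elt z = inv (chamber_elt z)"

definition F :: "'g \<Rightarrow> ('g \<Rightarrow> 'g)" where
  "F z = (THE w. w \<in> affine_weyl \<and>
     chamber_elt z ` translation z ` eclosure (alcove 1) = w ` eclosure (alcove 1))"

definition z_ideal :: "'g \<Rightarrow> 'g set" where
  "z_ideal z = (THE I. ideal_elt I = Some (F z))"

definition level_roots :: "'g \<Rightarrow> int \<Rightarrow> 'g set" where
  "level_roots z i = {\<alpha> \<in> pos_roots. pair \<alpha> z = of_int i}"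

end

end

theory Submission
  imports Defs
begin

text \<open>
  \<^bold>\<open>Why the proposition holds.\<close> Fix \<open>x\<close> in the open fundamental alcove, so that \<open>0 < (x, \<gamma>) < 1\<close> for
  every positive root \<open>\<gamma>\<close>. For \<open>v \<in> W\<close> and a root \<open>\<beta>\<close>, the value of \<open>\<beta>\<close> at \<open>v (z + x)\<close> is
  \<open>(z, v\<inverse> \<beta>) + (x, v\<inverse> \<beta>)\<close>: an integer which is known from the definition of \<open>Z\<^sub>a\<^sub>b\<close>, plus a number
  whose integral part only depends on the sign of \<open>v\<inverse> \<beta>\<close>. Choose \<open>v\<close> so that \<open>v (z + x)\<close> is dominant.
  If \<open>\<beta>\<close> is positive, then either \<open>\<gamma> = v\<inverse> \<beta>\<close> is positive and \<open>(z, \<gamma>) \<in> {0, 1}\<close>, or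
  \<open>\<gamma> = - v\<inverse> \<beta>\<close> is positive and \<open>(z, \<gamma>) \<in> {-1, -2}\<close>. In both cases \<open>\<beta>\<close> takes values in
  \<open>[0, 2]\<close> on \<open>v (z + C\<^sub>1)\<close>, and values above \<open>1\<close> exactly if \<open>(z, \<gamma>) = 1\<close>, respectively
  \<open>(z, \<gamma>) = -2\<close>. So the set \<open>\<Phi>\<close> of the positive roots that exceed \<open>1\<close> on this alcove is
  \<open>v \<Delta>\<^sub>z\<^sup>1 \<union> - v \<Delta>\<^sub>z\<^sup>-\<^sup>2\<close>, and \<open>F z\<close> inverts precisely the affine roots \<open>- \<beta> + \<delta>\<close> with \<open>\<beta> \<in> \<Phi>\<close>. As
  the dominant values add up, \<open>\<Phi>\<close> is an upper set and no two of its elements sum to a root. Hence the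
  root spaces over \<open>\<Phi>\<close> span an abelian ideal whose set \<open>L\<close> reduces to its first level and equals
  \<open>N (F z)\<close>. An ideal can be recovered from \<open>L\<close>, and an element of the affine Weyl group from its
  inversions, so this ideal is the one attached to \<open>z\<close>.

  \<^bold>\<open>What it rests on.\<close> Roots, positivity, Weyl groups and alcoves are all defined from the Lie algebra,
  so their structure theory comes first.

  \<^item> The Cartan subalgebra acts diagonalizably by assumption. The trace of a commutator \<open>[x, y]\<close> of
    opposite weight vectors vanishes on every string of weight spaces, which yields nondegeneracy of
    the Killing form (\<open>killing_nondegenerate\<close>) and its positivity on the real span of the roots
    (\<open>killing_root_positive\<close>). Highest weight vectors for \<open>sl\<^sub>2\<close> give the axioms of a root system
    and one-dimensional root spaces.

  \<^item> The roots of \<open>\<nn>\<close> are a positive system: no sum of them vanishes (\<open>pos_root_sums_nonzero\<close>), and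
    maximality of \<open>\<bb>\<close> among solvable subalgebras makes every root positive or negative
    (\<open>root_pos_or_neg\<close>). The highest root comes from simplicity: lowering from a maximal root space
    generates an ideal (\<open>highest_root_exists\<close>).

  \<^item> An element of \<open>W\<close> that preserves the positive roots is the identity, by the exchange argument
    (\<open>weyl_preserving_pos_roots\<close>). The affine Weyl group inherits this, because its translation part
    would be a minuscule vector in the coroot lattice, and there is none but \<open>0\<close>
    (\<open>affine_weyl_alcove_id\<close>). Every regular point is moved into the fundamental alcove by
    reflections that bring it closer to a base point (\<open>affine_weyl_to_alcove\<close>).
\<close>

section \<open>Traces and the Killing form\<close>

context lie_algebra
begin

abbreviation lin :: "('g \<Rightarrow> 'g) \<Rightarrow> bool" where
  "lin \<equiv> Vector_Spaces.linear (scale L) (scale L)"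

lemma lin_iff: "lin f \<longleftrightarrow> (\<forall>x y. f (x + y) = f x + f y) \<and> (\<forall>c x. f (c \<cdot> x) = c \<cdot> f x)"
  by (simp add: Vector_Spaces.linear_iff vector_space_axioms)

lemma lin_sum: "lin f \<Longrightarrow> f (sum g A) = (\<Sum>a\<in>A. f (g a))"
  using module_hom.sum linear_iff_module_hom by blast

lemma lin_zero: "lin f \<Longrightarrow> f 0 = 0"
  using lin_sum[of f _ "{}"] by simp

lemma lin_minus: "lin f \<Longrightarrow> f (- x) = - f x"
  using module_hom.neg linear_iff_module_hom by blast

lemma lin_ad: "lin (\<lambda>y. \<lbrace>x, y\<rbrace>)"
  by (simp add: lin_iff bracket_add_right bracket_scale_right)

lemma lin_compose: "lin f \<Longrightarrow> lin g \<Longrightarrow> lin (\<lambda>x. f (g x))"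
  by (simp add: lin_iff)

lemma bracket_zero_right [simp]: "\<lbrace>x, 0\<rbrace> = 0"
  using bracket_scale_right[of x 0 0] by simp

lemma bracket_zero_left [simp]: "\<lbrace>0, x\<rbrace> = 0"
  using bracket_scale_left[of 0 0 x] by simp

lemma bracket_anticommute: "\<lbrace>x, y\<rbrace> = - \<lbrace>y, x\<rbrace>"
proof -
  have "0 = \<lbrace>x + y, x + y\<rbrace>" by (simp only: bracket_self)
  also have "\<dots> = \<lbrace>x, y\<rbrace> + \<lbrace>y, x\<rbrace>"
    unfolding bracket_add_left bracket_add_right by (simp add: bracket_self)
  finally show ?thesis by (metis eq_neg_iff_add_eq_0)
qed

lemma bracket_minus_right: "\<lbrace>x, - y\<rbrace> = - \<lbrace>x, y\<rbrace>"
  using bracket_scale_right[of x "- 1" y] by simp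

lemma bracket_sum_right: "\<lbrace>x, sum g A\<rbrace> = (\<Sum>a\<in>A. \<lbrace>x, g a\<rbrace>)"
  using lin_sum[OF lin_ad] by simp

lemma bracket_derivation: "\<lbrace>x, \<lbrace>y, z\<rbrace>\<rbrace> = \<lbrace>\<lbrace>x, y\<rbrace>, z\<rbrace> + \<lbrace>y, \<lbrace>x, z\<rbrace>\<rbrace>"
proof -
  have "\<lbrace>x, \<lbrace>y, z\<rbrace>\<rbrace> + \<lbrace>y, \<lbrace>z, x\<rbrace>\<rbrace> + \<lbrace>z, \<lbrace>x, y\<rbrace>\<rbrace> = 0" by (rule jacobi)
  moreover have "\<lbrace>y, \<lbrace>z, x\<rbrace>\<rbrace> = - \<lbrace>y, \<lbrace>x, z\<rbrace>\<rbrace>"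
    using bracket_anticommute[of z x] by (simp add: bracket_minus_right)
  moreover have "\<lbrace>z, \<lbrace>x, y\<rbrace>\<rbrace> = - \<lbrace>\<lbrace>x, y\<rbrace>, z\<rbrace>" by (rule bracket_anticommute)
  ultimately show ?thesis by (simp add: algebra_simps)
qed

definition is_basis :: "'g set \<Rightarrow> bool" where
  "is_basis B \<longleftrightarrow> finite B \<and> independent B \<and> span B = UNIV"

lemma is_basis_basis: "is_basis (basis L)"
  by (simp add: is_basis_def finite_Basis independent_Basis span_Basis)

lemma basis_expansion: "is_basis B \<Longrightarrow> (\<Sum>b\<in>B. representation B v b \<cdot> b) = v"
  by (rule sum_representation_eq) (auto simp: is_basis_def)

lemma lin_representation:
  assumes "is_basis B"
  shows "representation B (x + y) b = representation B x b + representation B y b"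
    and "representation B (c \<cdot> x) b = c * representation B x b"
    and "representation B (\<Sum>i\<in>I. g i) b = (\<Sum>i\<in>I. representation B (g i) b)"
  using assms by (auto simp: is_basis_def representation_add representation_scale representation_sum)

lemma lin_eq_on_basis:
  assumes "is_basis B" "lin f" "lin g" "\<And>b. b \<in> B \<Longrightarrow> f b = g b"
  shows "f x = g x"
proof -
  have e: "h x = (\<Sum>b\<in>B. representation B x b \<cdot> h b)" if "lin h" for h
  proof -
    have "h x = h (\<Sum>b\<in>B. representation B x b \<cdot> b)" using basis_expansion[OF assms(1)] by simp
    also have "\<dots> = (\<Sum>b\<in>B. representation B x b \<cdot> h b)"
      using that by (simp add: lin_sum) (simp add: lin_iff)
    finally show ?thesis .
  qed
  show ?thesis using e[OF assms(2)] e[OF assms(3)] assms(4) by simp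
qed

definition trace_on :: "'g set \<Rightarrow> ('g \<Rightarrow> 'g) \<Rightarrow> complex" where
  "trace_on B f = (\<Sum>b\<in>B. representation B (f b) b)"

text \<open>Expanding \<open>g b\<close> in \<open>C\<close> and \<open>f c\<close> in \<open>B\<close> gives the same double sum on both sides. For
  \<open>B = C\<close> this is cyclicity of the trace; for \<open>g = id\<close> it is independence of the basis.\<close>

lemma trace_on_commute:
  assumes B: "is_basis B" and C: "is_basis C" and "lin f" "lin g"
  shows "trace_on B (\<lambda>x. f (g x)) = trace_on C (\<lambda>x. g (f x))"
proof -
  have *: "trace_on B (\<lambda>x. f (g x))
      = (\<Sum>b\<in>B. \<Sum>c\<in>C. representation C (g b) c * representation B (f c) b)"
    if B: "is_basis B" and C: "is_basis C" and f: "lin f" for f g B C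
  proof -
    have "f (g b) = (\<Sum>c\<in>C. representation C (g b) c \<cdot> f c)" for b
    proof -
      have "f (g b) = f (\<Sum>c\<in>C. representation C (g b) c \<cdot> c)" using basis_expansion[OF C] by simp
      then show ?thesis using f by (simp add: lin_sum) (simp add: lin_iff)
    qed
    then show ?thesis by (simp add: trace_on_def lin_representation[OF B])
  qed
  show ?thesis
    unfolding *[OF B C assms(3)] *[OF C B assms(4)]
    by (subst sum.swap) (simp add: mult.commute)
qed

lemma lin_id: "lin (\<lambda>x. x)" by (simp add: lin_iff)

lemma trace_eq_trace_on: "is_basis B \<Longrightarrow> lin f \<Longrightarrow> trace f = trace_on B f"
  using trace_on_commute[OF is_basis_basis _ _ lin_id, of B f]
  by (simp add: trace_def trace_on_def)

lemma trace_commute: "lin f \<Longrightarrow> lin g \<Longrightarrow> trace (\<lambda>x. f (g x)) = trace (\<lambda>x. g (f x))"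
  using trace_on_commute[OF is_basis_basis is_basis_basis, of f g]
  by (simp add: trace_def trace_on_def)

lemma trace_add: "trace (\<lambda>x. f x + g x) = trace f + trace g"
  by (simp add: trace_def lin_representation[OF is_basis_basis] sum.distrib)

lemma trace_scale: "trace (\<lambda>x. c \<cdot> f x) = c * trace f"
  by (simp add: trace_def lin_representation[OF is_basis_basis] sum_distrib_left)

lemma trace_diff: "trace (\<lambda>x. f x - g x) = trace f - trace g"
  using trace_add[of f "\<lambda>x. (- 1) \<cdot> g x"] trace_scale[of "- 1" g] by simp

lemma killing_add_left: "killing (x + y) z = killing x z + killing y z"
  by (simp add: killing_def bracket_add_left trace_add)

lemma killing_scale_left: "killing (c \<cdot> x) z = c * killing x z"
  by (simp add: killing_def bracket_scale_left trace_scale)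

lemma killing_sym: "killing x y = killing y x"
  unfolding killing_def by (rule trace_commute[OF lin_ad lin_ad])

lemma killing_add_right: "killing z (x + y) = killing z x + killing z y"
  using killing_add_left killing_sym by metis

lemma killing_scale_right: "killing z (c \<cdot> x) = c * killing z x"
  using killing_scale_left killing_sym by metis

lemma killing_minus_left: "killing (- x) z = - killing x z"
  using killing_scale_left[of "- 1" x z] by simp

lemma killing_minus_right: "killing z (- x) = - killing z x"
  using killing_scale_right[of z "- 1" x] by simp

lemma killing_diff_left: "killing (x - y) z = killing x z - killing y z"
  using killing_add_left[of x "- y" z] by (simp add: killing_minus_left)

lemma killing_diff_right: "killing z (x - y) = killing z x - killing z y"
  using killing_add_right[of z x "- y"] by (simp add: killing_minus_right)

lemma killing_zero [simp]: "killing 0 x = 0" "killing x 0 = 0"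
  using killing_scale_left[of 0 0 x] killing_scale_right[of x 0 0] by simp_all

lemma killing_sum_right: "killing x (sum g A) = (\<Sum>a\<in>A. killing x (g a))"
  by (induction A rule: infinite_finite_induct) (simp_all add: killing_add_right)

text \<open>As \<open>p\<close> commutes with \<open>ad x\<close>, the trace of \<open>p \<circ> ad x \<circ> ad y - p \<circ> ad y \<circ> ad x\<close> vanishes by cyclicity.\<close>

lemma trace_bracket_commute:
  assumes "lin p" "\<And>v. p \<lbrace>x, v\<rbrace> = \<lbrace>x, p v\<rbrace>"
  shows "trace (\<lambda>v. p \<lbrace>\<lbrace>x, y\<rbrace>, v\<rbrace>) = 0"
proof -
  have "p \<lbrace>\<lbrace>x, y\<rbrace>, v\<rbrace> = \<lbrace>x, p \<lbrace>y, v\<rbrace>\<rbrace> - p \<lbrace>y, \<lbrace>x, v\<rbrace>\<rbrace>" for v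
  proof -
    have "p \<lbrace>x, \<lbrace>y, v\<rbrace>\<rbrace> = p \<lbrace>\<lbrace>x, y\<rbrace>, v\<rbrace> + p \<lbrace>y, \<lbrace>x, v\<rbrace>\<rbrace>"
      using assms(1) by (subst bracket_derivation) (simp add: lin_iff)
    then show ?thesis using assms(2) by simp
  qed
  then show ?thesis
    using trace_commute[OF lin_ad[of x] lin_compose[OF assms(1) lin_ad[of y]]]
    by (simp add: trace_diff)
qed

lemma killing_invariant: "killing \<lbrace>x, y\<rbrace> z = killing x \<lbrace>y, z\<rbrace>"
proof -
  have "killing \<lbrace>x, y\<rbrace> z = trace (\<lambda>v. \<lbrace>x, \<lbrace>y, \<lbrace>z, v\<rbrace>\<rbrace>\<rbrace>) - trace (\<lambda>v. \<lbrace>y, \<lbrace>x, \<lbrace>z, v\<rbrace>\<rbrace>\<rbrace>)"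
    unfolding killing_def trace_diff[symmetric]
    by (rule arg_cong[where f = trace], rule ext) (subst (2) bracket_derivation, simp)
  moreover have "killing x \<lbrace>y, z\<rbrace> = trace (\<lambda>v. \<lbrace>x, \<lbrace>y, \<lbrace>z, v\<rbrace>\<rbrace>\<rbrace>) - trace (\<lambda>v. \<lbrace>x, \<lbrace>z, \<lbrace>y, v\<rbrace>\<rbrace>\<rbrace>)"
    unfolding killing_def trace_diff[symmetric]
    by (rule arg_cong[where f = trace], rule ext)
      (subst (2) bracket_derivation, simp add: bracket_add_right)
  moreover have "trace (\<lambda>v. \<lbrace>y, \<lbrace>x, \<lbrace>z, v\<rbrace>\<rbrace>\<rbrace>) = trace (\<lambda>v. \<lbrace>x, \<lbrace>z, \<lbrace>y, v\<rbrace>\<rbrace>\<rbrace>)"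
    by (rule trace_commute[OF lin_ad lin_compose[OF lin_ad lin_ad]])
  ultimately show ?thesis by simp
qed

section \<open>Simultaneous eigenvectors\<close>

text \<open>Subtracting \<open>e a H\<close> times the sum from its image under \<open>H\<close> kills the component \<open>y a\<close>, so the
  claim follows by induction on the number of components. With \<open>S = {0}\<close> it says that
  eigenvectors to different eigenvalues are linearly independent.\<close>

lemma eigencomponents_in_stable_subspace:
  fixes e :: "'i \<Rightarrow> 'g \<Rightarrow> complex"
  assumes "finite J" and S: "subspace S"
    and stable: "\<And>H v. H \<in> K \<Longrightarrow> v \<in> S \<Longrightarrow> \<lbrace>H, v\<rbrace> \<in> S"
    and "\<And>i H. i \<in> J \<Longrightarrow> H \<in> K \<Longrightarrow> \<lbrace>H, y i\<rbrace> = e i H \<cdot> y i"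
    and "\<And>i j. i \<in> J \<Longrightarrow> j \<in> J \<Longrightarrow> i \<noteq> j \<Longrightarrow> \<exists>H\<in>K. e i H \<noteq> e j H"
    and "(\<Sum>i\<in>J. y i) \<in> S"
  shows "\<forall>i\<in>J. y i \<in> S"
  using assms(1,4-6)
proof (induction J arbitrary: y rule: finite_induct)
  case (insert a J)
  have y: "y i \<in> S" if i: "i \<in> J" for i
  proof -
    obtain H where H: "H \<in> K" "e i H \<noteq> e a H"
      using insert.prems(2)[of i a] insert.hyps i by blast
    define y' where "y' = (\<lambda>j. (e j H - e a H) \<cdot> y j)"
    have "(\<Sum>j\<in>insert a J. y' j) = \<lbrace>H, \<Sum>j\<in>insert a J. y j\<rbrace> - e a H \<cdot> (\<Sum>j\<in>insert a J. y j)"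
      unfolding bracket_sum_right scale_sum_right sum_subtractf[symmetric]
      by (rule sum.cong) (simp_all add: y'_def insert.prems(1)[OF _ H(1)] scale_left_diff_distrib)
    also have "\<dots> \<in> S"
      using insert.prems(3) S stable[OF H(1)] by (simp add: subspace_diff subspace_scale)
    finally have "(\<Sum>j\<in>J. y' j) \<in> S"
      using insert.hyps by (simp add: y'_def)
    moreover have "\<lbrace>H', y' j\<rbrace> = e j H' \<cdot> y' j" if "j \<in> J" "H' \<in> K" for j H'
      using insert.prems(1)[OF _ that(2), of j] that(1)
      by (simp add: y'_def bracket_scale_right mult.commute)
    ultimately have "\<forall>j\<in>J. y' j \<in> S"
      using insert.prems(2) by (intro insert.IH) auto
    then have "inverse (e i H - e a H) \<cdot> y' i \<in> S"
      using i S by (simp add: subspace_scale)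
    then show ?thesis using H(2) by (simp add: y'_def)
  qed
  then have "(\<Sum>j\<in>J. y j) \<in> S" using S by (simp add: subspace_sum)
  then have "(\<Sum>j\<in>insert a J. y j) - (\<Sum>j\<in>J. y j) \<in> S"
    using insert.prems(3) S by (blast intro: subspace_diff)
  then show ?case using y insert.hyps by simp
qed simp

lemma span_eigenvectors_decompose:
  assumes "lin f" "x \<in> span {x. \<exists>c. f x = c \<cdot> x}"
  shows "\<exists>D y. finite D \<and> (\<forall>d. f (y d) = d \<cdot> y d) \<and> x = (\<Sum>d\<in>D. y d)"
proof -
  have f0: "f 0 = 0" by (rule lin_zero[OF assms(1)])
  let ?Q = "\<lambda>x. \<exists>D y. finite D \<and> (\<forall>d. f (y d) = d \<cdot> y d) \<and> (\<forall>d. d \<notin> D \<longrightarrow> y d = 0) \<and>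
    x = (\<Sum>d\<in>D. y d)"
  have "?Q x"
  proof (rule span_induct[OF assms(2), of ?Q], unfold mem_Collect_eq)
    show "subspace {x. ?Q x}"
    proof (rule subspaceI, unfold mem_Collect_eq)
      show "?Q 0" using f0 by (intro exI[of _ "{}"] exI[of _ "\<lambda>_. 0"]) simp
    next
      fix u v assume "?Q u" "?Q v"
      then obtain D y D' y' where
        *: "finite D" "\<forall>d. f (y d) = d \<cdot> y d" "\<forall>d. d \<notin> D \<longrightarrow> y d = 0" "u = (\<Sum>d\<in>D. y d)"
        "finite D'" "\<forall>d. f (y' d) = d \<cdot> y' d" "\<forall>d. d \<notin> D' \<longrightarrow> y' d = 0" "v = (\<Sum>d\<in>D'. y' d)"
        by blast
      have "(\<Sum>d\<in>D. y d) = (\<Sum>d\<in>D \<union> D'. y d)" "(\<Sum>d\<in>D'. y' d) = (\<Sum>d\<in>D \<union> D'. y' d)"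
        using * by (auto intro!: sum.mono_neutral_left)
      then have "u + v = (\<Sum>d\<in>D \<union> D'. y d + y' d)" using * by (simp add: sum.distrib)
      then show "?Q (u + v)"
        using * assms(1)
        by (intro exI[of _ "D \<union> D'"] exI[of _ "\<lambda>d. y d + y' d"]) (auto simp: lin_iff scale_right_distrib)
    next
      fix c u assume "?Q u"
      then obtain D y where
        *: "finite D" "\<forall>d. f (y d) = d \<cdot> y d" "\<forall>d. d \<notin> D \<longrightarrow> y d = 0" "u = (\<Sum>d\<in>D. y d)"
        by blast
      then show "?Q (c \<cdot> u)"
        using assms(1)
        by (intro exI[of _ D] exI[of _ "\<lambda>d. c \<cdot> y d"]) (auto simp: lin_iff scale_sum_right scale_left_commute)
    qed
  next
    fix u assume "\<exists>c. f u = c \<cdot> u"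
    then obtain c where c: "f u = c \<cdot> u" by blast
    show "?Q u"
      using c f0 by (intro exI[of _ "{c}"] exI[of _ "\<lambda>d. if d = c then u else 0"]) auto
  qed
  then show ?thesis by blast
qed

lemma simultaneous_eigenvectors_span:
  assumes A: "finite A"
    and comm: "\<And>x y. x \<in> A \<Longrightarrow> y \<in> A \<Longrightarrow> \<lbrace>x, y\<rbrace> = 0"
    and diag: "\<And>x. x \<in> A \<Longrightarrow> diagonalizable (\<lambda>y. \<lbrace>x, y\<rbrace>)"
  shows "span {x. \<forall>H\<in>A. \<exists>c. \<lbrace>H, x\<rbrace> = c \<cdot> x} = UNIV"
  using assms
proof (induction A rule: finite_induct)
  case (insert a A)
  let ?E = "{x. \<forall>H\<in>insert a A. \<exists>c. \<lbrace>H, x\<rbrace> = c \<cdot> x}"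
  have IH: "span {x. \<forall>H\<in>A. \<exists>c. \<lbrace>H, x\<rbrace> = c \<cdot> x} = UNIV"
    using insert by (intro insert.IH) auto
  have "{x. \<forall>H\<in>A. \<exists>c. \<lbrace>H, x\<rbrace> = c \<cdot> x} \<subseteq> span ?E"
  proof
    fix x assume "x \<in> {x. \<forall>H\<in>A. \<exists>c. \<lbrace>H, x\<rbrace> = c \<cdot> x}"
    then have x: "\<forall>H\<in>A. \<exists>c. \<lbrace>H, x\<rbrace> = c \<cdot> x" by simp
    have "x \<in> span {x. \<exists>c. \<lbrace>a, x\<rbrace> = c \<cdot> x}"
      using insert.prems(2)[of a] by (simp add: diagonalizable_def)
    from span_eigenvectors_decompose[OF lin_ad this] obtain D y where
      y: "finite D" "\<forall>d. \<lbrace>a, y d\<rbrace> = d \<cdot> y d" "x = (\<Sum>d\<in>D. y d)" by blast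
    have "y d \<in> ?E" if d: "d \<in> D" for d
    proof -
      have "\<exists>c. \<lbrace>H, y d\<rbrace> = c \<cdot> y d" if H: "H \<in> A" for H
      proof -
        obtain c where c: "\<lbrace>H, x\<rbrace> = c \<cdot> x" using x H by blast
        have "\<forall>d\<in>D. y d \<in> {v. \<lbrace>H, v\<rbrace> = c \<cdot> v}"
        proof (rule eigencomponents_in_stable_subspace[where K = "{a}" and e = "\<lambda>d _. d"])
          show "subspace {v. \<lbrace>H, v\<rbrace> = c \<cdot> v}"
            by (rule subspaceI) (auto simp: bracket_add_right bracket_scale_right scale_right_distrib scale_left_commute)
          show "\<lbrace>a', v\<rbrace> \<in> {v. \<lbrace>H, v\<rbrace> = c \<cdot> v}" if "a' \<in> {a}" "v \<in> {v. \<lbrace>H, v\<rbrace> = c \<cdot> v}" for a' v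
            using that bracket_derivation[of H a v] insert.prems(1)[of H a] H
            by (simp add: bracket_scale_right)
        qed (use y c in auto)
        then show ?thesis using d by blast
      qed
      then show ?thesis using y by auto
    qed
    then have "(\<Sum>d\<in>D. y d) \<in> span ?E" by (intro span_sum span_base) auto
    then show "x \<in> span ?E" using y by simp
  qed
  from span_minimal[OF this subspace_span] show ?case using IH by blast
qed simp

end

section \<open>Weight spaces and nondegeneracy of the Killing form\<close>

context simple_lie_borel
begin

lemma ideal_trivial: "ideal_of I UNIV \<Longrightarrow> I = {0} \<or> I = UNIV"
  using simple unfolding simple_def by blast

lemma nonabelian: "\<exists>x y. \<lbrace>x, y\<rbrace> \<noteq> 0"
  using simple unfolding simple_def by blast

lemma subspace_cartan: "subspace \<hh>"
  using cartan unfolding cartan_subalgebra_def subalgebra_def by blast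

lemma cartan_abelian: "H \<in> \<hh> \<Longrightarrow> H' \<in> \<hh> \<Longrightarrow> \<lbrace>H, H'\<rbrace> = 0"
  using cartan unfolding cartan_subalgebra_def by blast

lemma cartan_self_centralizing: "(\<And>H. H \<in> \<hh> \<Longrightarrow> \<lbrace>H, x\<rbrace> = 0) \<Longrightarrow> x \<in> \<hh>"
  using cartan unfolding cartan_subalgebra_def by blast

lemma center_trivial:
  assumes "\<And>y. \<lbrace>x, y\<rbrace> = 0"
  shows "x = 0"
proof -
  let ?I = "{x. \<forall>y. \<lbrace>x, y\<rbrace> = 0}"
  have "subspace ?I"
    by (rule subspaceI) (auto simp: bracket_add_left bracket_scale_left)
  moreover have "\<lbrace>y, x\<rbrace> \<in> ?I" if "x \<in> ?I" for x y
    using that bracket_anticommute[of y x] by simp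
  ultimately have "ideal_of ?I UNIV" unfolding ideal_of_def by blast
  moreover have "?I \<noteq> UNIV" using nonabelian by blast
  ultimately have "?I = {0}" using ideal_trivial by blast
  then show ?thesis using assms by blast
qed

definition weight_space :: "('g \<Rightarrow> complex) \<Rightarrow> 'g set" where
  "weight_space \<mu> = {x. \<forall>H\<in>\<hh>. \<lbrace>H, x\<rbrace> = \<mu> H \<cdot> x}"

lemma subspace_weight_space: "subspace (weight_space \<mu>)"
  by (rule subspaceI)
    (auto simp: weight_space_def bracket_add_right bracket_scale_right scale_right_distrib scale_left_commute)

lemma weight_space_cong: "(\<And>H. H \<in> \<hh> \<Longrightarrow> \<mu> H = \<nu> H) \<Longrightarrow> weight_space \<mu> = weight_space \<nu>"
  by (auto simp: weight_space_def)

lemma weight_space_0: "weight_space (\<lambda>H. 0) = \<hh>"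
  using cartan_abelian cartan_self_centralizing by (auto simp: weight_space_def)

lemma bracket_weight_space:
  assumes "x \<in> weight_space \<mu>" "y \<in> weight_space \<nu>"
  shows "\<lbrace>x, y\<rbrace> \<in> weight_space (\<lambda>H. \<mu> H + \<nu> H)"
  using assms
  by (auto simp: weight_space_def bracket_derivation[of _ x y] bracket_scale_left bracket_scale_right
      scale_left_distrib)

definition weight_basis :: "'g set \<Rightarrow> ('g \<Rightarrow> 'g \<Rightarrow> complex) \<Rightarrow> bool" where
  "weight_basis B wt \<longleftrightarrow> is_basis B \<and> (\<forall>b\<in>B. b \<in> weight_space (wt b))"

text \<open>Simultaneous eigenvectors for a basis of the Cartan subalgebra are weight vectors.\<close>

lemma weight_basis_exists: "\<exists>B wt. weight_basis B wt"
proof -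
  obtain A where A: "A \<subseteq> \<hh>" "independent A" "\<hh> \<subseteq> span A"
    using maximal_independent_subset by blast
  let ?E = "{x. \<forall>H\<in>A. \<exists>c. \<lbrace>H, x\<rbrace> = c \<cdot> x}"
  have "diagonalizable (\<lambda>y. \<lbrace>x, y\<rbrace>)" if "x \<in> A" for x
    using cartan subsetD[OF A(1) that] unfolding cartan_subalgebra_def by blast
  then have E: "span ?E = UNIV"
    using finiteI_independent[OF A(2)] subsetD[OF A(1)] cartan_abelian
    by (intro simultaneous_eigenvectors_span) blast+
  obtain B where B: "B \<subseteq> ?E" "independent B" "?E \<subseteq> span B"
    using maximal_independent_subset by blast
  have "span B = UNIV"
    using span_minimal[OF B(3) subspace_span] E by blast
  then have basis: "is_basis B"
    using B finiteI_independent by (simp add: is_basis_def)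
  have "\<exists>\<mu>. b \<in> weight_space \<mu>" if b: "b \<in> B" for b
  proof -
    have "subspace {H. \<exists>c. \<lbrace>H, b\<rbrace> = c \<cdot> b}"
    proof (rule subspaceI, unfold mem_Collect_eq)
      show "\<exists>c. \<lbrace>0, b\<rbrace> = c \<cdot> b" by (rule exI[of _ 0]) simp
      show "\<exists>c. \<lbrace>x + y, b\<rbrace> = c \<cdot> b" if "\<exists>c. \<lbrace>x, b\<rbrace> = c \<cdot> b" "\<exists>c. \<lbrace>y, b\<rbrace> = c \<cdot> b" for x y
        using that by (metis bracket_add_left scale_left_distrib)
      show "\<exists>c'. \<lbrace>c \<cdot> x, b\<rbrace> = c' \<cdot> b" if "\<exists>c. \<lbrace>x, b\<rbrace> = c \<cdot> b" for c x
        using that by (metis bracket_scale_left scale_scale)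
    qed
    moreover have "A \<subseteq> {H. \<exists>c. \<lbrace>H, b\<rbrace> = c \<cdot> b}" using B b by blast
    ultimately have "\<forall>H\<in>\<hh>. \<exists>c. \<lbrace>H, b\<rbrace> = c \<cdot> b"
      using span_minimal A(3) by blast
    then obtain \<mu> where "\<forall>H\<in>\<hh>. \<lbrace>H, b\<rbrace> = \<mu> H \<cdot> b" by metis
    then show ?thesis by (auto simp: weight_space_def)
  qed
  then obtain wt where "\<forall>b\<in>B. b \<in> weight_space (wt b)" by metis
  then show ?thesis using basis by (auto simp: weight_basis_def)
qed

lemma weight_of_component:
  assumes B: "weight_basis B wt" and v: "v \<in> weight_space \<mu>"
    and b: "representation B v b \<noteq> 0" and H: "H \<in> \<hh>"
  shows "wt b H = \<mu> H"
proof -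
  have B': "is_basis B" using B by (simp add: weight_basis_def)
  have bB: "b \<in> B" using b representation_ne_zero by blast
  have "\<mu> H * representation B v b = representation B \<lbrace>H, v\<rbrace> b"
    using v H by (simp add: weight_space_def lin_representation[OF B'])
  also have "\<dots> = representation B \<lbrace>H, \<Sum>c\<in>B. representation B v c \<cdot> c\<rbrace> b"
    by (simp add: basis_expansion[OF B'])
  also have "\<dots> = (\<Sum>c\<in>B. representation B v c * wt c H * representation B c b)"
    using B H
    by (simp add: bracket_sum_right bracket_scale_right lin_representation[OF B'] weight_basis_def weight_space_def mult.assoc)
  also have "\<dots> = (\<Sum>c\<in>B. if c = b then representation B v b * wt b H else 0)"
    using B' by (intro sum.cong) (auto simp: is_basis_def representation_basis)
  also have "\<dots> = representation B v b * wt b H"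
    using bB B' by (simp add: is_basis_def)
  finally show ?thesis using b by simp
qed

text \<open>The projection onto the sum of the weight spaces whose weights satisfy \<open>Q\<close>, along the others.\<close>

definition weight_proj :: "'g set \<Rightarrow> ('g \<Rightarrow> 'g \<Rightarrow> complex) \<Rightarrow> (('g \<Rightarrow> complex) \<Rightarrow> bool) \<Rightarrow> 'g \<Rightarrow> 'g" where
  "weight_proj B wt Q v = (\<Sum>b | b \<in> B \<and> Q (wt b). representation B v b \<cdot> b)"

lemma lin_weight_proj:
  assumes "weight_basis B wt"
  shows "lin (weight_proj B wt Q)"
proof -
  have "is_basis B" using assms by (simp add: weight_basis_def)
  then show ?thesis
    by (simp add: lin_iff weight_proj_def lin_representation scale_left_distrib sum.distrib scale_sum_right)
qed

lemma weight_proj_eq: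
  assumes B: "weight_basis B wt" and Q: "\<And>\<mu> \<nu>. (\<forall>H\<in>\<hh>. \<mu> H = \<nu> H) \<Longrightarrow> Q \<mu> = Q \<nu>"
    and v: "v \<in> weight_space \<mu>"
  shows "weight_proj B wt Q v = (if Q \<mu> then v else 0)"
proof -
  have B': "is_basis B" using B by (simp add: weight_basis_def)
  have *: "Q (wt b) = Q \<mu>" if "representation B v b \<noteq> 0" for b
    using weight_of_component[OF B v that] Q by blast
  show ?thesis
  proof (cases "Q \<mu>")
    case True
    have "weight_proj B wt Q v = (\<Sum>b\<in>B. representation B v b \<cdot> b)"
      unfolding weight_proj_def using B' * True
      by (intro sum.mono_neutral_left) (auto simp: is_basis_def)
    then show ?thesis using True basis_expansion[OF B'] by simp
  next
    case False
    then have "representation B v b = 0" if "Q (wt b)" for b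
      using * that by blast
    then show ?thesis unfolding weight_proj_def using False by (simp add: sum.neutral)
  qed
qed

lemma weight_basis_nonzero_component:
  assumes "weight_basis B wt" "v \<noteq> 0"
  obtains b where "b \<in> B" "representation B v b \<noteq> 0"
proof -
  have "is_basis B" using assms by (simp add: weight_basis_def)
  then have "(\<Sum>b\<in>B. representation B v b \<cdot> b) \<noteq> 0" using basis_expansion assms(2) by simp
  then show ?thesis using that by (metis (no_types, lifting) scale_zero_left sum.neutral)
qed

text \<open>The sum of the weight spaces for the weights \<open>\<beta> + k \<alpha>\<close> is stable under \<open>x\<close> and \<open>y\<close>, so the
  commutator \<open>[x, y]\<close> has trace \<open>0\<close> on it; but this trace is a positive multiple of \<open>\<beta>\<close> plus an
  integral multiple of \<open>\<alpha>\<close>, evaluated at \<open>[x, y]\<close>.\<close>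

lemma weight_string_real_ratio:
  assumes x: "x \<in> weight_space \<alpha>" and y: "y \<in> weight_space (\<lambda>H. - \<alpha> H)"
    and v: "v \<in> weight_space \<beta>" "v \<noteq> 0"
  shows "\<exists>r::real. \<beta> \<lbrace>x, y\<rbrace> = of_real r * \<alpha> \<lbrace>x, y\<rbrace>"
proof -
  obtain B wt where B: "weight_basis B wt" using weight_basis_exists by blast
  then have B': "is_basis B" and wtb: "\<And>b. b \<in> B \<Longrightarrow> b \<in> weight_space (wt b)"
    by (auto simp: weight_basis_def)
  define h0 where "h0 = \<lbrace>x, y\<rbrace>"
  have h0: "h0 \<in> \<hh>"
    using bracket_weight_space[OF x y] weight_space_0 by (simp add: h0_def)
  define Q where "Q = (\<lambda>\<mu>. \<exists>k::int. \<forall>H\<in>\<hh>. \<mu> H = \<beta> H + of_int k * \<alpha> H)"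
  have Qcong: "Q \<mu> = Q \<nu>" if "\<forall>H\<in>\<hh>. \<mu> H = \<nu> H" for \<mu> \<nu>
    using that by (simp add: Q_def)
  have Qshift: "Q (\<lambda>H. \<mu> H + \<alpha> H) = Q \<mu>" for \<mu>
  proof
    assume "Q (\<lambda>H. \<mu> H + \<alpha> H)"
    then obtain k :: int where "\<forall>H\<in>\<hh>. \<mu> H + \<alpha> H = \<beta> H + of_int k * \<alpha> H" by (auto simp: Q_def)
    then have "\<forall>H\<in>\<hh>. \<mu> H = \<beta> H + of_int (k - 1) * \<alpha> H" by (simp add: algebra_simps)
    then show "Q \<mu>" unfolding Q_def by blast
  next
    assume "Q \<mu>"
    then obtain k :: int where "\<forall>H\<in>\<hh>. \<mu> H = \<beta> H + of_int k * \<alpha> H" by (auto simp: Q_def)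
    then have "\<forall>H\<in>\<hh>. \<mu> H + \<alpha> H = \<beta> H + of_int (k + 1) * \<alpha> H" by (simp add: algebra_simps)
    then show "Q (\<lambda>H. \<mu> H + \<alpha> H)" unfolding Q_def by blast
  qed
  let ?p = "weight_proj B wt Q"
  have linp: "lin ?p" by (rule lin_weight_proj[OF B])
  have comm: "?p \<lbrace>x, u\<rbrace> = \<lbrace>x, ?p u\<rbrace>" for u
  proof (rule lin_eq_on_basis[OF B' lin_compose[OF linp lin_ad] lin_compose[OF lin_ad linp]])
    fix b assume b: "b \<in> B"
    have "\<lbrace>x, b\<rbrace> \<in> weight_space (\<lambda>H. wt b H + \<alpha> H)"
      using bracket_weight_space[OF x wtb[OF b]] by (simp add: add.commute)
    from weight_proj_eq[OF B Qcong this] weight_proj_eq[OF B Qcong wtb[OF b]]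
    show "?p \<lbrace>x, b\<rbrace> = \<lbrace>x, ?p b\<rbrace>" by (simp add: Qshift)
  qed
  let ?B' = "{b \<in> B. Q (wt b)}"
  have finB: "finite B" using B' by (simp add: is_basis_def)
  have "0 = trace (\<lambda>v. ?p \<lbrace>h0, v\<rbrace>)"
    unfolding h0_def by (rule trace_bracket_commute[OF linp comm, symmetric])
  also have "\<dots> = (\<Sum>b\<in>B. representation B (?p \<lbrace>h0, b\<rbrace>) b)"
    by (subst trace_eq_trace_on[OF B' lin_compose[OF linp lin_ad]]) (simp add: trace_on_def)
  also have "\<dots> = (\<Sum>b\<in>B. if Q (wt b) then wt b h0 else 0)"
  proof (rule sum.cong)
    fix b assume b: "b \<in> B"
    have "?p \<lbrace>h0, b\<rbrace> = wt b h0 \<cdot> ?p b"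
      using wtb[OF b] h0 linp by (simp add: weight_space_def lin_iff)
    also have "?p b = (if Q (wt b) then b else 0)"
      by (rule weight_proj_eq[OF B Qcong wtb[OF b]])
    finally show "representation B (?p \<lbrace>h0, b\<rbrace>) b = (if Q (wt b) then wt b h0 else 0)"
      using B' b by (simp add: is_basis_def lin_representation[OF B'] representation_basis representation_zero)
  qed simp
  also have "\<dots> = (\<Sum>b\<in>?B'. wt b h0)"
    using finB by (simp add: sum.inter_filter)
  finally have sum0: "(\<Sum>b\<in>?B'. wt b h0) = 0" by simp
  have "\<forall>b\<in>?B'. \<exists>k::int. wt b h0 = \<beta> h0 + of_int k * \<alpha> h0"
    using h0 by (auto simp: Q_def)
  then obtain k :: "'g \<Rightarrow> int" where k: "\<And>b. b \<in> ?B' \<Longrightarrow> wt b h0 = \<beta> h0 + of_int (k b) * \<alpha> h0"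
    by metis
  have "of_nat (card ?B') * \<beta> h0 + of_int (\<Sum>b\<in>?B'. k b) * \<alpha> h0 = 0"
    using sum0 k by (simp add: sum.distrib sum_distrib_right)
  moreover have "card ?B' \<noteq> 0"
  proof -
    obtain b where b: "b \<in> B" "representation B v b \<noteq> 0"
      using weight_basis_nonzero_component[OF B v(2)] by blast
    then have "\<forall>H\<in>\<hh>. wt b H = \<beta> H + of_int 0 * \<alpha> H"
      using weight_of_component[OF B v(1)] by simp
    then have "b \<in> ?B'" using b unfolding Q_def by blast
    then show ?thesis using finB by auto
  qed
  ultimately have "\<beta> h0 = of_real (- real_of_int (\<Sum>b\<in>?B'. k b) / real (card ?B')) * \<alpha> h0"
    by (simp add: field_simps eq_neg_iff_add_eq_0)
  then show ?thesis unfolding h0_def by blast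
qed

lemma killing_cartan_weights:
  assumes B: "weight_basis B wt" and H: "H \<in> \<hh>" "H' \<in> \<hh>"
  shows "killing H H' = (\<Sum>b\<in>B. wt b H * wt b H')"
proof -
  have B': "is_basis B" using B by (simp add: weight_basis_def)
  have "killing H H' = trace_on B (\<lambda>z. \<lbrace>H, \<lbrace>H', z\<rbrace>\<rbrace>)"
    unfolding killing_def by (rule trace_eq_trace_on[OF B' lin_compose[OF lin_ad lin_ad]])
  also have "\<dots> = (\<Sum>b\<in>B. wt b H * wt b H')"
    unfolding trace_on_def
  proof (rule sum.cong)
    fix b assume b: "b \<in> B"
    have "\<lbrace>H, \<lbrace>H', b\<rbrace>\<rbrace> = (wt b H * wt b H') \<cdot> b"
      using B b H by (simp add: weight_basis_def weight_space_def bracket_scale_right mult.commute)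
    then show "representation B \<lbrace>H, \<lbrace>H', b\<rbrace>\<rbrace> b = wt b H * wt b H'"
      using B' b by (simp add: lin_representation[OF B'] is_basis_def representation_basis)
  qed simp
  finally show ?thesis .
qed

text \<open>With \<open>h = [x, y]\<close>, every weight is a real multiple \<open>r\<close> of \<open>\<alpha>\<close> at \<open>h\<close>, so the form at \<open>h\<close> is
  \<open>\<alpha>(h)\<^sup>2\<close> times a sum of squares \<open>r\<^sup>2\<close>, among which \<open>\<alpha>\<close> itself contributes \<open>1\<close>. If \<open>\<alpha>(h) = 0\<close>, then all
  weights vanish at \<open>h\<close> and \<open>h\<close> is central.\<close>

lemma killing_bracket_opposite_weights:
  assumes x: "x \<in> weight_space \<alpha>" "x \<noteq> 0" and y: "y \<in> weight_space (\<lambda>H. - \<alpha> H)"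
  shows "\<exists>s::real. s \<ge> 1 \<and> killing \<lbrace>x, y\<rbrace> \<lbrace>x, y\<rbrace> = of_real s * (\<alpha> \<lbrace>x, y\<rbrace>)\<^sup>2"
    and "\<alpha> \<lbrace>x, y\<rbrace> = 0 \<Longrightarrow> \<lbrace>x, y\<rbrace> = 0"
proof -
  obtain B wt where B: "weight_basis B wt" using weight_basis_exists by blast
  then have B': "is_basis B" and wtb: "\<And>b. b \<in> B \<Longrightarrow> b \<in> weight_space (wt b)"
    by (auto simp: weight_basis_def)
  define h0 where "h0 = \<lbrace>x, y\<rbrace>"
  have h0: "h0 \<in> \<hh>"
    using bracket_weight_space[OF x(1) y] weight_space_0 by (simp add: h0_def)
  have b0: "b \<noteq> 0" if "b \<in> B" for b
    using that B' dependent_zero by (auto simp: is_basis_def)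
  have "\<exists>r::real. wt b h0 = of_real r * \<alpha> h0" if "b \<in> B" for b
    unfolding h0_def by (rule weight_string_real_ratio[OF x(1) y wtb[OF that] b0[OF that]])
  then obtain r :: "'g \<Rightarrow> real" where r: "\<And>b. b \<in> B \<Longrightarrow> wt b h0 = of_real (r b) * \<alpha> h0" by metis
  show "\<lbrace>x, y\<rbrace> = 0" if "\<alpha> \<lbrace>x, y\<rbrace> = 0"
  proof (rule center_trivial)
    fix v
    show "\<lbrace>\<lbrace>x, y\<rbrace>, v\<rbrace> = 0"
    proof (rule lin_eq_on_basis[OF B' lin_ad])
      show "lin (\<lambda>v. 0)" by (simp add: lin_iff)
      show "\<lbrace>\<lbrace>x, y\<rbrace>, b\<rbrace> = 0" if b: "b \<in> B" for b
        using wtb[OF b] h0 r[OF b] \<open>\<alpha> \<lbrace>x, y\<rbrace> = 0\<close> by (simp add: weight_space_def h0_def)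
    qed
  qed
  show "\<exists>s::real. s \<ge> 1 \<and> killing \<lbrace>x, y\<rbrace> \<lbrace>x, y\<rbrace> = of_real s * (\<alpha> \<lbrace>x, y\<rbrace>)\<^sup>2"
  proof (cases "\<alpha> h0 = 0")
    case True
    then show ?thesis using \<open>\<alpha> \<lbrace>x, y\<rbrace> = 0 \<Longrightarrow> \<lbrace>x, y\<rbrace> = 0\<close> by (intro exI[of _ 1]) (simp add: h0_def)
  next
    case False
    obtain b where b: "b \<in> B" "representation B x b \<noteq> 0"
      using weight_basis_nonzero_component[OF B x(2)] by blast
    then have "wt b h0 = \<alpha> h0"
      using weight_of_component[OF B x(1) b(2) h0] by simp
    then have "r b = 1" using r[OF b(1)] False by simp
    then have "(r b)\<^sup>2 = 1" by simp
    then have "(\<Sum>b\<in>B. (r b)\<^sup>2) \<ge> 1"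
      using member_le_sum[of b B "\<lambda>b. (r b)\<^sup>2"] b(1) B' by (simp add: is_basis_def)
    moreover have "killing h0 h0 = of_real (\<Sum>b\<in>B. (r b)\<^sup>2) * (\<alpha> h0)\<^sup>2"
      unfolding killing_cartan_weights[OF B h0 h0] of_real_sum sum_distrib_right
      by (rule sum.cong) (simp_all add: r power2_eq_square)
    ultimately show ?thesis unfolding h0_def by blast
  qed
qed

text \<open>The radical of the Killing form is an ideal. Were it everything, then all brackets of
  opposite weight spaces would vanish, so that nothing in the derived algebra would have weight
  \<open>0\<close>. But the derived algebra is a nonzero ideal, hence everything; so the Cartan subalgebra would
  be \<open>0\<close> and, being its own centralizer, everything at the same time.\<close>

theorem killing_nondegenerate:
  assumes "\<And>y. killing x y = 0"
  shows "x = 0"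
proof -
  let ?R = "{x. \<forall>y. killing x y = 0}"
  have "subspace ?R"
    by (rule subspaceI) (auto simp: killing_add_left killing_scale_left)
  moreover have "\<lbrace>y, x\<rbrace> \<in> ?R" if "x \<in> ?R" for x y
    using that killing_invariant[of x y] bracket_anticommute[of y x] by (simp add: killing_minus_left)
  ultimately have "ideal_of ?R UNIV" unfolding ideal_of_def by blast
  moreover have "?R \<noteq> UNIV"
  proof
    assume R: "?R = UNIV"
    obtain B wt where B: "weight_basis B wt" using weight_basis_exists by blast
    then have B': "is_basis B" and wtb: "\<And>b. b \<in> B \<Longrightarrow> b \<in> weight_space (wt b)"
      by (auto simp: weight_basis_def)
    have opp: "\<lbrace>x, y\<rbrace> = 0"
      if xy: "x \<in> weight_space \<alpha>" "y \<in> weight_space (\<lambda>H. - \<alpha> H)" for x y \<alpha>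
    proof (cases "x = 0")
      case False
      obtain s :: real where "s \<ge> 1" "killing \<lbrace>x, y\<rbrace> \<lbrace>x, y\<rbrace> = of_real s * (\<alpha> \<lbrace>x, y\<rbrace>)\<^sup>2"
        using killing_bracket_opposite_weights(1)[OF xy(1) False xy(2)] by blast
      moreover have "killing \<lbrace>x, y\<rbrace> \<lbrace>x, y\<rbrace> = 0" using R by blast
      ultimately have "\<alpha> \<lbrace>x, y\<rbrace> = 0" by simp
      then show ?thesis by (rule killing_bracket_opposite_weights(2)[OF xy(1) False xy(2)])
    qed simp
    define Q where "Q = (\<lambda>\<mu> :: 'g \<Rightarrow> complex. \<forall>H\<in>\<hh>. \<mu> H = 0)"
    have Qcong: "Q \<mu> = Q \<nu>" if "\<forall>H\<in>\<hh>. \<mu> H = \<nu> H" for \<mu> \<nu>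
      using that by (simp add: Q_def)
    let ?p = "weight_proj B wt Q"
    have linp: "lin ?p" by (rule lin_weight_proj[OF B])
    have lin0: "lin (\<lambda>v. 0)" by (simp add: lin_iff)
    have pb: "?p \<lbrace>b, c\<rbrace> = 0" if b: "b \<in> B" and c: "c \<in> B" for b c
    proof (cases "Q (\<lambda>H. wt b H + wt c H)")
      case True
      then have "weight_space (wt c) = weight_space (\<lambda>H. - wt b H)"
        by (intro weight_space_cong) (simp add: Q_def eq_neg_iff_add_eq_0 add.commute)
      then have "\<lbrace>b, c\<rbrace> = 0" using opp wtb b c by blast
      then show ?thesis using lin_zero[OF linp] by simp
    next
      case False
      then show ?thesis
        using weight_proj_eq[OF B Qcong bracket_weight_space[OF wtb[OF b] wtb[OF c]]] by simp
    qed
    have pbv: "?p \<lbrace>b, v\<rbrace> = 0" if b: "b \<in> B" for b v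
      by (rule lin_eq_on_basis[OF B' lin_compose[OF linp lin_ad] lin0 pb[OF b]])
    have pvb: "?p \<lbrace>v, b\<rbrace> = 0" if b: "b \<in> B" for b v
      using pbv[OF b, of v] lin_minus[OF linp] by (subst bracket_anticommute) simp
    have puv: "?p \<lbrace>u, v\<rbrace> = 0" for u v
      by (rule lin_eq_on_basis[OF B' lin_compose[OF linp lin_ad] lin0 pvb])
    have "ideal_of (bracket_span UNIV UNIV) UNIV"
      unfolding ideal_of_def bracket_span_def by (blast intro: span_base)
    moreover have "bracket_span UNIV UNIV \<noteq> {0}"
    proof -
      obtain u v where "\<lbrace>u, v\<rbrace> \<noteq> 0" using nonabelian by blast
      moreover have "\<lbrace>u, v\<rbrace> \<in> bracket_span UNIV UNIV"
        unfolding bracket_span_def by (rule span_base) blast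
      ultimately show ?thesis by blast
    qed
    ultimately have "bracket_span UNIV UNIV = UNIV" using ideal_trivial by blast
    moreover have "bracket_span UNIV UNIV \<subseteq> {v. ?p v = 0}"
      unfolding bracket_span_def
    proof (rule span_minimal)
      show "subspace {v. ?p v = 0}"
        using linp lin_zero[OF linp] by (intro subspaceI) (auto simp: lin_iff)
    qed (use puv in auto)
    ultimately have p0: "?p v = 0" for v by blast
    have "H = 0" if "H \<in> \<hh>" for H
    proof -
      have "?p H = H"
        using weight_proj_eq[of B wt Q H "\<lambda>H. 0", OF B Qcong] that weight_space_0
        by (simp add: Q_def)
      then show ?thesis using p0 by simp
    qed
    then have "\<lbrace>H, x\<rbrace> = 0" if "H \<in> \<hh>" for H x
      using that bracket_zero_left by metis
    then have "x \<in> \<hh>" for x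
      by (rule cartan_self_centralizing)
    then show False using nonabelian cartan_abelian by blast
  qed
  ultimately have "?R = {0}" using ideal_trivial by blast
  then show ?thesis using assms by blast
qed

section \<open>Roots as elements of the Cartan subalgebra\<close>

lemma killing_weight_orthogonal:
  assumes "x \<in> weight_space \<mu>" "y \<in> weight_space \<nu>" "H \<in> \<hh>" "\<mu> H + \<nu> H \<noteq> 0"
  shows "killing x y = 0"
proof -
  have "\<mu> H * killing x y = killing \<lbrace>H, x\<rbrace> y"
    using assms by (simp add: weight_space_def killing_scale_left)
  also have "\<dots> = - killing x \<lbrace>H, y\<rbrace>"
    using killing_invariant[of x H y] bracket_anticommute[of H x] by (simp add: killing_minus_left)
  also have "\<dots> = - (\<nu> H * killing x y)"
    using assms by (simp add: weight_space_def killing_scale_right)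
  finally show ?thesis using assms(4) by (simp add: eq_neg_iff_add_eq_0 ring_distribs[symmetric])
qed

lemma opposite_weight_vector:
  assumes x: "x \<in> weight_space \<mu>" "x \<noteq> 0"
  shows "\<exists>y\<in>weight_space (\<lambda>H. - \<mu> H). killing x y = 1"
proof -
  obtain B wt where B: "weight_basis B wt" using weight_basis_exists by blast
  then have B': "is_basis B" and wtb: "\<And>b. b \<in> B \<Longrightarrow> b \<in> weight_space (wt b)"
    by (auto simp: weight_basis_def)
  obtain y where "killing x y \<noteq> 0" using killing_nondegenerate x(2) by blast
  moreover have "killing x y = (\<Sum>b\<in>B. representation B y b * killing x b)"
    by (subst basis_expansion[OF B', of y, symmetric]) (simp add: killing_sum_right killing_scale_right)
  ultimately obtain b where b: "b \<in> B" "killing x b \<noteq> 0" by (metis (no_types, lifting) mult_zero_right sum.neutral)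
  then have "wt b H = - \<mu> H" if "H \<in> \<hh>" for H
    using killing_weight_orthogonal[OF x(1) wtb[OF b(1)] that] by (auto simp: eq_neg_iff_add_eq_0 add.commute)
  then have "b \<in> weight_space (\<lambda>H. - \<mu> H)"
    using wtb[OF b(1)] weight_space_cong[of "wt b" "\<lambda>H. - \<mu> H"] by simp
  then have "(1 / killing x b) \<cdot> b \<in> weight_space (\<lambda>H. - \<mu> H)"
    by (rule subspace_scale[OF subspace_weight_space])
  then show ?thesis using b by (intro bexI[of _ "(1 / killing x b) \<cdot> b"]) (simp_all add: killing_scale_right)
qed

lemma root_space_eq_weight_space: "root_space t = weight_space (killing t)"
  by (simp add: root_space_def weight_space_def)

lemma root_space_0: "root_space 0 = \<hh>"
  using weight_space_0 by (simp add: root_space_def weight_space_def)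

lemma subspace_root_space: "subspace (root_space t)"
  by (simp add: root_space_eq_weight_space subspace_weight_space)

lemma root_space_minus: "root_space (- t) = weight_space (\<lambda>H. - killing t H)"
  by (simp add: root_space_def weight_space_def killing_minus_left)

lemma bracket_root_space:
  "x \<in> root_space s \<Longrightarrow> y \<in> root_space t \<Longrightarrow> \<lbrace>x, y\<rbrace> \<in> root_space (s + t)"
  using bracket_weight_space[of x "killing s" y "killing t"]
  by (simp add: root_space_def weight_space_def killing_add_left)

lemma killing_nondegenerate_cartan:
  assumes t: "t \<in> \<hh>" and "\<And>H. H \<in> \<hh> \<Longrightarrow> killing t H = 0"
  shows "t = 0"
proof (rule ccontr)
  assume "t \<noteq> 0"
  then obtain y where "y \<in> weight_space (\<lambda>H. - 0)" "killing t y = 1"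
    using opposite_weight_vector[of t "\<lambda>H. 0"] t weight_space_0 by blast
  then show False using assms(2)[of y] weight_space_0 by simp
qed

text \<open>The bracket of opposite weight vectors on which the Killing form is \<open>1\<close> represents their
  weight, by invariance of the form.\<close>

lemma weight_represented:
  assumes x: "x \<in> weight_space \<mu>" "x \<noteq> 0"
  shows "\<exists>t\<in>\<hh>. \<forall>H\<in>\<hh>. killing t H = \<mu> H"
proof -
  obtain y where y: "y \<in> weight_space (\<lambda>H. - \<mu> H)" "killing x y = 1"
    using opposite_weight_vector[OF x] by blast
  have "\<lbrace>x, y\<rbrace> \<in> \<hh>" using bracket_weight_space[OF x(1) y(1)] weight_space_0 by simp
  moreover have "killing \<lbrace>x, y\<rbrace> H = \<mu> H" if H: "H \<in> \<hh>" for H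
  proof -
    have "\<lbrace>y, H\<rbrace> = \<mu> H \<cdot> y"
      using y(1) H bracket_anticommute[of y H] by (simp add: weight_space_def)
    then show ?thesis using killing_invariant[of x y H] y(2) by (simp add: killing_scale_right)
  qed
  ultimately show ?thesis by blast
qed

definition root_basis :: "'g set \<Rightarrow> ('g \<Rightarrow> 'g) \<Rightarrow> bool" where
  "root_basis B rt \<longleftrightarrow> is_basis B \<and> (\<forall>b\<in>B. rt b \<in> \<hh> \<and> b \<in> root_space (rt b))"

lemma root_basis_exists: "\<exists>B rt. root_basis B rt"
proof -
  obtain B wt where B: "weight_basis B wt" using weight_basis_exists by blast
  then have B': "is_basis B" and wtb: "\<And>b. b \<in> B \<Longrightarrow> b \<in> weight_space (wt b)"
    by (auto simp: weight_basis_def)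
  have "b \<noteq> 0" if "b \<in> B" for b
    using that B' dependent_zero by (auto simp: is_basis_def)
  then have "\<forall>b\<in>B. \<exists>t. t \<in> \<hh> \<and> (\<forall>H\<in>\<hh>. killing t H = wt b H)"
    using weight_represented[OF wtb] by blast
  then obtain rt where rt: "\<And>b. b \<in> B \<Longrightarrow> rt b \<in> \<hh> \<and> (\<forall>H\<in>\<hh>. killing (rt b) H = wt b H)" by metis
  have "b \<in> root_space (rt b)" if "b \<in> B" for b
    using rt[OF that] wtb[OF that] by (simp add: root_space_def weight_space_def)
  then show ?thesis using rt B' by (auto simp: root_basis_def)
qed

lemma root_basis_weight_basis: "root_basis B rt \<Longrightarrow> weight_basis B (\<lambda>b. killing (rt b))"
  by (simp add: root_basis_def weight_basis_def root_space_eq_weight_space)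

lemma killing_cartan_eq_iff:
  assumes "s \<in> \<hh>" "t \<in> \<hh>"
  shows "s = t \<longleftrightarrow> (\<forall>H\<in>\<hh>. killing s H = killing t H)"
  using killing_nondegenerate_cartan[of "s - t"] assms subspace_diff[OF subspace_cartan]
  by (auto simp: killing_diff_left)

lemma root_of_component:
  assumes "root_basis B rt" "v \<in> root_space t" "t \<in> \<hh>" "representation B v b \<noteq> 0"
  shows "rt b = t"
proof -
  have "rt b \<in> \<hh>" using assms(1,4) representation_ne_zero by (auto simp: root_basis_def)
  then show ?thesis
    using weight_of_component[OF root_basis_weight_basis[OF assms(1)], of v "killing t" b] assms
      killing_cartan_eq_iff[of "rt b" t]
    by (simp add: root_space_eq_weight_space)
qed

lemma roots_in_cartan: "\<alpha> \<in> roots \<Longrightarrow> \<alpha> \<in> \<hh>"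
  by (simp add: roots_def)

lemma roots_nonzero: "\<alpha> \<in> roots \<Longrightarrow> \<alpha> \<noteq> 0"
  by (simp add: roots_def)

lemma root_vector:
  assumes "\<alpha> \<in> roots"
  obtains x where "x \<in> root_space \<alpha>" "x \<noteq> 0"
  using assms subspace_0[OF subspace_root_space, of \<alpha>] by (auto simp: roots_def)

lemma rootI: "t \<in> \<hh> \<Longrightarrow> t \<noteq> 0 \<Longrightarrow> x \<in> root_space t \<Longrightarrow> x \<noteq> 0 \<Longrightarrow> t \<in> roots"
  by (auto simp: roots_def)

lemma root_basis_roots:
  assumes "root_basis B rt"
  shows "roots \<subseteq> rt ` B" and "rt ` B \<subseteq> insert 0 roots"
proof -
  show "roots \<subseteq> rt ` B"
  proof
    fix \<alpha> assume a: "\<alpha> \<in> roots"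
    then obtain x where x: "x \<in> root_space \<alpha>" "x \<noteq> 0" by (rule root_vector)
    obtain b where "b \<in> B" "representation B x b \<noteq> 0"
      using weight_basis_nonzero_component[OF root_basis_weight_basis[OF assms] x(2)] by blast
    then show "\<alpha> \<in> rt ` B"
      using root_of_component[OF assms x(1) roots_in_cartan[OF a]] by force
  qed
  have "b \<noteq> 0" if "b \<in> B" for b
    using that assms dependent_zero by (auto simp: root_basis_def is_basis_def)
  then show "rt ` B \<subseteq> insert 0 roots"
    using assms rootI by (auto simp: root_basis_def)
qed

lemma finite_roots: "finite roots"
proof -
  obtain B rt where "root_basis B rt" using root_basis_exists by blast
  then show ?thesis
    using finite_subset[OF root_basis_roots(1)] by (auto simp: root_basis_def is_basis_def)
qed

lemma bracket_opposite_root_spaces: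
  assumes "\<alpha> \<in> \<hh>" and x: "x \<in> root_space \<alpha>" and y: "y \<in> root_space (- \<alpha>)"
  shows "\<lbrace>x, y\<rbrace> = killing x y \<cdot> \<alpha>"
proof -
  have "\<lbrace>x, y\<rbrace> \<in> \<hh>" using bracket_root_space[OF x y] root_space_0 by simp
  moreover have "killing \<lbrace>x, y\<rbrace> H = killing (killing x y \<cdot> \<alpha>) H" if H: "H \<in> \<hh>" for H
  proof -
    have "\<lbrace>y, H\<rbrace> = killing \<alpha> H \<cdot> y"
      using y H bracket_anticommute[of y H] by (simp add: root_space_def killing_minus_left)
    then show ?thesis
      using killing_invariant[of x y H] by (simp add: killing_scale_right killing_scale_left)
  qed
  ultimately show ?thesis
    using killing_cartan_eq_iff assms(1) subspace_scale[OF subspace_cartan] by blast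
qed

lemma opposite_root_vector:
  assumes "x \<in> root_space \<alpha>" "x \<noteq> 0"
  shows "\<exists>y\<in>root_space (- \<alpha>). killing x y = 1"
  using opposite_weight_vector[of x "killing \<alpha>"] assms
  by (simp add: root_space_minus root_space_eq_weight_space[symmetric])

lemma roots_minus: "\<alpha> \<in> roots \<Longrightarrow> - \<alpha> \<in> roots"
proof -
  assume a: "\<alpha> \<in> roots"
  then obtain x where "x \<in> root_space \<alpha>" "x \<noteq> 0" by (rule root_vector)
  then obtain y where "y \<in> root_space (- \<alpha>)" "killing x y = 1"
    using opposite_root_vector by blast
  then show ?thesis
    using a subspace_neg[OF subspace_cartan] by (intro rootI[of _ y]) (auto simp: roots_def)
qed

text \<open>Writing \<open>\<alpha> = [x, y]\<close> with \<open>x\<close>, \<open>y\<close> in the root spaces of \<open>\<plusminus>\<alpha>\<close>, the string argument gives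
  \<open>(\<beta>, \<alpha>) = r\<^sub>\<beta> (\<alpha>, \<alpha>)\<close> with real \<open>r\<^sub>\<beta>\<close>, whence \<open>(\<alpha>, \<alpha>) = (\<alpha>, \<alpha>)\<^sup>2 \<Sum> r\<^sub>\<beta>\<^sup>2\<close>.\<close>

lemma killing_root_positive:
  assumes a: "\<alpha> \<in> roots"
  shows "\<exists>c::real. c > 0 \<and> killing \<alpha> \<alpha> = of_real c"
    and "\<beta> \<in> roots \<Longrightarrow> killing \<beta> \<alpha> \<in> \<real>"
proof -
  obtain x where x: "x \<in> root_space \<alpha>" "x \<noteq> 0" using a by (rule root_vector)
  obtain y where y: "y \<in> root_space (- \<alpha>)" "killing x y = 1"
    using opposite_root_vector[OF x] by blast
  have xy: "\<lbrace>x, y\<rbrace> = \<alpha>"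
    using bracket_opposite_root_spaces[OF roots_in_cartan[OF a] x(1) y(1)] y(2) by simp
  have xw: "x \<in> weight_space (killing \<alpha>)" and yw: "y \<in> weight_space (\<lambda>H. - killing \<alpha> H)"
    using x y by (simp_all add: root_space_minus[symmetric] root_space_eq_weight_space[symmetric])
  obtain s :: real where s: "s \<ge> 1" "killing \<alpha> \<alpha> = of_real s * (killing \<alpha> \<alpha>)\<^sup>2"
    using killing_bracket_opposite_weights(1)[OF xw x(2) yw] unfolding xy by blast
  have "killing \<alpha> \<alpha> \<noteq> 0"
    using killing_bracket_opposite_weights(2)[OF xw x(2) yw] roots_nonzero[OF a] unfolding xy by blast
  then have "killing \<alpha> \<alpha> = of_real (1 / s)"
    using s by (simp add: power2_eq_square field_simps)
  then show pos: "\<exists>c::real. c > 0 \<and> killing \<alpha> \<alpha> = of_real c"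
    using s(1) by (intro exI[of _ "1 / s"]) auto
  show "killing \<beta> \<alpha> \<in> \<real>" if b: "\<beta> \<in> roots"
  proof -
    obtain v where "v \<in> root_space \<beta>" "v \<noteq> 0" using b by (rule root_vector)
    then obtain r :: real where "killing \<beta> \<alpha> = of_real r * killing \<alpha> \<alpha>"
      using weight_string_real_ratio[OF xw yw, of v "killing \<beta>"] unfolding xy
      by (auto simp: root_space_eq_weight_space)
    then show ?thesis using pos by auto
  qed
qed

end

section \<open>Representations of \<open>sl\<^sub>2\<close> and the root system\<close>

context lie_algebra
begin

text \<open>The usual computation in a highest weight module: \<open>e f\<^sup>k\<^sup>+\<^sup>1 x = (k + 1) (m - k) f\<^sup>k x\<close>, so if
  \<open>f\<^sup>k x\<close> is the last nonzero vector, then \<open>m = k\<close>.\<close>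

lemma highest_weight_natural:
  assumes ef: "\<lbrace>e, f\<rbrace> = h" and hf: "\<lbrace>h, f\<rbrace> = (- 2) \<cdot> f"
    and x: "\<lbrace>e, x\<rbrace> = 0" "\<lbrace>h, x\<rbrace> = m \<cdot> x" "x \<noteq> 0"
    and nilp: "((\<lambda>v. \<lbrace>f, v\<rbrace>) ^^ N) x = 0"
  shows "\<exists>n::nat. m = of_nat n \<and> (\<forall>j\<le>n. ((\<lambda>v. \<lbrace>f, v\<rbrace>) ^^ j) x \<noteq> 0)"
proof -
  define y where "y k = ((\<lambda>v. \<lbrace>f, v\<rbrace>) ^^ k) x" for k
  have y0: "y 0 = x" and ySuc: "y (Suc k) = \<lbrace>f, y k\<rbrace>" for k
    by (simp_all add: y_def)
  have hy: "\<lbrace>h, y k\<rbrace> = (m - 2 * of_nat k) \<cdot> y k" for k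
  proof (induction k)
    case (Suc k)
    have "\<lbrace>h, y (Suc k)\<rbrace> = \<lbrace>\<lbrace>h, f\<rbrace>, y k\<rbrace> + \<lbrace>f, \<lbrace>h, y k\<rbrace>\<rbrace>"
      unfolding ySuc by (rule bracket_derivation)
    also have "\<dots> = (- 2) \<cdot> \<lbrace>f, y k\<rbrace> + (m - 2 * of_nat k) \<cdot> \<lbrace>f, y k\<rbrace>"
      unfolding hf Suc bracket_scale_left bracket_scale_right ..
    also have "\<dots> = (- 2 + (m - 2 * of_nat k)) \<cdot> \<lbrace>f, y k\<rbrace>"
      by (rule scale_left_distrib[symmetric])
    also have "- 2 + (m - 2 * of_nat k) = m - 2 * of_nat (Suc k)" by simp
    finally show ?case by (simp only: ySuc)
  qed (simp add: y0 x)
  have ey: "\<lbrace>e, y (Suc k)\<rbrace> = ((of_nat k + 1) * (m - of_nat k)) \<cdot> y k" for k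
  proof (induction k)
    case 0
    show ?case unfolding ySuc by (subst bracket_derivation) (simp add: ef y0 x)
  next
    case (Suc k)
    have "\<lbrace>e, y (Suc (Suc k))\<rbrace> = \<lbrace>h, y (Suc k)\<rbrace> + \<lbrace>f, \<lbrace>e, y (Suc k)\<rbrace>\<rbrace>"
      unfolding ef[symmetric] by (subst ySuc) (rule bracket_derivation)
    also have "\<dots> = (m - 2 * of_nat (Suc k)) \<cdot> y (Suc k) + ((of_nat k + 1) * (m - of_nat k)) \<cdot> y (Suc k)"
      unfolding hy Suc by (simp add: bracket_scale_right ySuc)
    also have "\<dots> = ((of_nat (Suc k) + 1) * (m - of_nat (Suc k))) \<cdot> y (Suc k)"
      unfolding scale_left_distrib[symmetric] by (simp add: algebra_simps)
    finally show ?case .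
  qed
  define M where "M = (LEAST k. y k = 0)"
  have "y M = 0" unfolding M_def by (rule LeastI[of _ N]) (simp add: y_def nilp)
  then have "M \<noteq> 0" using y0 x(3) by metis
  then obtain n where n: "M = Suc n" using not0_implies_Suc by blast
  have nz: "y j \<noteq> 0" if "j \<le> n" for j
    using not_less_Least[of j "\<lambda>k. y k = 0"] that n unfolding M_def by simp
  have "((of_nat n + 1) * (m - of_nat n)) \<cdot> y n = 0"
    using ey[of n] \<open>y M = 0\<close> n by simp
  then have "(of_nat n + 1) * (m - of_nat n) = 0" using nz by simp
  moreover have "(of_nat n + 1 :: complex) \<noteq> 0"
    by (metis of_nat_Suc of_nat_neq_0 add.commute)
  ultimately have "m = of_nat n" by simp
  then show ?thesis using nz unfolding y_def by blast
qed

end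

context simple_lie_borel
begin

lemmas cartan_add = subspace_add[OF subspace_cartan]
  and cartan_diff = subspace_diff[OF subspace_cartan]
  and cartan_scale = subspace_scale[OF subspace_cartan]

lemma killing_root_self:
  assumes "\<alpha> \<in> roots"
  shows "killing \<alpha> \<alpha> \<noteq> 0" "killing \<alpha> (coroot \<alpha>) = 2" "killing (coroot \<alpha>) \<alpha> = 2"
proof -
  show *: "killing \<alpha> \<alpha> \<noteq> 0" using killing_root_positive(1)[OF assms] by auto
  show "killing \<alpha> (coroot \<alpha>) = 2" "killing (coroot \<alpha>) \<alpha> = 2"
    using * by (simp_all add: coroot_def killing_scale_right killing_scale_left)
qed

lemma coroot_in_cartan: "\<alpha> \<in> roots \<Longrightarrow> coroot \<alpha> \<in> \<hh>"
  by (simp add: coroot_def subspace_scale[OF subspace_cartan] roots_in_cartan)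

lemma coroot_minus: "coroot (- \<alpha>) = - coroot \<alpha>"
  by (simp add: coroot_def killing_minus_left killing_minus_right)

lemma bracket_coroot:
  "\<alpha> \<in> roots \<Longrightarrow> x \<in> root_space \<beta> \<Longrightarrow> \<lbrace>coroot \<alpha>, x\<rbrace> = killing \<beta> (coroot \<alpha>) \<cdot> x"
  using coroot_in_cartan by (simp add: root_space_def)

lemma sl2_triple:
  assumes a: "\<alpha> \<in> roots" and e: "e \<in> root_space \<alpha>" "e \<noteq> 0"
  obtains f where "f \<in> root_space (- \<alpha>)" "\<lbrace>e, f\<rbrace> = coroot \<alpha>" "\<lbrace>coroot \<alpha>, f\<rbrace> = (- 2) \<cdot> f"
proof -
  obtain y where y: "y \<in> root_space (- \<alpha>)" "killing e y = 1"
    using opposite_root_vector[OF e] by blast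
  let ?f = "(2 / killing \<alpha> \<alpha>) \<cdot> y"
  have f: "?f \<in> root_space (- \<alpha>)"
    using y subspace_scale[OF subspace_root_space] by blast
  show ?thesis
  proof (rule that[OF f])
    show "\<lbrace>e, ?f\<rbrace> = coroot \<alpha>"
      using bracket_opposite_root_spaces[OF roots_in_cartan[OF a] e(1) f] y(2)
      by (simp add: killing_scale_right coroot_def)
    show "\<lbrace>coroot \<alpha>, ?f\<rbrace> = (- 2) \<cdot> ?f"
      using bracket_coroot[OF a f] killing_root_self[OF a] by (simp add: killing_minus_left)
  qed
qed

lemma root_space_nonroot: "t \<in> \<hh> \<Longrightarrow> t \<noteq> 0 \<Longrightarrow> t \<notin> roots \<Longrightarrow> root_space t = {0}"
  by (simp add: roots_def)

lemma power_ad_root_space: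
  assumes "f \<in> root_space \<gamma>" "x \<in> root_space \<beta>"
  shows "((\<lambda>v. \<lbrace>f, v\<rbrace>) ^^ k) x \<in> root_space (\<beta> + of_nat k \<cdot> \<gamma>)"
proof (induction k)
  case (Suc k)
  have "of_nat (Suc k) \<cdot> \<gamma> = \<gamma> + of_nat k \<cdot> \<gamma>" by (simp add: scale_left_distrib)
  then show ?case using bracket_root_space[OF assms(1) Suc] by (simp add: add.left_commute)
qed (simp add: assms)

lemma ad_root_vector_nilpotent:
  assumes f: "f \<in> root_space \<gamma>" "\<gamma> \<in> roots" and x: "x \<in> root_space \<beta>" "\<beta> \<in> \<hh>"
  shows "\<exists>k. ((\<lambda>v. \<lbrace>f, v\<rbrace>) ^^ k) x = 0"
proof -
  have "inj (\<lambda>k::nat. \<beta> + of_nat k \<cdot> \<gamma>)"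
    using roots_nonzero[OF f(2)] by (simp add: inj_on_def)
  then have "infinite (range (\<lambda>k::nat. \<beta> + of_nat k \<cdot> \<gamma>))"
    by (simp add: finite_image_iff)
  then have "\<not> range (\<lambda>k::nat. \<beta> + of_nat k \<cdot> \<gamma>) \<subseteq> insert 0 roots"
    using finite_roots finite_subset by blast
  then obtain k :: nat where k: "\<beta> + of_nat k \<cdot> \<gamma> \<notin> insert 0 roots" by auto
  have "\<beta> + of_nat k \<cdot> \<gamma> \<in> \<hh>"
    by (intro cartan_add cartan_scale roots_in_cartan f x)
  then have "root_space (\<beta> + of_nat k \<cdot> \<gamma>) = {0}" using k root_space_nonroot by blast
  then show ?thesis using power_ad_root_space[OF f(1) x(1)] by blast
qed

lemma highest_root_vector_weight:
  assumes a: "\<alpha> \<in> roots" and e: "e \<in> root_space \<alpha>" "e \<noteq> 0"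
    and x: "x \<in> root_space \<beta>" "\<beta> \<in> \<hh>" "x \<noteq> 0" "\<lbrace>e, x\<rbrace> = 0"
  shows "\<exists>n::nat. killing \<beta> (coroot \<alpha>) = of_nat n \<and>
    (\<forall>j\<le>n. \<exists>v\<in>root_space (\<beta> - of_nat j \<cdot> \<alpha>). v \<noteq> 0)"
proof -
  obtain f where f: "f \<in> root_space (- \<alpha>)" "\<lbrace>e, f\<rbrace> = coroot \<alpha>" "\<lbrace>coroot \<alpha>, f\<rbrace> = (- 2) \<cdot> f"
    by (rule sl2_triple[OF a e])
  obtain N where "((\<lambda>v. \<lbrace>f, v\<rbrace>) ^^ N) x = 0"
    using ad_root_vector_nilpotent[OF f(1) roots_minus[OF a] x(1,2)] by blast
  then obtain n where n: "killing \<beta> (coroot \<alpha>) = of_nat n" "\<forall>j\<le>n. ((\<lambda>v. \<lbrace>f, v\<rbrace>) ^^ j) x \<noteq> 0"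
    using highest_weight_natural[OF f(2,3) x(4) bracket_coroot[OF a x(1)] x(3)] by blast
  then show ?thesis using power_ad_root_space[OF f(1) x(1)] by fastforce
qed

text \<open>Going up from \<open>\<gg>\<^sub>\<beta>\<close> as far as possible, say to \<open>\<beta> + p \<alpha>\<close>, reaches a highest weight vector, whose
  weight is a natural number \<open>m\<close>; so \<open>(\<beta>, \<alpha>\<^sup>\<or>) = m - 2 p\<close>. Going down from there gives the reflected
  weight if it lies below \<open>\<beta>\<close>; the other case is the same with \<open>- \<alpha>\<close> for \<open>\<alpha>\<close>.\<close>

lemma root_string:
  assumes a: "\<alpha> \<in> roots" and b: "\<beta> \<in> roots"
  shows "\<exists>n::int. killing \<beta> (coroot \<alpha>) = of_int n \<and>
    (n \<ge> 0 \<longrightarrow> (\<exists>v\<in>root_space (\<beta> - of_int n \<cdot> \<alpha>). v \<noteq> 0))"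
proof -
  obtain e where e: "e \<in> root_space \<alpha>" "e \<noteq> 0" using a by (rule root_vector)
  obtain x where x: "x \<in> root_space \<beta>" "x \<noteq> 0" using b by (rule root_vector)
  define y where "y k = ((\<lambda>v. \<lbrace>e, v\<rbrace>) ^^ k) x" for k
  define M where "M = (LEAST k. y k = 0)"
  have "\<exists>k. y k = 0"
    using ad_root_vector_nilpotent[OF e(1) a x(1) roots_in_cartan[OF b]] by (simp add: y_def)
  then have yM: "y M = 0" unfolding M_def by (rule LeastI_ex)
  moreover have "y 0 \<noteq> 0" using x(2) by (simp add: y_def)
  ultimately have "M \<noteq> 0" by metis
  then obtain p where p: "M = Suc p" using not0_implies_Suc by blast
  have yp: "y p \<noteq> 0" using not_less_Least[of p "\<lambda>k. y k = 0"] p unfolding M_def by simp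
  have ey: "\<lbrace>e, y p\<rbrace> = 0" using yM p by (simp add: y_def)
  let ?\<gamma> = "\<beta> + of_nat p \<cdot> \<alpha>"
  have g: "?\<gamma> \<in> \<hh>"
    by (intro cartan_add cartan_scale roots_in_cartan a b)
  obtain m :: nat where m: "killing ?\<gamma> (coroot \<alpha>) = of_nat m"
      "\<forall>j\<le>m. \<exists>v\<in>root_space (?\<gamma> - of_nat j \<cdot> \<alpha>). v \<noteq> 0"
    using highest_root_vector_weight[OF a e _ g yp ey] power_ad_root_space[OF e(1) x(1), of p]
    unfolding y_def[symmetric] by blast
  have "killing \<beta> (coroot \<alpha>) = of_int (int m - 2 * int p)"
    using m(1) killing_root_self(2)[OF a] by (simp add: killing_add_left killing_scale_left algebra_simps)
  moreover have "\<exists>v\<in>root_space (\<beta> - of_int (int m - 2 * int p) \<cdot> \<alpha>). v \<noteq> 0" if "int m - 2 * int p \<ge> 0"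
  proof -
    have "of_nat (m - p) = complex_of_int (int m - 2 * int p) + of_nat p"
      using that by (simp add: of_nat_diff)
    then have "?\<gamma> - of_nat (m - p) \<cdot> \<alpha> = \<beta> - of_int (int m - 2 * int p) \<cdot> \<alpha>"
      by (simp only: scale_left_distrib) simp
    moreover have "\<exists>v\<in>root_space (?\<gamma> - of_nat (m - p) \<cdot> \<alpha>). v \<noteq> 0"
      using m(2) by simp
    ultimately show ?thesis by (simp only:)
  qed
  ultimately show ?thesis by (intro exI[of _ "int m - 2 * int p"] conjI impI)
qed

subsection \<open>Reflections\<close>

lemma lin_reflection: "lin (reflection \<alpha>)"
  by (simp add: lin_iff reflection_def killing_add_left killing_scale_left scale_left_distrib
      scale_right_diff_distrib)

lemma reflection_minus_root: "reflection (- \<alpha>) = reflection \<alpha>"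
  by (simp add: fun_eq_iff reflection_def coroot_minus killing_minus_right)

lemma reflection_self: "\<alpha> \<in> roots \<Longrightarrow> reflection \<alpha> \<alpha> = - \<alpha>"
  using scale_left_distrib[of 1 1 \<alpha>] by (simp add: reflection_def killing_root_self)

lemma reflection_involution: "\<alpha> \<in> roots \<Longrightarrow> reflection \<alpha> (reflection \<alpha> x) = x"
  using scale_left_distrib[of "killing x (coroot \<alpha>)" "killing x (coroot \<alpha>)" \<alpha>]
  by (simp add: reflection_def killing_diff_left killing_scale_left killing_root_self mult_2_right)

lemma killing_reflection:
  assumes "\<alpha> \<in> roots"
  shows "killing (reflection \<alpha> x) (reflection \<alpha> y) = killing x y"
  using killing_root_self(1)[OF assms] killing_sym[of \<alpha> y]
  by (simp add: reflection_def killing_diff_left killing_diff_right killing_scale_left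
      killing_scale_right coroot_def field_simps)

lemma reflection_root:
  assumes a: "\<alpha> \<in> roots" and b: "\<beta> \<in> roots"
  shows "reflection \<alpha> \<beta> \<in> roots"
proof -
  have "\<exists>v\<in>root_space (reflection \<alpha> \<beta>). v \<noteq> 0"
  proof -
    obtain n :: int where n: "killing \<beta> (coroot \<alpha>) = of_int n"
        "n \<ge> 0 \<longrightarrow> (\<exists>v\<in>root_space (\<beta> - of_int n \<cdot> \<alpha>). v \<noteq> 0)"
      using root_string[OF a b] by (elim exE conjE) (rule that)
    obtain n' :: int where n': "killing \<beta> (coroot (- \<alpha>)) = of_int n'"
        "n' \<ge> 0 \<longrightarrow> (\<exists>v\<in>root_space (\<beta> - of_int n' \<cdot> (- \<alpha>)). v \<noteq> 0)"
      using root_string[OF roots_minus[OF a] b] by (elim exE conjE) (rule that)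
    have "(of_int n' :: complex) = of_int (- n)" using n(1) n'(1) by (simp add: coroot_minus killing_minus_right)
    then have "n' = - n" by (simp only: of_int_eq_iff)
    then show ?thesis using n n'(2) by (cases "n \<ge> 0") (auto simp: reflection_def)
  qed
  moreover have "reflection \<alpha> \<beta> \<in> \<hh>"
    unfolding reflection_def by (intro cartan_diff cartan_scale roots_in_cartan a b)
  moreover have "reflection \<alpha> \<beta> \<noteq> 0"
    using reflection_involution[OF a, of \<beta>] lin_zero[OF lin_reflection, of \<alpha>] roots_nonzero[OF b] by auto
  ultimately show ?thesis using rootI by blast
qed

lemma killing_coroot_integer:
  assumes "\<alpha> \<in> roots" "\<beta> \<in> roots"
  shows "\<exists>n::int. killing \<beta> (coroot \<alpha>) = of_int n"
  using root_string[OF assms] by (elim exE conjE) (rule exI)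

text \<open>A vector of weight \<open>-\<alpha>\<close> orthogonal to \<open>e \<in> \<gg>\<^sub>\<alpha>\<close> would be a highest weight vector of weight
  \<open>-2\<close>.\<close>

lemma root_space_line:
  assumes a: "\<alpha> \<in> roots" and x: "x \<in> root_space \<alpha>" "x \<noteq> 0" and y: "y \<in> root_space \<alpha>"
  shows "\<exists>c. y = c \<cdot> x"
proof -
  note a' = roots_minus[OF a]
  obtain e where e: "e \<in> root_space (- \<alpha>)" "killing x e = 1"
    using opposite_root_vector[OF x] by blast
  then have "e \<noteq> 0" by auto
  define v where "v = y - killing y e \<cdot> x"
  have v: "v \<in> root_space \<alpha>"
    unfolding v_def by (intro subspace_diff subspace_scale subspace_root_space x y)
  have "killing e v = 0"
    using e(2) killing_sym[of e v] by (simp add: v_def killing_diff_left killing_scale_left)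
  then have ev: "\<lbrace>e, v\<rbrace> = 0"
    using bracket_opposite_root_spaces[of "- \<alpha>" e v] e(1) v roots_in_cartan[OF a'] by simp
  have "v = 0"
  proof (rule ccontr)
    assume "v \<noteq> 0"
    then obtain n :: nat where "killing \<alpha> (coroot (- \<alpha>)) = of_nat n"
      using highest_root_vector_weight[OF a' e(1) \<open>e \<noteq> 0\<close> v roots_in_cartan[OF a] _ ev] by blast
    then have "(of_int (- 2) :: complex) = of_int (int n)"
      using killing_root_self(2)[OF a] by (simp add: coroot_minus killing_minus_right)
    then show False by (simp only: of_int_eq_iff)
  qed
  then show ?thesis by (auto simp: v_def)
qed

text \<open>Otherwise \<open>y\<close> would be a highest weight vector of negative weight.\<close>

lemma bracket_root_vectors_nonzero:
  assumes a: "\<alpha> \<in> roots" and b: "\<beta> \<in> roots" and neg: "Re (killing \<beta> (coroot \<alpha>)) < 0"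
    and x: "x \<in> root_space \<alpha>" "x \<noteq> 0" and y: "y \<in> root_space \<beta>" "y \<noteq> 0"
  shows "\<lbrace>x, y\<rbrace> \<noteq> 0"
proof
  assume "\<lbrace>x, y\<rbrace> = 0"
  then obtain n :: nat where "killing \<beta> (coroot \<alpha>) = of_nat n"
    using highest_root_vector_weight[OF a x y(1) roots_in_cartan[OF b] y(2)] by blast
  then show False using neg by simp
qed

text \<open>For \<open>y\<close> of weight \<open>2 \<alpha>\<close>, integrality excludes the weight \<open>3 \<alpha>\<close>, so \<open>[e, y] = 0\<close>; and
  \<open>[f, y]\<close> is a multiple of \<open>e\<close>, so \<open>[e, [f, y]] = 0\<close>. But \<open>[e, [f, y]] = [[e, f], y] = 4 y\<close>.\<close>

lemma double_root_not_root:
  assumes a: "\<alpha> \<in> roots"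
  shows "of_nat 2 \<cdot> \<alpha> \<notin> roots"
proof
  assume b: "of_nat 2 \<cdot> \<alpha> \<in> roots"
  note kaa = killing_root_self(1)[OF a]
  obtain e where e: "e \<in> root_space \<alpha>" "e \<noteq> 0" using a by (rule root_vector)
  obtain f where f: "f \<in> root_space (- \<alpha>)" "\<lbrace>e, f\<rbrace> = coroot \<alpha>" by (rule sl2_triple[OF a e])
  obtain y where y: "y \<in> root_space (of_nat 2 \<cdot> \<alpha>)" "y \<noteq> 0" using b by (rule root_vector)
  have three: "3 \<cdot> \<alpha> \<notin> roots"
  proof
    assume c: "3 \<cdot> \<alpha> \<in> roots"
    obtain n :: int where "killing \<alpha> (coroot (3 \<cdot> \<alpha>)) = of_int n"
      using killing_coroot_integer[OF c a] by blast
    moreover have "3 * killing \<alpha> (coroot (3 \<cdot> \<alpha>)) = 2"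
      using kaa by (simp add: coroot_def killing_scale_left killing_scale_right)
    ultimately have "(of_int (3 * n) :: complex) = of_int 2" by simp
    then have "3 * n = 2" by (simp only: of_int_eq_iff)
    then show False by presburger
  qed
  have "\<lbrace>e, y\<rbrace> \<in> root_space (3 \<cdot> \<alpha>)"
    using bracket_root_space[OF e(1) y(1)] scale_left_distrib[of 1 2 \<alpha>] by simp
  then have ey: "\<lbrace>e, y\<rbrace> = 0"
    using root_space_nonroot[of "3 \<cdot> \<alpha>"] three roots_in_cartan[OF a] roots_nonzero[OF a]
      subspace_scale[OF subspace_cartan] by auto
  have "\<lbrace>f, y\<rbrace> \<in> root_space \<alpha>"
    using bracket_root_space[OF f(1) y(1)] scale_left_distrib[of 1 1 \<alpha>] by simp
  then obtain c where "\<lbrace>f, y\<rbrace> = c \<cdot> e" using root_space_line[OF a e] by blast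
  then have "\<lbrace>e, \<lbrace>f, y\<rbrace>\<rbrace> = 0" by (simp add: bracket_scale_right bracket_self)
  moreover have "\<lbrace>e, \<lbrace>f, y\<rbrace>\<rbrace> = 4 \<cdot> y"
    unfolding bracket_derivation[of e]
    using bracket_coroot[OF a y(1)] killing_root_self(2)[OF a] by (simp add: f(2) ey killing_scale_left)
  ultimately show False using y(2) by simp
qed

lemma root_multiple:
  assumes a: "\<alpha> \<in> roots" and b: "of_nat k \<cdot> \<alpha> \<in> roots"
  shows "k = 1"
proof -
  note kaa = killing_root_self(1)[OF a]
  have k0: "k \<noteq> 0" using roots_nonzero[OF b] by auto
  obtain n :: int where "killing \<alpha> (coroot (of_nat k \<cdot> \<alpha>)) = of_int n"
    using killing_coroot_integer[OF b a] by blast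
  moreover have "of_nat k * killing \<alpha> (coroot (of_nat k \<cdot> \<alpha>)) = 2"
    using kaa k0 by (simp add: coroot_def killing_scale_left killing_scale_right)
  ultimately have "(of_int (int k * n) :: complex) = of_int 2" by simp
  then have "int k * n = 2" by (simp only: of_int_eq_iff)
  then have "int k dvd 2" by (metis dvd_triv_left)
  then have "k dvd 2" by (metis int_dvd_int_iff of_nat_numeral)
  then have "k \<le> 2" by (rule dvd_imp_le) simp
  then have "k = 1 \<or> k = 2" using k0 by linarith
  then show ?thesis using double_root_not_root[OF a] b by blast
qed

subsection \<open>The real form\<close>

lemma pair_add_left: "pair (x + y) z = pair x z + pair y z"
  and pair_add_right: "pair z (x + y) = pair z x + pair z y"
  and pair_diff_left: "pair (x - y) z = pair x z - pair y z"
  and pair_diff_right: "pair z (x - y) = pair z x - pair z y"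
  and pair_minus_left: "pair (- x) z = - pair x z"
  and pair_minus_right: "pair z (- x) = - pair z x"
  and pair_scale_left: "pair (complex_of_real r \<cdot> x) z = r * pair x z"
  and pair_scale_right: "pair z (complex_of_real r \<cdot> x) = r * pair z x"
  and pair_sum_right: "pair z (sum g A) = (\<Sum>a\<in>A. pair z (g a))"
  by (simp_all add: pair_def killing_add_left killing_add_right killing_diff_left killing_diff_right
      killing_minus_left killing_minus_right killing_scale_left killing_scale_right
      killing_sum_right)

lemma pair_zero [simp]: "pair 0 x = 0" "pair x 0 = 0"
  by (simp_all add: pair_def)

lemma pair_sym: "pair x y = pair y x"
  by (simp add: pair_def killing_sym[of x y])

lemma pair_scale_of_nat: "pair (of_nat n \<cdot> x) y = real n * pair x y"
  and pair_scale_of_int: "pair (of_int k \<cdot> x) y = real_of_int k * pair x y"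
  using pair_scale_left[of "real n" x y] pair_scale_left[of "real_of_int k" x y] by simp_all

lemma pair_root_self_pos: "\<alpha> \<in> roots \<Longrightarrow> pair \<alpha> \<alpha> > 0"
  using killing_root_positive(1)[of \<alpha>] by (auto simp: pair_def)

lemma killing_roots_real: "\<alpha> \<in> roots \<Longrightarrow> \<beta> \<in> roots \<Longrightarrow> killing \<alpha> \<beta> = of_real (pair \<alpha> \<beta>)"
  using killing_root_positive(2)[of \<beta> \<alpha>] by (simp add: pair_def)

lemma coroot_real: "\<alpha> \<in> roots \<Longrightarrow> coroot \<alpha> = complex_of_real (2 / pair \<alpha> \<alpha>) \<cdot> \<alpha>"
  by (simp add: coroot_def killing_roots_real)

lemma vector_space_real: "vector_space (\<lambda>r x. complex_of_real r \<cdot> x)"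
  by unfold_locales (simp_all add: scale_right_distrib scale_left_distrib)

lemma h_real_0: "0 \<in> h_real"
  and h_real_add: "x \<in> h_real \<Longrightarrow> y \<in> h_real \<Longrightarrow> x + y \<in> h_real"
  and h_real_scale: "x \<in> h_real \<Longrightarrow> complex_of_real r \<cdot> x \<in> h_real"
  and h_real_minus: "x \<in> h_real \<Longrightarrow> - x \<in> h_real"
  and h_real_diff: "x \<in> h_real \<Longrightarrow> y \<in> h_real \<Longrightarrow> x - y \<in> h_real"
  and h_real_sum: "(\<And>i. i \<in> I \<Longrightarrow> g i \<in> h_real) \<Longrightarrow> sum g I \<in> h_real"
  and h_real_coroot: "\<alpha> \<in> roots \<Longrightarrow> coroot \<alpha> \<in> h_real"
proof -
  interpret R: vector_space "\<lambda>r x. complex_of_real r \<cdot> x" by (rule vector_space_real)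
  show "0 \<in> h_real" "x \<in> h_real \<Longrightarrow> y \<in> h_real \<Longrightarrow> x + y \<in> h_real"
    "x \<in> h_real \<Longrightarrow> complex_of_real r \<cdot> x \<in> h_real" "x \<in> h_real \<Longrightarrow> - x \<in> h_real"
    "x \<in> h_real \<Longrightarrow> y \<in> h_real \<Longrightarrow> x - y \<in> h_real"
    "(\<And>i. i \<in> I \<Longrightarrow> g i \<in> h_real) \<Longrightarrow> sum g I \<in> h_real" "\<alpha> \<in> roots \<Longrightarrow> coroot \<alpha> \<in> h_real"
    unfolding h_real_def
    by (auto intro: R.span_zero R.span_add R.span_scale R.span_neg R.span_diff R.span_sum R.span_base)
qed

lemma h_real_induct [consumes 1, case_names zero add scale coroot]:
  assumes "x \<in> h_real" and "Q 0" "\<And>x y. Q x \<Longrightarrow> Q y \<Longrightarrow> Q (x + y)"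
    and "\<And>r x. Q x \<Longrightarrow> Q (complex_of_real r \<cdot> x)" and "\<And>\<alpha>. \<alpha> \<in> roots \<Longrightarrow> Q (coroot \<alpha>)"
  shows "Q x"
proof -
  interpret R: vector_space "\<lambda>r x. complex_of_real r \<cdot> x" by (rule vector_space_real)
  have "R.subspace {x. Q x}" using assms(2-4) by (intro R.subspaceI) auto
  from R.span_minimal[OF _ this, of "coroot ` roots"] show ?thesis
    using assms(1,5) unfolding h_real_def by blast
qed

lemma h_real_roots:
  assumes a: "\<alpha> \<in> roots"
  shows "\<alpha> \<in> h_real"
proof -
  have "complex_of_real (pair \<alpha> \<alpha> / 2) \<cdot> coroot \<alpha> \<in> h_real"
    using a by (intro h_real_scale h_real_coroot)
  then show ?thesis using pair_root_self_pos[OF a] by (simp add: coroot_real[OF a])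
qed

lemma h_real_in_cartan: "x \<in> h_real \<Longrightarrow> x \<in> \<hh>"
  by (induction rule: h_real_induct)
    (simp_all add: subspace_0[OF subspace_cartan] cartan_add cartan_scale coroot_in_cartan)

lemma killing_h_real_root:
  assumes "x \<in> h_real" "\<beta> \<in> roots"
  shows "killing x \<beta> = of_real (pair x \<beta>)"
proof -
  have "killing x \<beta> \<in> \<real>" using assms(1)
    by (induction rule: h_real_induct)
      (simp_all add: killing_add_left killing_scale_left coroot_real killing_roots_real assms(2))
  then show ?thesis by (simp add: pair_def)
qed

lemma reflection_h_real:
  assumes "x \<in> h_real" "\<alpha> \<in> roots"
  shows "reflection \<alpha> x = x - complex_of_real (2 * pair x \<alpha> / pair \<alpha> \<alpha>) \<cdot> \<alpha>"
  using assms by (simp add: reflection_def coroot_real killing_scale_right killing_h_real_root mult.commute)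

lemma reflection_in_h_real: "x \<in> h_real \<Longrightarrow> \<alpha> \<in> roots \<Longrightarrow> reflection \<alpha> x \<in> h_real"
  unfolding reflection_h_real by (rule h_real_diff) (auto intro: h_real_scale h_real_roots simp del: of_real_divide of_real_mult)

lemma pair_h_real_sum_squares:
  assumes B: "root_basis B rt" and x: "x \<in> h_real"
  shows "pair x x = (\<Sum>b\<in>B. (pair x (rt b))\<^sup>2)"
proof -
  have "killing (rt b) x = of_real (pair x (rt b))" if "b \<in> B" for b
  proof (cases "rt b = 0")
    case False
    then have "rt b \<in> roots" using root_basis_roots(2)[OF B] that by blast
    then show ?thesis using killing_h_real_root[OF x] killing_sym by metis
  qed simp
  then have "killing x x = of_real (\<Sum>b\<in>B. (pair x (rt b))\<^sup>2)"
    unfolding killing_cartan_weights[OF root_basis_weight_basis[OF B] h_real_in_cartan[OF x] h_real_in_cartan[OF x]]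
    by (simp add: power2_eq_square)
  then show ?thesis by (simp add: pair_def)
qed

lemma pair_nonneg: "x \<in> h_real \<Longrightarrow> pair x x \<ge> 0"
  using root_basis_exists pair_h_real_sum_squares by (metis sum_nonneg zero_le_power2)

lemma h_real_eq_0I:
  assumes x: "x \<in> h_real" and "\<And>\<alpha>. \<alpha> \<in> roots \<Longrightarrow> pair x \<alpha> = 0"
  shows "x = 0"
proof -
  obtain B rt where B: "root_basis B rt" using root_basis_exists by blast
  have z: "killing (rt b) x = 0" if "b \<in> B" for b
  proof (cases "rt b = 0")
    case False
    then have "rt b \<in> roots" using root_basis_roots(2)[OF B] that by blast
    then show ?thesis using killing_h_real_root[OF x] assms(2) killing_sym[of x] by simp
  qed simp
  have "killing x H = 0" if "H \<in> \<hh>" for H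
    using killing_cartan_weights[OF root_basis_weight_basis[OF B] h_real_in_cartan[OF x] that] z by simp
  then show ?thesis using killing_nondegenerate_cartan[OF h_real_in_cartan[OF x]] by blast
qed

lemma pair_eq_0_iff:
  assumes x: "x \<in> h_real"
  shows "pair x x = 0 \<longleftrightarrow> x = 0"
proof
  assume 0: "pair x x = 0"
  obtain B rt where B: "root_basis B rt" using root_basis_exists by blast
  have fin: "finite B" using B by (simp add: root_basis_def is_basis_def)
  have "pair x (rt b) = 0" if "b \<in> B" for b
    using 0 pair_h_real_sum_squares[OF B x] that fin by (simp add: sum_nonneg_eq_0_iff)
  then show "x = 0"
    using root_basis_roots(1)[OF B] by (intro h_real_eq_0I[OF x]) auto
qed simp

lemma root_integrality:
  assumes "\<alpha> \<in> roots" "\<beta> \<in> roots"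
  obtains n :: int where "reflection \<alpha> \<beta> = \<beta> - of_int n \<cdot> \<alpha>" "2 * pair \<beta> \<alpha> = of_int n * pair \<alpha> \<alpha>"
proof -
  obtain n :: int where n: "killing \<beta> (coroot \<alpha>) = of_int n"
    using killing_coroot_integer[OF assms] by blast
  have "Re (killing \<beta> (coroot \<alpha>)) = 2 * pair \<beta> \<alpha> / pair \<alpha> \<alpha>"
    using assms by (simp add: coroot_real killing_scale_right killing_roots_real)
  then have "2 * pair \<beta> \<alpha> = of_int n * pair \<alpha> \<alpha>"
    using n pair_root_self_pos[OF assms(1)] by (simp add: field_simps)
  then show ?thesis using that[of n] n by (simp add: reflection_def)
qed

lemma bracket_nonzero_if_obtuse:
  assumes "\<alpha> \<in> roots" "\<beta> \<in> roots" "pair \<alpha> \<beta> < 0"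
    and "x \<in> root_space \<alpha>" "x \<noteq> 0" "y \<in> root_space \<beta>" "y \<noteq> 0"
  shows "\<lbrace>x, y\<rbrace> \<noteq> 0"
proof (rule bracket_root_vectors_nonzero[OF assms(1,2) _ assms(4-7)])
  have "Re (killing \<beta> (coroot \<alpha>)) = 2 * pair \<alpha> \<beta> / pair \<alpha> \<alpha>"
    using assms by (simp add: coroot_real killing_scale_right killing_roots_real pair_sym)
  then show "Re (killing \<beta> (coroot \<alpha>)) < 0"
    using assms(3) pair_root_self_pos[OF assms(1)] by (simp add: divide_neg_pos)
qed

lemma root_add:
  assumes a: "\<alpha> \<in> roots" and b: "\<beta> \<in> roots" and neg: "pair \<alpha> \<beta> < 0" and "\<alpha> + \<beta> \<noteq> 0"
  shows "\<alpha> + \<beta> \<in> roots"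
proof -
  obtain x where x: "x \<in> root_space \<alpha>" "x \<noteq> 0" using a by (rule root_vector)
  obtain y where y: "y \<in> root_space \<beta>" "y \<noteq> 0" using b by (rule root_vector)
  have "\<alpha> + \<beta> \<in> \<hh>"
    by (intro cartan_add roots_in_cartan a b)
  then show ?thesis
    using rootI[OF _ assms(4) bracket_root_space[OF x(1) y(1)] bracket_nonzero_if_obtuse[OF a b neg x y]] by blast
qed

lemma root_diff:
  assumes "\<alpha> \<in> roots" "\<beta> \<in> roots" "pair \<alpha> \<beta> > 0" "\<alpha> \<noteq> \<beta>"
  shows "\<alpha> - \<beta> \<in> roots"
  using root_add[OF assms(1) roots_minus[OF assms(2)]] assms(3,4) by (simp add: pair_minus_right)

section \<open>Root space decomposition of stable subspaces\<close>

lemma root_decomposition: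
  "\<exists>y. (\<forall>t. y t \<in> root_space t) \<and> x = (\<Sum>t\<in>insert 0 roots. y t)"
proof -
  obtain B rt where B: "root_basis B rt" using root_basis_exists by blast
  then have B': "is_basis B" and rt: "\<And>b. b \<in> B \<Longrightarrow> b \<in> root_space (rt b)"
    by (auto simp: root_basis_def)
  define y where "y t = (\<Sum>b | b \<in> B \<and> rt b = t. representation B x b \<cdot> b)" for t
  have "y t \<in> root_space t" for t
    unfolding y_def using rt
    by (intro subspace_sum[OF subspace_root_space] subspace_scale[OF subspace_root_space]) auto
  moreover have "(\<Sum>t\<in>insert 0 roots. y t) = (\<Sum>b\<in>B. representation B x b \<cdot> b)"
    unfolding y_def using B' finite_roots root_basis_roots(2)[OF B]
    by (intro sum.group) (auto simp: is_basis_def)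
  ultimately show ?thesis using basis_expansion[OF B'] by metis
qed

definition cartan_stable :: "'g set \<Rightarrow> bool" where
  "cartan_stable S \<longleftrightarrow> subspace S \<and> (\<forall>H\<in>\<hh>. \<forall>x\<in>S. \<lbrace>H, x\<rbrace> \<in> S)"

lemma cartan_stable_components:
  assumes S: "cartan_stable S" and y: "\<And>t. y t \<in> root_space t"
    and sum: "(\<Sum>t\<in>insert 0 roots. y t) \<in> S" and t: "t \<in> insert 0 roots"
  shows "y t \<in> S"
proof -
  have in_h: "t \<in> \<hh>" if "t \<in> insert 0 roots" for t
    using that roots_in_cartan subspace_0[OF subspace_cartan] by blast
  have "\<forall>t\<in>insert 0 roots. y t \<in> S"
  proof (rule eigencomponents_in_stable_subspace[where K = \<hh> and e = killing])
    show "\<lbrace>H, y t\<rbrace> = killing t H \<cdot> y t" if "t \<in> insert 0 roots" "H \<in> \<hh>" for t H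
      using y[of t] that(2) by (simp add: root_space_def)
    show "\<exists>H\<in>\<hh>. killing s H \<noteq> killing t H"
      if "s \<in> insert 0 roots" "t \<in> insert 0 roots" "s \<noteq> t" for s t
      using killing_cartan_eq_iff[OF in_h[OF that(1)] in_h[OF that(2)]] that(3) by blast
  qed (use S sum finite_roots in \<open>auto simp: cartan_stable_def\<close>)
  then show ?thesis using t by blast
qed

lemma root_space_subset:
  assumes "subspace S" "\<alpha> \<in> roots" "x \<in> root_space \<alpha>" "x \<noteq> 0" "x \<in> S"
  shows "root_space \<alpha> \<subseteq> S"
proof
  fix y assume "y \<in> root_space \<alpha>"
  then obtain c where "y = c \<cdot> x" using root_space_line assms by blast
  then show "y \<in> S" using assms by (simp add: subspace_scale)
qed

text \<open>A stable subspace contains the weight components of its elements, and a component in a root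
  space generates this line.\<close>

lemma cartan_stable_span_root_spaces:
  assumes S: "cartan_stable S" and S0: "\<hh> \<inter> S \<subseteq> {0}"
  shows "S = span (\<Union>\<alpha>\<in>{\<alpha>\<in>roots. root_space \<alpha> \<subseteq> S}. root_space \<alpha>)" (is "S = span ?U")
proof
  have sub: "subspace S" using S by (simp add: cartan_stable_def)
  show "span ?U \<subseteq> S" by (rule span_minimal[OF _ sub]) auto
  show "S \<subseteq> span ?U"
  proof
    fix x assume x: "x \<in> S"
    obtain y where y: "\<And>t. y t \<in> root_space t" "x = (\<Sum>t\<in>insert 0 roots. y t)"
      using root_decomposition by metis
    have yS: "y t \<in> S" if "t \<in> insert 0 roots" for t
      using cartan_stable_components[OF S y(1) _ that] x y(2) by simp
    have "y t \<in> span ?U" if t: "t \<in> insert 0 roots" for t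
    proof (cases "y t = 0")
      case False
      have "t \<noteq> 0" using False S0 yS[OF t] y(1)[of t] root_space_0 by blast
      then have "t \<in> roots" using t by simp
      then have "root_space t \<subseteq> S" using root_space_subset[OF sub _ y(1) False yS[OF t]] by simp
      then show ?thesis using y(1)[of t] \<open>t \<in> roots\<close> by (intro span_base) auto
    qed (simp add: span_zero)
    then show "x \<in> span ?U" unfolding y(2) by (rule span_sum)
  qed
qed

text \<open>The projection to the weight \<open>\<beta>\<close> kills all other root spaces and fixes \<open>x\<close>.\<close>

lemma root_space_meets_span:
  assumes M: "M \<subseteq> \<hh>" and x: "x \<in> span (\<Union>t\<in>M. root_space t)"
    and b: "\<beta> \<in> \<hh>" "x \<in> root_space \<beta>" "x \<noteq> 0"
  shows "\<beta> \<in> M"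
proof (rule ccontr)
  assume nb: "\<beta> \<notin> M"
  obtain B rt where "root_basis B rt" using root_basis_exists by blast
  then have B: "weight_basis B (\<lambda>b. killing (rt b))" by (rule root_basis_weight_basis)
  define Q where "Q = (\<lambda>\<mu>. \<forall>H\<in>\<hh>. \<mu> H = killing \<beta> H)"
  have Qcong: "Q \<mu> = Q \<nu>" if "\<forall>H\<in>\<hh>. \<mu> H = \<nu> H" for \<mu> \<nu>
    using that by (simp add: Q_def)
  let ?p = "weight_proj B (\<lambda>b. killing (rt b)) Q"
  have linp: "lin ?p" by (rule lin_weight_proj[OF B])
  have p: "?p v = (if Q (killing t) then v else 0)" if "v \<in> root_space t" for v t
    using weight_proj_eq[of B _ Q v "killing t", OF B Qcong] that by (simp add: root_space_eq_weight_space)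
  have "span (\<Union>t\<in>M. root_space t) \<subseteq> {v. ?p v = 0}"
  proof (rule span_minimal)
    show "subspace {v. ?p v = 0}"
      using linp lin_zero[OF linp] by (intro subspaceI) (auto simp: lin_iff)
    have "\<not> Q (killing t)" if "t \<in> M" for t
      using killing_cartan_eq_iff[of t \<beta>] that M b(1) nb by (auto simp: Q_def)
    then show "(\<Union>t\<in>M. root_space t) \<subseteq> {v. ?p v = 0}" using p by auto
  qed
  then have "?p x = 0" using x by blast
  moreover have "?p x = x" using p[OF b(2)] by (simp add: Q_def)
  ultimately show False using b(3) by simp
qed

section \<open>The positive system defined by the Borel subalgebra\<close>

lemma ideal_nilrad: "ideal_of \<nn> \<bb>"
  using nilradical unfolding nilradical_of_def by (rule conjunct1)

lemma subspace_nilrad: "subspace \<nn>"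
  and nilrad_subset_borel: "\<nn> \<subseteq> \<bb>"
  and bracket_borel_nilrad: "x \<in> \<bb> \<Longrightarrow> y \<in> \<nn> \<Longrightarrow> \<lbrace>x, y\<rbrace> \<in> \<nn>"
  using ideal_nilrad unfolding ideal_of_def by blast+

lemma cartan_subset_borel: "\<hh> \<subseteq> \<bb>"
proof
  fix x assume "x \<in> \<hh>"
  then show "x \<in> \<bb>"
    unfolding borel_decomp(1) using subspace_0[OF subspace_nilrad]
    by (intro CollectI exI[of _ x] exI[of _ 0]) simp
qed

lemma pos_roots_roots: "\<alpha> \<in> pos_roots \<Longrightarrow> \<alpha> \<in> roots"
  by (simp add: pos_roots_def)

lemma finite_pos_roots: "finite pos_roots"
  by (rule finite_subset[OF _ finite_roots]) (auto simp: pos_roots_def)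

lemma cartan_stable_nilrad: "cartan_stable \<nn>"
  unfolding cartan_stable_def
  using subspace_nilrad cartan_subset_borel bracket_borel_nilrad by blast

lemma nilrad_eq_span: "\<nn> = span (\<Union>\<alpha>\<in>pos_roots. root_space \<alpha>)"
  using cartan_stable_span_root_spaces[OF cartan_stable_nilrad] borel_decomp(2)
  by (simp add: pos_roots_def)

lemma pos_rootI:
  "\<alpha> \<in> roots \<Longrightarrow> x \<in> root_space \<alpha> \<Longrightarrow> x \<noteq> 0 \<Longrightarrow> x \<in> \<nn> \<Longrightarrow> \<alpha> \<in> pos_roots"
  using root_space_subset[OF subspace_nilrad] by (simp add: pos_roots_def)

text \<open>Otherwise the bracket of opposite root vectors would be a nonzero element of \<open>\<hh> \<inter> \<nn>\<close>.\<close>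

lemma minus_pos_root_not_pos:
  assumes a: "\<alpha> \<in> pos_roots"
  shows "- \<alpha> \<notin> pos_roots"
proof
  assume b: "- \<alpha> \<in> pos_roots"
  have r: "\<alpha> \<in> roots" using a by (rule pos_roots_roots)
  obtain e where e: "e \<in> root_space \<alpha>" "e \<noteq> 0" using r by (rule root_vector)
  obtain f where f: "f \<in> root_space (- \<alpha>)" "\<lbrace>e, f\<rbrace> = coroot \<alpha>" by (rule sl2_triple[OF r e])
  have "e \<in> \<nn>" "f \<in> \<nn>" using e f a b by (auto simp: pos_roots_def)
  from bracket_borel_nilrad[OF subsetD[OF nilrad_subset_borel this(1)] this(2)]
  have "coroot \<alpha> \<in> \<nn>" unfolding f(2) .
  then have "coroot \<alpha> = 0" using coroot_in_cartan[OF r] borel_decomp(2) by blast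
  then show False using killing_root_self(2)[OF r] by simp
qed

lemma pos_root_add_obtuse:
  assumes a: "\<alpha> \<in> pos_roots" and b: "\<beta> \<in> pos_roots" and neg: "pair \<alpha> \<beta> < 0"
  shows "\<alpha> + \<beta> \<in> pos_roots"
proof -
  have ra: "\<alpha> \<in> roots" and rb: "\<beta> \<in> roots" using a b pos_roots_roots by blast+
  have "\<alpha> + \<beta> \<noteq> 0" using minus_pos_root_not_pos[OF a] b by (auto simp: add_eq_0_iff)
  then have r: "\<alpha> + \<beta> \<in> roots" using root_add[OF ra rb neg] by blast
  obtain x where x: "x \<in> root_space \<alpha>" "x \<noteq> 0" using ra by (rule root_vector)
  obtain y where y: "y \<in> root_space \<beta>" "y \<noteq> 0" using rb by (rule root_vector)
  have "x \<in> \<nn>" "y \<in> \<nn>" using x y a b by (auto simp: pos_roots_def)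
  then have "\<lbrace>x, y\<rbrace> \<in> \<nn>"
    using bracket_borel_nilrad[OF subsetD[OF nilrad_subset_borel]] by simp
  then show ?thesis
    by (rule pos_rootI[OF r bracket_root_space[OF x(1) y(1)] bracket_nonzero_if_obtuse[OF ra rb neg x y]])
qed

definition root_sums :: "'g set \<Rightarrow> 'g set" where
  "root_sums A = {sum_list xs | xs. set xs \<subseteq> A \<and> xs \<noteq> []}"

lemma root_sumsI: "set xs \<subseteq> A \<Longrightarrow> xs \<noteq> [] \<Longrightarrow> sum_list xs = x \<Longrightarrow> x \<in> root_sums A"
  unfolding root_sums_def by blast

lemma root_sums_base: "\<alpha> \<in> A \<Longrightarrow> \<alpha> \<in> root_sums A"
  unfolding root_sums_def by (intro CollectI exI[of _ "[\<alpha>]"]) simp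

lemma root_sums_add: "x \<in> root_sums A \<Longrightarrow> y \<in> root_sums A \<Longrightarrow> x + y \<in> root_sums A"
proof -
  assume "x \<in> root_sums A" "y \<in> root_sums A"
  then obtain xs ys where "x = sum_list xs" "set xs \<subseteq> A" "xs \<noteq> []" "y = sum_list ys" "set ys \<subseteq> A"
    unfolding root_sums_def by blast
  then show ?thesis unfolding root_sums_def by (intro CollectI exI[of _ "xs @ ys"]) simp
qed

lemma root_sums_induct [consumes 1, case_names base add]:
  assumes "x \<in> root_sums A" "\<And>\<alpha>. \<alpha> \<in> A \<Longrightarrow> Q \<alpha>" "\<And>x y. Q x \<Longrightarrow> Q y \<Longrightarrow> Q (x + y)"
  shows "Q x"
proof -
  have "xs \<noteq> [] \<Longrightarrow> set xs \<subseteq> A \<Longrightarrow> Q (sum_list xs)" for xs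
    by (induction xs rule: list_nonempty_induct) (use assms in auto)
  then show ?thesis using assms(1) unfolding root_sums_def by blast
qed

lemma root_sums_mono_sums: "X \<subseteq> root_sums A \<Longrightarrow> x \<in> root_sums X \<Longrightarrow> x \<in> root_sums A"
  by (rotate_tac, induction rule: root_sums_induct) (auto intro: root_sums_add)

lemma sum_list_separate:
  "sum_list xs = sum_list (filter (\<lambda>x. x \<noteq> \<beta>) xs) + of_nat (count_list xs \<beta>) \<cdot> \<beta>"
  by (induction xs) (auto simp: scale_left_distrib algebra_simps)

lemma sum_list_concat_replicate: "sum_list (concat (replicate k xs)) = of_nat k \<cdot> sum_list xs"
  by (induction k) (auto simp: scale_left_distrib)

lemma sum_list_replicate_scale: "sum_list (replicate k x) = of_nat k \<cdot> x"
  by (induction k) (auto simp: scale_left_distrib)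

lemma pair_sum_list: "pair x (sum_list ys) = (\<Sum>y\<leftarrow>ys. pair x y)"
  by (induction ys) (auto simp: pair_add_right)

text \<open>If \<open>\<alpha> + \<gamma>\<^sub>1 + \<cdots> + \<gamma>\<^sub>m = 0\<close>, then \<open>(\<alpha>, \<gamma>\<^sub>j) < 0\<close> for some \<open>j\<close>; as \<open>\<alpha> + \<gamma>\<^sub>j\<close> is again positive,
  there is a shorter vanishing sum.\<close>

lemma pos_root_sums_nonzero: "0 \<notin> root_sums pos_roots"
proof -
  have "set xs \<subseteq> pos_roots \<Longrightarrow> xs \<noteq> [] \<Longrightarrow> sum_list xs \<noteq> 0" for xs
  proof (induction "length xs" arbitrary: xs rule: less_induct)
    case less
    then obtain a ys where xs: "xs = a # ys" by (cases xs) auto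
    then have a: "a \<in> pos_roots" and ys: "set ys \<subseteq> pos_roots" using less.prems by auto
    show ?case
    proof
      assume "sum_list xs = 0"
      then have "pair a a + (\<Sum>y\<leftarrow>ys. pair a y) = 0"
        using pair_sum_list[of a xs] xs by simp
      then have "(\<Sum>y\<leftarrow>ys. pair a y) < 0"
        using pair_root_self_pos[OF pos_roots_roots[OF a]] by linarith
      then have "\<exists>y\<in>set ys. pair a y < 0"
        using sum_list_nonneg[of "map (pair a) ys"] by (force simp: not_less)
      then obtain y where y: "y \<in> set ys" "pair a y < 0" by blast
      then obtain ys1 ys2 where s: "ys = ys1 @ y # ys2" by (meson split_list)
      have "a + y \<in> pos_roots" using pos_root_add_obtuse[OF a _ y(2)] y(1) ys by blast
      then have "sum_list ((a + y) # ys1 @ ys2) \<noteq> 0"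
        using ys by (intro less.hyps) (auto simp: xs s)
      then show False using \<open>sum_list xs = 0\<close> by (simp add: xs s algebra_simps)
    qed
  qed
  then show ?thesis unfolding root_sums_def by auto
qed

text \<open>The number of roots below \<open>\<alpha>\<close> in the partial order defined by \<open>A\<close>.\<close>

definition root_rank :: "'g set \<Rightarrow> 'g \<Rightarrow> nat" where
  "root_rank A \<alpha> = card {\<gamma> \<in> A. \<alpha> - \<gamma> \<in> root_sums A}"

lemma root_rank_less:
  assumes A: "finite A" "0 \<notin> root_sums A" and a: "\<alpha> \<in> A" and b: "\<beta> \<in> root_sums A"
  shows "root_rank A \<alpha> < root_rank A (\<alpha> + \<beta>)"
  unfolding root_rank_def
proof (rule psubset_card_mono)
  have "\<alpha> \<in> {\<gamma> \<in> A. \<alpha> + \<beta> - \<gamma> \<in> root_sums A}" using a b by simp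
  moreover have "\<alpha> \<notin> {\<gamma> \<in> A. \<alpha> - \<gamma> \<in> root_sums A}" using A by simp
  moreover have "{\<gamma> \<in> A. \<alpha> - \<gamma> \<in> root_sums A} \<subseteq> {\<gamma> \<in> A. \<alpha> + \<beta> - \<gamma> \<in> root_sums A}"
  proof clarsimp
    fix \<gamma> assume "\<alpha> - \<gamma> \<in> root_sums A"
    then have "(\<alpha> - \<gamma>) + \<beta> \<in> root_sums A" using b by (rule root_sums_add)
    then show "\<alpha> + \<beta> - \<gamma> \<in> root_sums A" by (simp add: algebra_simps)
  qed
  ultimately show "{\<gamma> \<in> A. \<alpha> - \<gamma> \<in> root_sums A} \<subset> {\<gamma> \<in> A. \<alpha> + \<beta> - \<gamma> \<in> root_sums A}" by blast
qed (use A in simp)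

lemma root_rank_le: "finite A \<Longrightarrow> root_rank A \<alpha> \<le> card A"
  unfolding root_rank_def by (rule card_mono) auto

lemma bracket_spans:
  assumes "subspace T" "\<And>x y. x \<in> A \<Longrightarrow> y \<in> B \<Longrightarrow> \<lbrace>x, y\<rbrace> \<in> T"
    and "x \<in> span A" "y \<in> span B"
  shows "\<lbrace>x, y\<rbrace> \<in> T"
proof -
  have 1: "\<lbrace>a, y\<rbrace> \<in> T" if "a \<in> A" for a
  proof -
    have "subspace {y. \<lbrace>a, y\<rbrace> \<in> T}"
      using assms(1) by (intro subspaceI) (auto simp: bracket_add_right bracket_scale_right subspace_0 subspace_add subspace_scale)
    from span_minimal[OF _ this, of B] show ?thesis using assms(2,4) that by blast
  qed
  have "subspace {x. \<lbrace>x, y\<rbrace> \<in> T}"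
    using assms(1) by (intro subspaceI) (auto simp: bracket_add_left bracket_scale_left subspace_0 subspace_add subspace_scale)
  from span_minimal[OF _ this, of A] show ?thesis using 1 assms(3) by blast
qed

lemma bracket_span_subset:
  assumes "subspace T" "\<And>x y. x \<in> A \<Longrightarrow> y \<in> B \<Longrightarrow> \<lbrace>x, y\<rbrace> \<in> T"
  shows "bracket_span A B \<subseteq> T"
  unfolding bracket_span_def by (rule span_minimal) (use assms in auto)

text \<open>The derived series of \<open>\<hh> \<oplus> \<Oplus>\<^sub>A \<gg>\<^sub>\<alpha>\<close> descends along the rank, which
  increases when roots are added; and the rank is bounded.\<close>

lemma closed_root_set_solvable:
  assumes A: "A \<subseteq> roots" "0 \<notin> root_sums A"
    and closed: "\<And>\<alpha> \<beta>. \<alpha> \<in> A \<Longrightarrow> \<beta> \<in> A \<Longrightarrow> \<alpha> + \<beta> \<in> roots \<Longrightarrow> \<alpha> + \<beta> \<in> A"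
  shows "subalgebra (span (\<Union>t\<in>insert 0 A. root_space t))"
    and "solvable (span (\<Union>t\<in>insert 0 A. root_space t))"
proof -
  let ?K = "span (\<Union>t\<in>insert 0 A. root_space t)"
  define N where "N k = span (\<Union>\<gamma>\<in>{\<gamma>\<in>A. root_rank A \<gamma> \<ge> k}. root_space \<gamma>)" for k
  have finA: "finite A" using A(1) finite_roots finite_subset by blast
  have Nbr: "\<lbrace>x, y\<rbrace> \<in> N (Suc k)"
    if "\<alpha> \<in> A" "\<beta> \<in> A" "x \<in> root_space \<alpha>" "y \<in> root_space \<beta>" "k \<le> root_rank A \<alpha>" for x y \<alpha> \<beta> k
  proof (cases "\<lbrace>x, y\<rbrace> = 0")
    case False
    have "\<alpha> + \<beta> \<in> root_sums A" using that root_sums_base root_sums_add by blast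
    then have "\<alpha> + \<beta> \<noteq> 0" using A(2) by metis
    moreover have "\<alpha> + \<beta> \<in> \<hh>"
      using that(1,2) A(1) by (intro cartan_add roots_in_cartan) auto
    moreover have br: "\<lbrace>x, y\<rbrace> \<in> root_space (\<alpha> + \<beta>)" using bracket_root_space that by blast
    ultimately have "\<alpha> + \<beta> \<in> A" using rootI[OF _ _ br False] closed that by blast
    moreover have "Suc k \<le> root_rank A (\<alpha> + \<beta>)"
      using root_rank_less[OF finA A(2) that(1) root_sums_base[OF that(2)]] that(5) by linarith
    ultimately show ?thesis unfolding N_def using br by (intro span_base) auto
  qed (simp add: N_def span_zero)
  have N0: "N (Suc k) \<subseteq> N 0" for k unfolding N_def by (rule span_mono) auto
  have NK: "N 0 \<subseteq> ?K" unfolding N_def by (rule span_mono) auto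
  have K0: "\<lbrace>x, y\<rbrace> \<in> N 0" if xy: "x \<in> ?K" "y \<in> ?K" for x y
  proof (rule bracket_spans[OF _ _ xy])
    show "subspace (N 0)" by (simp add: N_def)
    fix u v assume "u \<in> (\<Union>t\<in>insert 0 A. root_space t)" "v \<in> (\<Union>t\<in>insert 0 A. root_space t)"
    then obtain s t where s: "s \<in> insert 0 A" "u \<in> root_space s" and t: "t \<in> insert 0 A" "v \<in> root_space t"
      by blast
    have cartan_root: "\<lbrace>H, w\<rbrace> \<in> N 0" if "H \<in> \<hh>" "w \<in> root_space \<gamma>" "\<gamma> \<in> A" for H w \<gamma>
    proof -
      have "w \<in> N 0" unfolding N_def using that by (intro span_base) auto
      moreover have "\<lbrace>H, w\<rbrace> = killing \<gamma> H \<cdot> w" using that by (simp add: root_space_def)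
      ultimately show ?thesis by (simp add: N_def span_scale)
    qed
    consider "s = 0" "t = 0" | "s = 0" "t \<in> A" | "s \<in> A" "t = 0" | "s \<in> A" "t \<in> A"
      using s t by blast
    then show "\<lbrace>u, v\<rbrace> \<in> N 0"
    proof cases
      case 1
      then have "\<lbrace>u, v\<rbrace> = 0" using s t root_space_0 cartan_abelian by blast
      then show ?thesis by (simp add: N_def span_zero)
    next
      case 2
      then show ?thesis using cartan_root s t root_space_0 by blast
    next
      case 3
      then have "\<lbrace>v, u\<rbrace> \<in> N 0" using cartan_root s t root_space_0 by blast
      then show ?thesis
        by (subst bracket_anticommute) (simp add: N_def span_neg)
    next
      case 4
      then show ?thesis using Nbr[of s t u v 0] s t N0 by blast
    qed
  qed
  then show "subalgebra ?K" using NK unfolding subalgebra_def by blast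
  have NN: "\<lbrace>x, y\<rbrace> \<in> N (Suc k)" if xy: "x \<in> N k" "y \<in> N k" for x y k
  proof -
    have "subspace (N (Suc k))" by (simp add: N_def)
    from bracket_spans[OF this _ xy[unfolded N_def]] show ?thesis using Nbr by blast
  qed
  have D: "derived_series (Suc k) ?K \<subseteq> N k" for k
  proof (induction k)
    case 0
    have "subspace (N 0)" by (simp add: N_def)
    from bracket_span_subset[OF this K0] show ?case by simp
  next
    case (Suc k)
    have "subspace (N (Suc k))" by (simp add: N_def)
    then have "bracket_span (derived_series (Suc k) ?K) (derived_series (Suc k) ?K) \<subseteq> N (Suc k)"
      using Suc NN by (intro bracket_span_subset) blast+
    then show ?case by simp
  qed
  have "{\<gamma>\<in>A. root_rank A \<gamma> \<ge> Suc (card A)} = {}"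
    using root_rank_le[OF finA] by (auto simp: not_less_eq_eq)
  then have "N (Suc (card A)) = {0}" unfolding N_def by (simp only: UN_empty span_empty)
  then have "derived_series (Suc (Suc (card A))) ?K \<subseteq> {0}" using D[of "Suc (card A)"] by simp
  moreover have "0 \<in> derived_series (Suc (Suc (card A))) ?K"
    by (subst derived_series.simps(2)) (simp add: bracket_span_def span_zero)
  ultimately show "solvable ?K" unfolding solvable_def by blast
qed

lemma borel_eq_span: "\<bb> = span (\<Union>t\<in>insert 0 pos_roots. root_space t)"
proof -
  have "span (\<Union>t\<in>insert 0 pos_roots. root_space t) = span (\<hh> \<union> (\<Union>t\<in>pos_roots. root_space t))"
    by (simp add: root_space_0)
  also have "\<dots> = {x + y | x y. x \<in> \<hh> \<and> y \<in> \<nn>}"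
    unfolding span_Un nilrad_eq_span[symmetric] span_eq_iff[THEN iffD2, OF subspace_cartan] ..
  finally show ?thesis using borel_decomp(1) by simp
qed

lemma zero_sum_involves:
  assumes "0 \<in> root_sums (insert \<beta> pos_roots)" "\<beta> \<notin> pos_roots"
  obtains xs k where "set xs \<subseteq> pos_roots" "k > 0" "sum_list xs + of_nat k \<cdot> \<beta> = 0"
proof -
  obtain zs where zs: "set zs \<subseteq> insert \<beta> pos_roots" "zs \<noteq> []" "sum_list zs = 0"
    using assms(1) unfolding root_sums_def by auto
  let ?xs = "filter (\<lambda>x. x \<noteq> \<beta>) zs"
  have xs: "set ?xs \<subseteq> pos_roots" using zs(1) by auto
  moreover have s: "sum_list ?xs + of_nat (count_list zs \<beta>) \<cdot> \<beta> = 0"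
    using sum_list_separate[of zs \<beta>] zs(3) by simp
  moreover have "count_list zs \<beta> > 0"
  proof (rule ccontr)
    assume "\<not> count_list zs \<beta> > 0"
    then have "\<beta> \<notin> set zs" by (simp add: count_list_0_iff)
    then have "set zs \<subseteq> pos_roots" using zs(1) by blast
    then have "0 \<in> root_sums pos_roots" using zs(2,3) by (rule root_sumsI)
    then show False using pos_root_sums_nonzero by blast
  qed
  ultimately show ?thesis using that by blast
qed

text \<open>If neither \<open>\<beta>\<close> nor \<open>-\<beta>\<close> is positive, then one of them can be added to the positive roots
  without creating a vanishing sum; the roots in the resulting monoid define a solvable subalgebra
  larger than \<open>\<bb>\<close>.\<close>

lemma root_pos_or_neg:
  assumes r: "\<alpha> \<in> roots"
  shows "\<alpha> \<in> pos_roots \<or> - \<alpha> \<in> pos_roots"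
proof (rule ccontr)
  assume n: "\<not> (\<alpha> \<in> pos_roots \<or> - \<alpha> \<in> pos_roots)"
  have "\<exists>\<beta>\<in>{\<alpha>, - \<alpha>}. 0 \<notin> root_sums (insert \<beta> pos_roots)"
  proof (rule ccontr)
    assume "\<not> ?thesis"
    then have z: "0 \<in> root_sums (insert \<alpha> pos_roots)" "0 \<in> root_sums (insert (- \<alpha>) pos_roots)" by blast+
    obtain xs k where xs: "set xs \<subseteq> pos_roots" "k > 0" "sum_list xs + of_nat k \<cdot> \<alpha> = 0"
      by (rule zero_sum_involves[OF z(1)]) (use n in auto)
    obtain xs' k' where xs': "set xs' \<subseteq> pos_roots" "k' > 0" "sum_list xs' + of_nat k' \<cdot> (- \<alpha>) = 0"
      by (rule zero_sum_involves[OF z(2)]) (use n in auto)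
    let ?zs = "concat (replicate k' xs) @ concat (replicate k xs')"
    have "sum_list xs = - (of_nat k \<cdot> \<alpha>)" "sum_list xs' = of_nat k' \<cdot> \<alpha>"
      using xs(3) xs'(3) by (simp_all add: eq_neg_iff_add_eq_0)
    then have "sum_list ?zs = 0"
      by (simp add: sum_list_concat_replicate mult.commute)
    moreover have "xs \<noteq> []" using xs roots_nonzero[OF r] by auto
    then have "?zs \<noteq> []" using xs'(2) by (cases k') auto
    moreover have "set ?zs \<subseteq> pos_roots" using xs(1) xs'(1) by (auto split: if_splits)
    ultimately have "0 \<in> root_sums pos_roots" by (intro root_sumsI[of ?zs])
    then show False using pos_root_sums_nonzero by blast
  qed
  then obtain \<beta> where b: "\<beta> \<in> {\<alpha>, - \<alpha>}" "0 \<notin> root_sums (insert \<beta> pos_roots)" by blast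
  have rb: "\<beta> \<in> roots" using b(1) r roots_minus by blast
  define A where "A = roots \<inter> root_sums (insert \<beta> pos_roots)"
  have A: "A \<subseteq> roots" by (simp add: A_def)
  have "0 \<notin> root_sums A"
    using root_sums_mono_sums[of A "insert \<beta> pos_roots" 0] b(2) by (auto simp: A_def)
  moreover have closed: "\<gamma> + \<delta> \<in> A" if "\<gamma> \<in> A" "\<delta> \<in> A" "\<gamma> + \<delta> \<in> roots" for \<gamma> \<delta>
    using that root_sums_add by (auto simp: A_def)
  ultimately have K: "subalgebra (span (\<Union>t\<in>insert 0 A. root_space t))" "solvable (span (\<Union>t\<in>insert 0 A. root_space t))"
    using closed_root_set_solvable[OF A] by blast+
  have "pos_roots \<subseteq> A" using root_sums_base pos_roots_roots by (auto simp: A_def)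
  then have "\<bb> \<subseteq> span (\<Union>t\<in>insert 0 A. root_space t)"
    unfolding borel_eq_span by (intro span_mono) blast
  then have eq: "span (\<Union>t\<in>insert 0 A. root_space t) = \<bb>"
    using borel K unfolding borel_subalgebra_def by blast
  obtain x where x: "x \<in> root_space \<beta>" "x \<noteq> 0" using rb by (rule root_vector)
  have "\<beta> \<in> A" using rb root_sums_base by (simp add: A_def)
  then have "x \<in> \<bb>" unfolding eq[symmetric] using x(1) by (intro span_base) blast
  moreover have "insert 0 pos_roots \<subseteq> \<hh>"
    using pos_roots_roots roots_in_cartan subspace_0[OF subspace_cartan] by blast
  ultimately have "\<beta> \<in> insert 0 pos_roots"
    using root_space_meets_span[OF _ _ roots_in_cartan[OF rb] x] borel_eq_span by blast
  then show False using b(1) n roots_nonzero[OF rb] by auto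
qed

lemma pos_roots_closed:
  assumes "x \<in> root_sums pos_roots" "x \<in> roots"
  shows "x \<in> pos_roots"
proof (rule ccontr)
  assume "x \<notin> pos_roots"
  then have "- x \<in> root_sums pos_roots" using root_pos_or_neg[OF assms(2)] root_sums_base by blast
  from root_sums_add[OF assms(1) this] show False using pos_root_sums_nonzero by simp
qed

section \<open>Simple roots and the highest root\<close>

lemma simple_roots_pos: "\<alpha> \<in> simple_roots \<Longrightarrow> \<alpha> \<in> pos_roots"
  by (simp add: simple_roots_def)

lemma simple_roots_roots: "\<alpha> \<in> simple_roots \<Longrightarrow> \<alpha> \<in> roots"
  by (simp add: simple_roots_pos pos_roots_roots)

lemma finite_simple_roots: "finite simple_roots"
  by (rule finite_subset[OF _ finite_pos_roots]) (auto simp: simple_roots_def)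

lemma pos_root_sum_simple: "\<alpha> \<in> pos_roots \<Longrightarrow> \<alpha> \<in> root_sums simple_roots"
proof (induction "root_rank pos_roots \<alpha>" arbitrary: \<alpha> rule: less_induct)
  case less
  show ?case
  proof (cases "\<alpha> \<in> simple_roots")
    case False
    then obtain \<beta> \<gamma> where bg: "\<beta> \<in> pos_roots" "\<gamma> \<in> pos_roots" "\<alpha> = \<beta> + \<gamma>"
      using less.prems by (auto simp: simple_roots_def)
    have "root_rank pos_roots \<beta> < root_rank pos_roots \<alpha>"
      unfolding bg(3) using bg finite_pos_roots pos_root_sums_nonzero
      by (intro root_rank_less root_sums_base)
    moreover have "root_rank pos_roots \<gamma> < root_rank pos_roots \<alpha>"
      unfolding bg(3) add.commute[of \<beta>] using bg finite_pos_roots pos_root_sums_nonzero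
      by (intro root_rank_less root_sums_base)
    ultimately have "\<beta> + \<gamma> \<in> root_sums simple_roots"
      using less.hyps bg by (intro root_sums_add) auto
    then show ?thesis by (simp add: bg(3))
  qed (rule root_sums_base)
qed

lemma simple_roots_obtuse:
  assumes a: "\<alpha> \<in> simple_roots" and b: "\<beta> \<in> simple_roots" and ne: "\<alpha> \<noteq> \<beta>"
  shows "pair \<alpha> \<beta> \<le> 0"
proof (rule ccontr)
  assume "\<not> pair \<alpha> \<beta> \<le> 0"
  then have r: "\<alpha> - \<beta> \<in> roots"
    using root_diff a b ne simple_roots_roots by simp
  have indec: "\<gamma> \<noteq> \<delta> + \<epsilon>" if "\<gamma> \<in> simple_roots" "\<delta> \<in> pos_roots" "\<epsilon> \<in> pos_roots" for \<gamma> \<delta> \<epsilon>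
    using that unfolding simple_roots_def by blast
  show False
    using root_pos_or_neg[OF r]
  proof
    assume "\<alpha> - \<beta> \<in> pos_roots"
    from indec[OF a simple_roots_pos[OF b] this] show False by simp
  next
    assume "- (\<alpha> - \<beta>) \<in> pos_roots"
    from indec[OF b simple_roots_pos[OF a] this] show False by simp
  qed
qed

lemma nonneg_combination_simple:
  assumes "set xs \<subseteq> simple_roots" "\<alpha> \<in> simple_roots" "\<alpha> \<notin> set xs"
  shows "pair \<alpha> (sum_list xs) \<le> 0"
  unfolding pair_sum_list using assms
  by (induction xs) (auto intro!: add_nonpos_nonpos simple_roots_obtuse)

text \<open>If \<open>\<beta> - n \<alpha> = -\<gamma>\<close> with \<open>\<gamma>\<close> positive, then \<open>\<beta> + \<gamma> = n \<alpha>\<close>; as the simple roots are mutually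
  obtuse and have no vanishing sum, only \<open>\<alpha>\<close> can occur in \<open>\<beta>\<close>, so that \<open>\<beta>\<close> is a multiple of \<open>\<alpha>\<close>.\<close>

lemma simple_reflection_pos:
  assumes a: "\<alpha> \<in> simple_roots" and b: "\<beta> \<in> pos_roots" and ne: "\<beta> \<noteq> \<alpha>"
  shows "reflection \<alpha> \<beta> \<in> pos_roots"
proof (rule ccontr)
  assume n: "reflection \<alpha> \<beta> \<notin> pos_roots"
  have ra: "\<alpha> \<in> roots" and rb: "\<beta> \<in> roots" using a b simple_roots_roots pos_roots_roots by auto
  obtain n :: int where n: "reflection \<alpha> \<beta> = \<beta> - of_int n \<cdot> \<alpha>"
    by (rule root_integrality[OF ra rb])
  define \<gamma> where "\<gamma> = of_int n \<cdot> \<alpha> - \<beta>"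
  have "- reflection \<alpha> \<beta> \<in> pos_roots"
    using root_pos_or_neg[OF reflection_root[OF ra rb]] \<open>reflection \<alpha> \<beta> \<notin> pos_roots\<close> by blast
  then have g: "\<gamma> \<in> pos_roots" by (simp add: n \<gamma>_def)
  obtain xs where xs: "set xs \<subseteq> simple_roots" "xs \<noteq> []" "\<beta> = sum_list xs"
    using pos_root_sum_simple[OF b] unfolding root_sums_def by blast
  obtain ys where ys: "set ys \<subseteq> simple_roots" "ys \<noteq> []" "\<gamma> = sum_list ys"
    using pos_root_sum_simple[OF g] unfolding root_sums_def by blast
  let ?zs = "filter (\<lambda>x. x \<noteq> \<alpha>) (xs @ ys)"
  define m where "m = int (count_list (xs @ ys) \<alpha>) - n"
  have zs: "set ?zs \<subseteq> simple_roots" using xs ys by auto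
  have s: "sum_list ?zs + of_int m \<cdot> \<alpha> = 0"
  proof -
    have "sum_list (xs @ ys) = of_int n \<cdot> \<alpha>" 
      unfolding sum_list_append xs(3)[symmetric] ys(3)[symmetric] \<gamma>_def by simp
    then show ?thesis
      using sum_list_separate[of "xs @ ys" \<alpha>] by (simp add: m_def scale_left_diff_distrib)
  qed
  have "pair \<alpha> (sum_list ?zs) \<le> 0" by (rule nonneg_combination_simple[OF zs a]) simp
  moreover have "pair \<alpha> (sum_list ?zs) = - (of_int m * pair \<alpha> \<alpha>)"
  proof -
    have "sum_list ?zs = - (of_int m \<cdot> \<alpha>)" using s by (simp only: eq_neg_iff_add_eq_0)
    then show ?thesis
      using pair_scale_of_int[of m \<alpha> \<alpha>] pair_sym[of \<alpha> "of_int m \<cdot> \<alpha>"] by (simp only: pair_minus_right)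
  qed
  ultimately have "of_int m * pair \<alpha> \<alpha> \<ge> 0" by simp
  then have m: "m \<ge> 0" using pair_root_self_pos[OF ra] by (simp add: zero_le_mult_iff)
  have "?zs = []"
  proof (rule ccontr)
    assume "?zs \<noteq> []"
    then have "0 \<in> root_sums pos_roots"
      using zs simple_roots_pos s m a
      by (intro root_sumsI[of "?zs @ replicate (nat m) \<alpha>"]) (auto simp: sum_list_replicate_scale add.assoc)
    then show False using pos_root_sums_nonzero by blast
  qed
  then have "filter (\<lambda>x. x \<noteq> \<alpha>) xs = []" by simp
  then have "\<beta> = of_nat (count_list xs \<alpha>) \<cdot> \<alpha>"
    using sum_list_separate[of xs \<alpha>] xs(3) by simp
  then show False using root_multiple[OF ra, of "count_list xs \<alpha>"] rb ne by simp
qed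

definition two_rho :: 'g where
  "two_rho = (\<Sum>\<alpha>\<in>pos_roots. \<alpha>)"

lemma two_rho_h_real: "two_rho \<in> h_real"
  unfolding two_rho_def by (intro h_real_sum h_real_roots pos_roots_roots)

text \<open>The reflection in \<open>\<alpha>\<close> permutes the other positive roots, so it takes \<open>2 \<rho>\<close> to \<open>2 \<rho> - 2 \<alpha>\<close>.\<close>

lemma pair_two_rho_simple:
  assumes a: "\<alpha> \<in> simple_roots"
  shows "pair two_rho \<alpha> = pair \<alpha> \<alpha>"
proof -
  have ra: "\<alpha> \<in> roots" using a by (rule simple_roots_roots)
  have split: "two_rho = \<alpha> + (\<Sum>\<beta>\<in>pos_roots - {\<alpha>}. \<beta>)"
    unfolding two_rho_def by (rule sum.remove[OF finite_pos_roots simple_roots_pos[OF a]])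
  have ne: "reflection \<alpha> \<beta> \<noteq> \<alpha>" if "\<beta> \<in> pos_roots" for \<beta>
    using that reflection_involution[OF ra, of \<beta>] reflection_self[OF ra]
      minus_pos_root_not_pos[OF simple_roots_pos[OF a]] by auto
  have "(\<Sum>\<beta>\<in>pos_roots - {\<alpha>}. reflection \<alpha> \<beta>) = (\<Sum>\<beta>\<in>pos_roots - {\<alpha>}. \<beta>)"
    using ne simple_reflection_pos[OF a] reflection_involution[OF ra]
    by (intro sum.reindex_bij_witness[of _ "reflection \<alpha>" "reflection \<alpha>"]) auto
  then have "reflection \<alpha> two_rho = - \<alpha> + (\<Sum>\<beta>\<in>pos_roots - {\<alpha>}. \<beta>)"
    using lin_sum[OF lin_reflection, of \<alpha> "\<lambda>x. x"] lin_reflection[of \<alpha>] reflection_self[OF ra]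
    by (subst split) (simp add: lin_iff)
  then have "pair (reflection \<alpha> two_rho) \<alpha> = pair two_rho \<alpha> - 2 * pair \<alpha> \<alpha>"
    using arg_cong[OF split, of "\<lambda>x. pair x \<alpha>"] by (simp add: pair_add_left pair_minus_left pair_diff_left)
  moreover have "pair (reflection \<alpha> two_rho) \<alpha> = - pair two_rho \<alpha>"
    using killing_reflection[OF ra, of two_rho "- \<alpha>"] lin_minus[OF lin_reflection, of \<alpha> \<alpha>]
    by (simp add: pair_def reflection_self[OF ra] killing_minus_right)
  ultimately show ?thesis by simp
qed

lemma pair_two_rho_pos: "\<alpha> \<in> pos_roots \<Longrightarrow> pair two_rho \<alpha> > 0"
proof -
  assume "\<alpha> \<in> pos_roots"
  then have "\<alpha> \<in> root_sums simple_roots" by (rule pos_root_sum_simple)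
  then show ?thesis
    by (induction rule: root_sums_induct)
      (simp_all add: pair_two_rho_simple pair_root_self_pos simple_roots_roots pair_add_right)
qed

lemma pair_pos_nonneg:
  assumes "\<And>\<alpha>. \<alpha> \<in> simple_roots \<Longrightarrow> pair x \<alpha> \<ge> 0" "\<beta> \<in> pos_roots"
  shows "pair x \<beta> \<ge> 0"
  using pos_root_sum_simple[OF assms(2)]
  by (induction rule: root_sums_induct) (simp_all add: assms(1) pair_add_right)

lemma pair_pos_positive:
  assumes "\<And>\<alpha>. \<alpha> \<in> simple_roots \<Longrightarrow> pair x \<alpha> > 0" "\<beta> \<in> pos_roots"
  shows "pair x \<beta> > 0"
  using pos_root_sum_simple[OF assms(2)]
  by (induction rule: root_sums_induct) (simp_all add: assms(1) pair_add_right)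

lemma pos_roots_nonempty: "pos_roots \<noteq> {}"
proof
  assume e: "pos_roots = {}"
  then have e': "roots = {}" using root_pos_or_neg by blast
  have "x \<in> \<hh>" for x
  proof -
    obtain y where y: "\<And>t. y t \<in> root_space t" "x = (\<Sum>t\<in>insert 0 roots. y t)"
      using root_decomposition by metis
    then show ?thesis using e' y(1)[of 0] root_space_0 by simp
  qed
  then show False using nonabelian cartan_abelian by blast
qed

lemma sum_list_count:
  assumes "set xs \<subseteq> A" "finite A"
  shows "sum_list xs = (\<Sum>\<alpha>\<in>A. of_nat (count_list xs \<alpha>) \<cdot> \<alpha>)"
  using assms(1)
proof (induction xs)
  case (Cons x xs)
  have "(\<Sum>\<alpha>\<in>A. of_nat (count_list (x # xs) \<alpha>) \<cdot> \<alpha>)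
      = (\<Sum>\<alpha>\<in>A. (if \<alpha> = x then x else 0) + of_nat (count_list xs \<alpha>) \<cdot> \<alpha>)"
    by (intro sum.cong) (auto simp: scale_left_distrib)
  also have "\<dots> = x + sum_list xs"
    using Cons assms(2) by (simp add: sum.distrib)
  finally show ?case by simp
qed simp

text \<open>Let \<open>\<theta>\<close> be a root at which \<open>\<rho>\<close> is maximal. The space generated from \<open>\<gg>\<^sub>\<theta>\<close> by lowering is
  an ideal, because \<open>\<gg>\<^sub>\<theta>\<close> is annihilated by the positive root spaces; hence it is all of \<open>\<gg>\<close>. On
  the other hand its weights all lie below \<open>\<theta>\<close>.\<close>

lemma highest_root_exists:
  "\<exists>\<theta>\<in>pos_roots. \<forall>\<beta>\<in>roots. \<exists>xs. set xs \<subseteq> simple_roots \<and> \<theta> = \<beta> + sum_list xs"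
proof -
  have ne: "pair two_rho ` roots \<noteq> {}" using pos_roots_nonempty pos_roots_roots by blast
  have fin: "finite (pair two_rho ` roots)" using finite_roots by simp
  obtain \<theta> where th: "\<theta> \<in> roots" "pair two_rho \<theta> = Max (pair two_rho ` roots)"
    using Max_in[OF fin ne] by auto
  have max: "pair two_rho \<beta> \<le> pair two_rho \<theta>" if "\<beta> \<in> roots" for \<beta>
    using Max_ge[OF fin, of "pair two_rho \<beta>"] that th(2) by simp
  have pos: "\<theta> \<in> pos_roots"
  proof (rule ccontr)
    assume "\<theta> \<notin> pos_roots"
    then have "- \<theta> \<in> pos_roots" using root_pos_or_neg[OF th(1)] by blast
    then have "pair two_rho (- \<theta>) > 0" by (rule pair_two_rho_pos)
    then show False using max[OF roots_minus[OF th(1)]] by (simp add: pair_minus_right)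
  qed
  have th_h: "\<theta> \<in> \<hh>" using th(1) by (rule roots_in_cartan)
  have top: "\<lbrace>e, x\<rbrace> = 0" if e: "e \<in> root_space \<alpha>" "\<alpha> \<in> pos_roots" and x: "x \<in> root_space \<theta>" for e x \<alpha>
  proof -
    have "pair two_rho (\<alpha> + \<theta>) > pair two_rho \<theta>"
      using pair_two_rho_pos[OF e(2)] by (simp add: pair_add_right)
    then have nr: "\<alpha> + \<theta> \<notin> roots" using max[of "\<alpha> + \<theta>"] by auto
    have "\<alpha> + \<theta> \<noteq> 0"
      using pair_two_rho_pos[OF e(2)] pair_two_rho_pos[OF pos] pair_add_right[of two_rho \<alpha> \<theta>] by auto
    moreover have "\<alpha> + \<theta> \<in> \<hh>" by (intro cartan_add roots_in_cartan pos_roots_roots e th_h)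
    ultimately have "root_space (\<alpha> + \<theta>) = {0}" using nr root_space_nonroot by blast
    then show ?thesis using bracket_root_space[OF e(1) x] by simp
  qed
  define closed where "closed T \<longleftrightarrow> subspace T \<and> root_space \<theta> \<subseteq> T \<and>
    (\<forall>\<alpha>\<in>pos_roots. \<forall>f\<in>root_space (- \<alpha>). \<forall>u\<in>T. \<lbrace>f, u\<rbrace> \<in> T)" for T
  define U where "U = \<Inter> {T. closed T}"
  have Uc: "closed U"
  proof -
    have "subspace U" unfolding U_def by (rule subspace_Inter) (auto simp: closed_def)
    then show ?thesis unfolding closed_def U_def by blast
  qed
  then have sub: "subspace U" and base: "root_space \<theta> \<subseteq> U"
    and low: "\<And>\<alpha> f u. \<alpha> \<in> pos_roots \<Longrightarrow> f \<in> root_space (- \<alpha>) \<Longrightarrow> u \<in> U \<Longrightarrow> \<lbrace>f, u\<rbrace> \<in> U"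
    unfolding closed_def by blast+
  have "closed {u \<in> U. \<forall>y. \<lbrace>y, u\<rbrace> \<in> U}" (is "closed ?T")
    unfolding closed_def
  proof (intro conjI ballI)
    show "subspace ?T"
      using sub by (intro subspaceI)
        (auto simp: bracket_add_right bracket_scale_right subspace_0 subspace_add subspace_scale)
    show "root_space \<theta> \<subseteq> ?T"
    proof
      fix u assume u: "u \<in> root_space \<theta>"
      then have uU: "u \<in> U" using base by blast
      have "\<lbrace>y, u\<rbrace> \<in> U" for y
      proof -
        obtain c where c: "\<And>t. c t \<in> root_space t" "y = (\<Sum>t\<in>insert 0 roots. c t)"
          using root_decomposition by metis
        have "\<lbrace>c t, u\<rbrace> \<in> U" if t: "t \<in> insert 0 roots" for t
        proof -
          consider "t = 0" | "t \<in> pos_roots" | "- t \<in> pos_roots" using t root_pos_or_neg by blast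
          then show ?thesis
          proof cases
            case 1
            then have "\<lbrace>c t, u\<rbrace> = killing \<theta> (c t) \<cdot> u"
              using c(1)[of 0] root_space_0 u by (simp add: root_space_def[of \<theta>])
            then show ?thesis using uU sub by (simp add: subspace_scale)
          next
            case 2
            then show ?thesis using top[OF c(1) _ u] subspace_0[OF sub] by simp
          next
            case 3
            then show ?thesis using low[OF 3 _ uU] c(1)[of t] by simp
          qed
        qed
        then have "(\<Sum>t\<in>insert 0 roots. \<lbrace>c t, u\<rbrace>) \<in> U" by (rule subspace_sum[OF sub])
        moreover have "\<lbrace>y, u\<rbrace> = (\<Sum>t\<in>insert 0 roots. \<lbrace>c t, u\<rbrace>)"
          unfolding c(2) bracket_anticommute[of _ u] bracket_sum_right by (simp add: sum_negf)
        ultimately show ?thesis by simp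
      qed
      then show "u \<in> ?T" using uU by simp
    qed
    fix \<alpha> f u assume a: "\<alpha> \<in> pos_roots" "f \<in> root_space (- \<alpha>)" "u \<in> ?T"
    have "\<lbrace>y, \<lbrace>f, u\<rbrace>\<rbrace> \<in> U" for y
      unfolding bracket_derivation[of y f u]
      using a low[OF a(1,2)] by (intro subspace_add[OF sub]) auto
    then show "\<lbrace>f, u\<rbrace> \<in> ?T" using low[OF a(1,2)] a(3) by simp
  qed
  then have "U \<subseteq> ?T" unfolding U_def by blast
  then have "ideal_of U UNIV" unfolding ideal_of_def using sub by blast
  moreover have "U \<noteq> {0}"
    using base th(1) root_vector[of \<theta>] by blast
  ultimately have UNIV: "U = UNIV" using ideal_trivial by blast
  define M where "M = {\<mu> \<in> \<hh>. \<exists>xs. set xs \<subseteq> simple_roots \<and> \<theta> = \<mu> + sum_list xs}"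
  have "closed (span (\<Union>\<mu>\<in>M. root_space \<mu>))" (is "closed (span ?V)")
    unfolding closed_def
  proof (intro conjI ballI)
    have "\<theta> \<in> M" unfolding M_def using th_h by (auto intro: exI[of _ "[]"])
    then show "root_space \<theta> \<subseteq> span ?V" by (rule subset_trans[OF UN_upper span_superset])
    fix \<alpha> f u assume a: "\<alpha> \<in> pos_roots" "f \<in> root_space (- \<alpha>)" "u \<in> span ?V"
    obtain ys where ys: "set ys \<subseteq> simple_roots" "\<alpha> = sum_list ys"
      using pos_root_sum_simple[OF a(1)] unfolding root_sums_def by blast
    show "\<lbrace>f, u\<rbrace> \<in> span ?V"
    proof (rule bracket_spans[OF subspace_span _ span_base[of f "{f}"] a(3)])
      fix f' v assume "f' \<in> {f}" "v \<in> ?V"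
      then obtain \<mu> where m: "f' = f" "\<mu> \<in> M" "v \<in> root_space \<mu>" by blast
      obtain xs where xs: "set xs \<subseteq> simple_roots" "\<theta> = \<mu> + sum_list xs" "\<mu> \<in> \<hh>"
        using m(2) unfolding M_def by blast
      have "\<theta> = (- \<alpha> + \<mu>) + sum_list (xs @ ys)"
        unfolding xs(2) ys(2) by (simp add: algebra_simps)
      moreover have "- \<alpha> + \<mu> \<in> \<hh>"
        by (rule cartan_add[OF roots_in_cartan[OF roots_minus[OF pos_roots_roots[OF a(1)]]] xs(3)])
      moreover have "set (xs @ ys) \<subseteq> simple_roots" using xs(1) ys(1) by simp
      ultimately have "- \<alpha> + \<mu> \<in> M" unfolding M_def by blast
      then show "\<lbrace>f', v\<rbrace> \<in> span ?V"
        using bracket_root_space[OF a(2) m(3)] unfolding m(1) by (intro span_base) blast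
    qed simp
  qed simp
  then have "U \<subseteq> span ?V" unfolding U_def by blast
  then have span: "x \<in> span ?V" for x using UNIV by blast
  have "\<exists>xs. set xs \<subseteq> simple_roots \<and> \<theta> = \<beta> + sum_list xs" if b: "\<beta> \<in> roots" for \<beta>
  proof -
    obtain x where x: "x \<in> root_space \<beta>" "x \<noteq> 0" using b by (rule root_vector)
    have "M \<subseteq> \<hh>" by (auto simp: M_def)
    then have "\<beta> \<in> M" by (rule root_space_meets_span[OF _ span roots_in_cartan[OF b] x])
    then show ?thesis by (simp add: M_def)
  qed
  then show ?thesis using pos by blast
qed

lemma highest_root:
  shows "highest_root \<in> pos_roots"
    and "\<beta> \<in> roots \<Longrightarrow> \<exists>xs. set xs \<subseteq> simple_roots \<and> highest_root = \<beta> + sum_list xs"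
proof -
  obtain \<theta> where th: "\<theta> \<in> pos_roots"
    "\<And>\<beta>. \<beta> \<in> roots \<Longrightarrow> \<exists>xs. set xs \<subseteq> simple_roots \<and> \<theta> = \<beta> + sum_list xs"
    using highest_root_exists by blast
  let ?P = "\<lambda>\<theta>. \<theta> \<in> roots \<and>
     (\<forall>\<beta>\<in>roots. \<exists>c :: 'g \<Rightarrow> nat. \<theta> - \<beta> = (\<Sum>\<alpha>\<in>simple_roots. of_nat (c \<alpha>) \<cdot> \<alpha>))"
  have P: "?P \<theta>"
  proof (intro conjI ballI)
    show "\<theta> \<in> roots" using th(1) by (rule pos_roots_roots)
    fix \<beta> assume "\<beta> \<in> roots"
    then obtain xs where xs: "set xs \<subseteq> simple_roots" "\<theta> = \<beta> + sum_list xs" using th(2) by blast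
    then have "\<theta> - \<beta> = (\<Sum>\<alpha>\<in>simple_roots. of_nat (count_list xs \<alpha>) \<cdot> \<alpha>)"
      using sum_list_count[OF xs(1) finite_simple_roots] by simp
    then show "\<exists>c :: 'g \<Rightarrow> nat. \<theta> - \<beta> = (\<Sum>\<alpha>\<in>simple_roots. of_nat (c \<alpha>) \<cdot> \<alpha>)"
      by (rule exI[of _ "count_list xs"])
  qed
  have unique: "\<theta>' = \<theta>" if P': "?P \<theta>'" for \<theta>'
  proof -
    obtain c :: "'g \<Rightarrow> nat" where "\<theta>' - \<theta> = (\<Sum>\<alpha>\<in>simple_roots. of_nat (c \<alpha>) \<cdot> \<alpha>)"
      using P' P by blast
    moreover have "pair two_rho (\<Sum>\<alpha>\<in>simple_roots. of_nat (c \<alpha>) \<cdot> \<alpha>) \<ge> 0"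
      unfolding pair_sum_right using pair_two_rho_pos[OF simple_roots_pos]
      by (intro sum_nonneg) (simp add: pair_sym[of two_rho] pair_scale_of_nat less_imp_le)
    ultimately have le: "pair two_rho \<theta> \<le> pair two_rho \<theta>'"
      by (metis diff_ge_0_iff_ge pair_diff_right)
    obtain xs where xs: "set xs \<subseteq> simple_roots" "\<theta> = \<theta>' + sum_list xs" using th(2) P' by blast
    have "xs = []"
    proof (rule ccontr)
      assume "xs \<noteq> []"
      then have "sum_list xs \<in> root_sums pos_roots"
        using xs(1) simple_roots_pos by (intro root_sumsI[of xs]) auto
      then have "pair two_rho (sum_list xs) > 0"
        by (induction rule: root_sums_induct) (simp_all add: pair_two_rho_pos pair_add_right)
      then show False using le xs(2) by (simp add: pair_add_right)
    qed
    then show ?thesis using xs by simp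
  qed
  have "highest_root = \<theta>" unfolding highest_root_def by (rule the_equality[of ?P, OF P unique])
  then show "highest_root \<in> pos_roots"
    "\<beta> \<in> roots \<Longrightarrow> \<exists>xs. set xs \<subseteq> simple_roots \<and> highest_root = \<beta> + sum_list xs"
    using th by blast+
qed

lemma pair_le_highest_root:
  assumes "\<And>\<alpha>. \<alpha> \<in> simple_roots \<Longrightarrow> pair x \<alpha> \<ge> 0" "\<beta> \<in> roots"
  shows "pair x \<beta> \<le> pair x highest_root"
proof -
  obtain xs where xs: "set xs \<subseteq> simple_roots" "highest_root = \<beta> + sum_list xs"
    using highest_root(2)[OF assms(2)] by blast
  have "pair x (sum_list xs) \<ge> 0"
    unfolding pair_sum_list using xs(1) assms(1) by (intro sum_list_nonneg) auto
  then show ?thesis by (simp add: xs(2) pair_add_right)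
qed

section \<open>The Weyl group\<close>

lemma reflection_weyl: "\<alpha> \<in> roots \<Longrightarrow> reflection \<alpha> \<in> weyl"
  using weyl_step[OF _ weyl_id, of \<alpha>] by simp

lemma weyl_compose: "v \<in> weyl \<Longrightarrow> w \<in> weyl \<Longrightarrow> v \<circ> w \<in> weyl"
  by (induction rule: weyl.induct) (auto simp: comp_assoc intro: weyl_step)

lemma lin_weyl: "w \<in> weyl \<Longrightarrow> lin w"
proof (induction rule: weyl.induct)
  case (weyl_step \<alpha> w)
  then show ?case using lin_compose[OF lin_reflection] by (simp add: comp_def)
qed (simp add: lin_iff)

lemma killing_weyl: "w \<in> weyl \<Longrightarrow> killing (w x) (w y) = killing x y"
  by (induction rule: weyl.induct) (simp_all add: killing_reflection)

lemma weyl_root: "w \<in> weyl \<Longrightarrow> \<alpha> \<in> roots \<Longrightarrow> w \<alpha> \<in> roots"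
  by (induction rule: weyl.induct) (simp_all add: reflection_root)

lemma weyl_h_real: "w \<in> weyl \<Longrightarrow> x \<in> h_real \<Longrightarrow> w x \<in> h_real"
  by (induction rule: weyl.induct) (simp_all add: reflection_in_h_real)

lemma weyl_inverse:
  assumes "w \<in> weyl"
  shows "bij w" "inv w \<in> weyl"
proof -
  have "\<exists>u\<in>weyl. u \<circ> w = id \<and> w \<circ> u = id" using assms
  proof (induction rule: weyl.induct)
    case weyl_id
    show ?case using weyl.weyl_id by (intro bexI[of _ id]) auto
  next
    case (weyl_step \<alpha> w)
    then obtain u where u: "u \<in> weyl" "u \<circ> w = id" "w \<circ> u = id" by blast
    have s: "reflection \<alpha> \<circ> reflection \<alpha> = id"
      using reflection_involution[OF weyl_step.hyps(1)] by (simp add: fun_eq_iff)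
    have "(u \<circ> reflection \<alpha>) \<circ> (reflection \<alpha> \<circ> w) = u \<circ> (reflection \<alpha> \<circ> reflection \<alpha>) \<circ> w"
      by (simp only: comp_assoc)
    then have "(u \<circ> reflection \<alpha>) \<circ> (reflection \<alpha> \<circ> w) = id" by (simp add: s u)
    moreover have "(reflection \<alpha> \<circ> w) \<circ> (u \<circ> reflection \<alpha>) = reflection \<alpha> \<circ> (w \<circ> u) \<circ> reflection \<alpha>"
      by (simp only: comp_assoc)
    then have "(reflection \<alpha> \<circ> w) \<circ> (u \<circ> reflection \<alpha>) = id" by (simp add: s u)
    ultimately show ?case
      using weyl_compose[OF u(1) reflection_weyl[OF weyl_step.hyps(1)]] by blast
  qed
  then obtain u where u: "u \<in> weyl" "u \<circ> w = id" "w \<circ> u = id" by blast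
  then show "bij w" using o_bij by blast
  have "inv w = u" using u by (metis inv_unique_comp)
  then show "inv w \<in> weyl" using u(1) by simp
qed

lemma weyl_inv_apply [simp]:
  assumes "w \<in> weyl"
  shows "w (inv w x) = x" "inv w (w x) = x"
  using weyl_inverse(1)[OF assms] by (simp_all add: bij_is_inj bij_is_surj surj_f_inv_f)

lemma pair_weyl: "w \<in> weyl \<Longrightarrow> pair (w x) (w y) = pair x y"
  by (simp add: pair_def killing_weyl)

lemma pair_weyl_left: "w \<in> weyl \<Longrightarrow> pair (w x) y = pair x (inv w y)"
  using pair_weyl[of w x "inv w y"] by simp

lemma coroot_weyl: "w \<in> weyl \<Longrightarrow> coroot (w \<alpha>) = w (coroot \<alpha>)"
  using lin_weyl[of w] by (simp add: coroot_def killing_weyl lin_iff)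

lemma reflection_weyl_conjugate:
  "w \<in> weyl \<Longrightarrow> w (reflection \<alpha> x) = reflection (w \<alpha>) (w x)"
proof -
  assume w: "w \<in> weyl"
  have "w (x - c \<cdot> \<alpha>) = w x - c \<cdot> w \<alpha>" for c
    using lin_weyl[OF w] lin_minus[OF lin_weyl[OF w], of "c \<cdot> \<alpha>"] unfolding lin_iff
    by (metis diff_conv_add_uminus)
  then show ?thesis by (simp add: reflection_def coroot_weyl[OF w] killing_weyl[OF w])
qed

primrec reflection_word :: "'g list \<Rightarrow> 'g \<Rightarrow> 'g" where
  "reflection_word [] = id"
| "reflection_word (\<alpha> # xs) = reflection \<alpha> \<circ> reflection_word xs"

lemma reflection_word_foldr: "foldr (\<lambda>\<alpha> w. reflection \<alpha> \<circ> w) xs id = reflection_word xs"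
  by (induction xs) simp_all

lemma reflection_word_append: "reflection_word (xs @ ys) = reflection_word xs \<circ> reflection_word ys"
  by (induction xs) (simp_all add: comp_assoc)

lemma reflection_word_weyl: "set xs \<subseteq> roots \<Longrightarrow> reflection_word xs \<in> weyl"
  by (induction xs) (auto intro: weyl_id weyl_step)

text \<open>A positive root that is not simple is moved down by some simple reflection, so all
  reflections are conjugate to simple ones under simple reflections.\<close>

lemma pos_reflection_word:
  "\<beta> \<in> pos_roots \<Longrightarrow> \<exists>xs. set xs \<subseteq> simple_roots \<and> reflection \<beta> = reflection_word xs"
proof (induction "root_rank pos_roots \<beta>" arbitrary: \<beta> rule: less_induct)
  case less
  have rb: "\<beta> \<in> roots" using less.prems by (rule pos_roots_roots)
  show ?case
  proof (cases "\<beta> \<in> simple_roots")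
    case True
    then show ?thesis by (intro exI[of _ "[\<beta>]"]) simp
  next
    case False
    have "\<exists>\<alpha>\<in>simple_roots. pair \<beta> \<alpha> > 0"
    proof (rule ccontr)
      assume "\<not> ?thesis"
      then have "pair (- \<beta>) \<alpha> \<ge> 0" if "\<alpha> \<in> simple_roots" for \<alpha>
        using that by (force simp: pair_minus_left)
      then have "pair (- \<beta>) \<beta> \<ge> 0" using less.prems by (rule pair_pos_nonneg)
      then show False using pair_root_self_pos[OF rb] by (simp add: pair_minus_left)
    qed
    then obtain \<alpha> where a: "\<alpha> \<in> simple_roots" "pair \<beta> \<alpha> > 0" by blast
    have ra: "\<alpha> \<in> roots" using a(1) by (rule simple_roots_roots)
    define \<gamma> where "\<gamma> = reflection \<alpha> \<beta>"
    have g: "\<gamma> \<in> pos_roots"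
      unfolding \<gamma>_def using simple_reflection_pos[OF a(1) less.prems] False a(1) by blast
    obtain n :: int where n: "reflection \<alpha> \<beta> = \<beta> - of_int n \<cdot> \<alpha>" "2 * pair \<beta> \<alpha> = of_int n * pair \<alpha> \<alpha>"
      by (rule root_integrality[OF ra rb])
    have "of_int n * pair \<alpha> \<alpha> > 0" unfolding n(2)[symmetric] using a(2) by simp
    then have n0: "n > 0" using pair_root_self_pos[OF ra] by (simp add: zero_less_mult_iff)
    have "of_int n \<cdot> \<alpha> \<in> root_sums pos_roots"
      using n0 simple_roots_pos[OF a(1)]
      by (intro root_sumsI[of "replicate (nat n) \<alpha>"]) (auto simp: sum_list_replicate_scale)
    then have "root_rank pos_roots \<gamma> < root_rank pos_roots (\<gamma> + of_int n \<cdot> \<alpha>)"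
      by (rule root_rank_less[OF finite_pos_roots pos_root_sums_nonzero g])
    then have "root_rank pos_roots \<gamma> < root_rank pos_roots \<beta>" by (simp add: \<gamma>_def n(1))
    from less.hyps[OF this g] obtain xs
      where xs: "set xs \<subseteq> simple_roots" "reflection \<gamma> = reflection_word xs" by blast
    have "reflection \<beta> x = reflection \<alpha> (reflection \<gamma> (reflection \<alpha> x))" for x
      using reflection_weyl_conjugate[OF reflection_weyl[OF ra], of \<gamma> "reflection \<alpha> x"]
      by (simp add: \<gamma>_def reflection_involution[OF ra])
    then have "reflection \<beta> = reflection_word (\<alpha> # xs @ [\<alpha>])"
      by (simp add: reflection_word_append xs(2)[symmetric] fun_eq_iff)
    then show ?thesis using xs(1) a(1) by (intro exI[of _ "\<alpha> # xs @ [\<alpha>]"]) simp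
  qed
qed

lemma weyl_simple_word: "w \<in> weyl \<Longrightarrow> \<exists>xs. set xs \<subseteq> simple_roots \<and> w = reflection_word xs"
proof (induction rule: weyl.induct)
  case weyl_id
  show ?case by (intro exI[of _ "[]"]) simp
next
  case (weyl_step \<alpha> w)
  have "\<exists>ys. set ys \<subseteq> simple_roots \<and> reflection \<alpha> = reflection_word ys"
    using root_pos_or_neg[OF weyl_step.hyps(1)] pos_reflection_word[of \<alpha>] pos_reflection_word[of "- \<alpha>"]
      reflection_minus_root[of \<alpha>] by auto
  then obtain xs ys where "set ys \<subseteq> simple_roots" "reflection \<alpha> = reflection_word ys"
      "set xs \<subseteq> simple_roots" "w = reflection_word xs"
    using weyl_step.IH by blast
  then show ?case by (intro exI[of _ "ys @ xs"]) (simp add: reflection_word_append)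
qed

text \<open>Read from the right, the letters of the word take \<open>\<alpha>\<close> out of the positive roots at some letter
  \<open>b\<close>. The only positive root that \<open>s\<^sub>b\<close> makes negative is \<open>b\<close>, so up to there \<open>\<alpha>\<close> has been moved to \<open>b\<close>,
  and multiplying by \<open>s\<^sub>\<alpha>\<close> from the right amounts to deleting this letter.\<close>

lemma exchange:
  assumes a: "\<alpha> \<in> simple_roots"
  shows "set xs \<subseteq> simple_roots \<Longrightarrow> reflection_word xs \<alpha> \<notin> pos_roots \<Longrightarrow>
    \<exists>ys. set ys \<subseteq> simple_roots \<and> length xs = Suc (length ys) \<and>
      reflection_word xs \<circ> reflection \<alpha> = reflection_word ys"
proof (induction xs)
  case Nil
  then show ?case using simple_roots_pos[OF a] by simp
next
  case (Cons b xs)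
  have xs: "set xs \<subseteq> simple_roots" and b: "b \<in> simple_roots" using Cons.prems by auto
  show ?case
  proof (cases "reflection_word xs \<alpha> \<in> pos_roots")
    case False
    then obtain ys where "set ys \<subseteq> simple_roots" "length xs = Suc (length ys)"
        "reflection_word xs \<circ> reflection \<alpha> = reflection_word ys"
      using Cons.IH[OF xs] by blast
    then show ?thesis using b by (intro exI[of _ "b # ys"]) (simp add: fun_eq_iff)
  next
    case True
    have w: "reflection_word xs \<in> weyl"
      using xs simple_roots_roots by (intro reflection_word_weyl) auto
    have "reflection_word xs \<alpha> = b"
      using simple_reflection_pos[OF b True] Cons.prems(2) by auto
    then have "reflection_word (b # xs) (reflection \<alpha> x) = reflection_word xs x" for x
      using reflection_weyl_conjugate[OF w, of \<alpha> x] reflection_involution[OF simple_roots_roots[OF b]]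
      by simp
    then show ?thesis using xs by (intro exI[of _ xs]) (simp add: fun_eq_iff)
  qed
qed

text \<open>If a word for \<open>w\<close> ends in \<open>\<alpha>\<close>, then \<open>w \<alpha>\<close> is positive, so the word without its last letter takes
  \<open>\<alpha>\<close> to a negative root, and the exchange lemma gives a shorter word for \<open>w\<close>.\<close>

theorem weyl_preserving_pos_roots:
  assumes w: "w \<in> weyl" and pos: "\<And>\<alpha>. \<alpha> \<in> pos_roots \<Longrightarrow> w \<alpha> \<in> pos_roots"
  shows "w = id"
proof -
  have "set xs \<subseteq> simple_roots \<Longrightarrow> (\<forall>\<alpha>\<in>pos_roots. reflection_word xs \<alpha> \<in> pos_roots) \<Longrightarrow>
    reflection_word xs = id" for xs
  proof (induction "length xs" arbitrary: xs rule: less_induct)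
    case less
    show ?case
    proof (cases xs rule: rev_cases)
      case (snoc bs \<alpha>)
      have a: "\<alpha> \<in> simple_roots" and bs: "set bs \<subseteq> simple_roots" using less.prems snoc by auto
      have ra: "\<alpha> \<in> roots" using a by (rule simple_roots_roots)
      have lin: "lin (reflection_word bs)"
        using bs simple_roots_roots by (intro lin_weyl reflection_word_weyl) auto
      have xs: "reflection_word xs = reflection_word bs \<circ> reflection \<alpha>"
        by (simp add: snoc reflection_word_append)
      have "reflection_word xs \<alpha> = - reflection_word bs \<alpha>"
        by (simp add: xs reflection_self[OF ra] lin_minus[OF lin])
      then have "- reflection_word bs \<alpha> \<in> pos_roots" using less.prems(2) simple_roots_pos[OF a] by metis
      then have "reflection_word bs \<alpha> \<notin> pos_roots" using minus_pos_root_not_pos by force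
      then obtain ys where ys: "set ys \<subseteq> simple_roots" "length bs = Suc (length ys)"
          "reflection_word xs = reflection_word ys"
        using exchange[OF a bs] xs by auto
      have "reflection_word ys = id"
        using less.prems(2) ys by (intro less.hyps) (auto simp: snoc)
      then show ?thesis using ys(3) by simp
    qed simp
  qed
  then show ?thesis using weyl_simple_word[OF w] pos by metis
qed

text \<open>An element of \<open>W\<close> is determined by its action on the roots.\<close>

lemma finite_weyl: "finite weyl"
proof (rule inj_on_finite[of "\<lambda>w. restrict w roots" _ "roots \<rightarrow>\<^sub>E roots"])
  show "inj_on (\<lambda>w. restrict w roots) weyl"
  proof (rule inj_onI)
    fix v w assume v: "v \<in> weyl" and w: "w \<in> weyl" and eq: "restrict v roots = restrict w roots"
    have "(inv v \<circ> w) \<alpha> = \<alpha>" if "\<alpha> \<in> roots" for \<alpha>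
      using fun_cong[OF eq, of \<alpha>] that v by (metis comp_apply restrict_apply' weyl_inv_apply(2))
    then have "inv v \<circ> w = id"
      using weyl_compose[OF weyl_inverse(2)[OF v] w] pos_roots_roots
      by (intro weyl_preserving_pos_roots) auto
    then have "v (inv v (w x)) = v x" for x by (simp add: fun_eq_iff)
    then show "v = w" using v by auto
  qed
qed (use weyl_root finite_roots in \<open>auto intro: finite_PiE\<close>)

text \<open>A simple reflection in a root that is negative at \<open>v p\<close> increases the number of positive roots that
  are positive there by one.\<close>

lemma weyl_dominant:
  assumes reg: "\<And>\<alpha>. \<alpha> \<in> roots \<Longrightarrow> pair p \<alpha> \<noteq> 0"
  shows "\<exists>v\<in>weyl. \<forall>\<alpha>\<in>pos_roots. pair (v p) \<alpha> > 0"
proof -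
  define N where "N v = {\<alpha> \<in> pos_roots. pair (v p) \<alpha> > 0}" for v :: "'g \<Rightarrow> 'g"
  have "card (N v) < Suc (card pos_roots)" for v
    unfolding N_def less_Suc_eq_le by (rule card_mono[OF finite_pos_roots]) auto
  then have "\<exists>v. v \<in> weyl \<and> (\<forall>u. u \<in> weyl \<longrightarrow> card (N u) \<le> card (N v))"
    using ex_has_greatest_nat[of "\<lambda>v. v \<in> weyl" id "\<lambda>v. card (N v)", OF weyl_id] by blast
  then obtain v where v: "v \<in> weyl" and max: "\<And>u. u \<in> weyl \<Longrightarrow> card (N u) \<le> card (N v)" by blast
  have "pair (v p) \<alpha> > 0" if a: "\<alpha> \<in> simple_roots" for \<alpha>
  proof (rule ccontr)
    assume "\<not> pair (v p) \<alpha> > 0"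
    have ra: "\<alpha> \<in> roots" using a by (rule simple_roots_roots)
    have sw: "reflection \<alpha> \<circ> v \<in> weyl" using ra v by (rule weyl_step)
    have "pair (v p) \<alpha> \<noteq> 0"
      unfolding pair_weyl_left[OF v] by (rule reg[OF weyl_root[OF weyl_inverse(2)[OF v] ra]])
    then have neg: "pair (v p) \<alpha> < 0" using \<open>\<not> pair (v p) \<alpha> > 0\<close> by simp
    have s: "pair (reflection \<alpha> x) (reflection \<alpha> y) = pair x y" for x y
      by (rule pair_weyl[OF reflection_weyl[OF ra]])
    have "insert \<alpha> (reflection \<alpha> ` N v) \<subseteq> N (reflection \<alpha> \<circ> v)"
    proof -
      have "pair (reflection \<alpha> (v p)) \<alpha> > 0"
        using s[of "v p" "- \<alpha>"] neg lin_minus[OF lin_reflection, of \<alpha> \<alpha>]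
        by (simp add: reflection_self[OF ra] pair_minus_right)
      moreover have "reflection \<alpha> \<beta> \<in> pos_roots" if "\<beta> \<in> N v" for \<beta>
        using that neg by (intro simple_reflection_pos[OF a]) (auto simp: N_def)
      ultimately show ?thesis using simple_roots_pos[OF a] s by (auto simp: N_def)
    qed
    moreover have "\<alpha> \<notin> reflection \<alpha> ` N v"
    proof
      assume "\<alpha> \<in> reflection \<alpha> ` N v"
      then obtain \<beta> where "\<beta> \<in> N v" "\<alpha> = reflection \<alpha> \<beta>" by blast
      then have "- \<alpha> \<in> N v" using reflection_involution[OF ra, of \<beta>] reflection_self[OF ra] by metis
      then show False using minus_pos_root_not_pos[OF simple_roots_pos[OF a]] by (simp add: N_def)
    qed
    moreover have fin: "finite (N u)" for u using finite_pos_roots by (simp add: N_def)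
    moreover have "card (reflection \<alpha> ` N v) = card (N v)"
      using reflection_involution[OF ra] by (intro card_image) (metis inj_onI)
    ultimately have "Suc (card (N v)) \<le> card (N (reflection \<alpha> \<circ> v))"
      using card_mono[OF fin, of "insert \<alpha> (reflection \<alpha> ` N v)"] by simp
    then show False using max[OF sw] by simp
  qed
  then show ?thesis using pair_pos_positive v by blast
qed

subsection \<open>The Coxeter number\<close>

lemma simple_reflection_add:
  assumes "b \<in> simple_roots" "set ys \<subseteq> simple_roots" "b \<notin> set ys"
  shows "\<exists>k::nat. reflection b (sum_list ys) = sum_list ys + of_nat k \<cdot> b"
  using assms(2,3)
proof (induction ys)
  case Nil
  show ?case using lin_zero[OF lin_reflection] by (intro exI[of _ 0]) simp
next
  case (Cons y ys)
  have rb: "b \<in> roots" and ry: "y \<in> roots" using simple_roots_roots assms(1) Cons.prems by auto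
  obtain n :: int where n: "reflection b y = y - of_int n \<cdot> b" "2 * pair y b = of_int n * pair b b"
    by (rule root_integrality[OF rb ry])
  have "pair y b \<le> 0" using simple_roots_obtuse[of y b] Cons.prems assms(1) by auto
  then have "of_int n * pair b b \<le> 0" unfolding n(2)[symmetric] by simp
  then have "n \<le> 0" using pair_root_self_pos[OF rb] by (simp add: mult_le_0_iff)
  then have m: "n = - int (nat (- n))" by simp
  obtain k :: nat where k: "reflection b (sum_list ys) = sum_list ys + of_nat k \<cdot> b"
    using Cons by auto
  define m where "m = nat (- n)"
  have "reflection b (sum_list (y # ys)) = y - of_int (- int m) \<cdot> b + (sum_list ys + of_nat k \<cdot> b)"
    using lin_reflection[of b] m by (simp add: lin_iff n(1) k m_def)
  also have "\<dots> = sum_list (y # ys) + of_nat (m + k) \<cdot> b"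
    by (simp add: scale_left_distrib algebra_simps)
  finally show ?case by blast
qed

text \<open>Simple roots are mutually obtuse, so reflecting in a letter that has not occurred yet adds
  nonnegative multiples of it.\<close>

lemma distinct_word_moves_up:
  assumes "a \<in> simple_roots" "set bs \<subseteq> simple_roots" "distinct (a # bs)"
  shows "\<exists>ys. set ys \<subseteq> set bs \<and> reflection_word bs a = sum_list (a # ys)"
  using assms
proof (induction bs)
  case Nil
  show ?case by (intro exI[of _ "[]"]) simp
next
  case (Cons b bs)
  then obtain ys where ys: "set ys \<subseteq> set bs" "reflection_word bs a = sum_list (a # ys)" by auto
  have "b \<in> simple_roots" "set (a # ys) \<subseteq> simple_roots" "b \<notin> set (a # ys)"
    using Cons.prems ys(1) by auto
  then obtain k :: nat where "reflection b (sum_list (a # ys)) = sum_list (a # ys) + of_nat k \<cdot> b"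
    using simple_reflection_add by blast
  then show ?case using ys
    by (intro exI[of _ "ys @ replicate k b"]) (auto simp: sum_list_replicate_scale add.assoc)
qed

lemma simple_roots_nonempty: "simple_roots \<noteq> {}"
proof -
  obtain \<alpha> where "\<alpha> \<in> pos_roots" using pos_roots_nonempty by blast
  then obtain xs where "set xs \<subseteq> simple_roots" "xs \<noteq> []"
    using pos_root_sum_simple unfolding root_sums_def by blast
  then show ?thesis by (cases xs) auto
qed

text \<open>The Coxeter element has finite order because \<open>W\<close> is finite. It is not the identity: its letters
  after the first one, \<open>a\<close>, move the root \<open>a\<close> up, whereas the reflection in \<open>a\<close> takes it to \<open>- a\<close>.\<close>

lemma coxeter_number_ge_2: "coxeter_number \<ge> 2"
proof -
  define as where "as = (SOME as. distinct as \<and> set as = simple_roots)"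
  have "\<exists>as. distinct as \<and> set as = simple_roots"
    using finite_distinct_list[OF finite_simple_roots] by blast
  then have "distinct as \<and> set as = simple_roots" unfolding as_def by (rule someI_ex)
  then have as: "distinct as" "set as = simple_roots" by auto
  have c: "coxeter_element = reflection_word as" 
    by (simp add: coxeter_element_def as_def reflection_word_foldr)
  have cw: "coxeter_element \<in> weyl"
    unfolding c using as(2) simple_roots_roots by (intro reflection_word_weyl) auto
  have "coxeter_element \<noteq> id"
  proof
    assume id: "coxeter_element = id"
    obtain a bs where abs: "as = a # bs" using as(2) simple_roots_nonempty by (cases as) auto
    have a: "a \<in> simple_roots" and bs: "set bs \<subseteq> simple_roots" using as(2) abs by auto
    obtain ys where ys: "set ys \<subseteq> set bs" "reflection_word bs a = sum_list (a # ys)"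
      using distinct_word_moves_up[OF a bs] as(1) abs by blast
    have "reflection a (reflection_word bs a) = a"
      using id unfolding c abs by (simp add: fun_eq_iff)
    then have "reflection_word bs a = - a"
      using reflection_involution[OF simple_roots_roots[OF a], of "reflection_word bs a"]
        reflection_self[OF simple_roots_roots[OF a]] by simp
    then have "sum_list (a # a # ys) = 0" using ys(2) by simp
    then have "0 \<in> root_sums pos_roots"
      using a bs ys(1) simple_roots_pos by (intro root_sumsI[of "a # a # ys"]) auto
    then show False using pos_root_sums_nonzero by blast
  qed
  have pow: "coxeter_element ^^ k \<in> weyl" for k
    by (induction k) (simp_all only: funpow.simps weyl_id weyl_compose[OF cw])
  have "\<not> inj (\<lambda>k. coxeter_element ^^ k)"
    using finite_weyl pow infinite_UNIV_nat finite_subset[of "range (\<lambda>k. coxeter_element ^^ k)" weyl]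
      finite_imageD by blast
  then obtain i j where "i \<noteq> j" "coxeter_element ^^ i = coxeter_element ^^ j"
    unfolding inj_on_def by blast
  then obtain i j where ij: "i < j" "coxeter_element ^^ i = coxeter_element ^^ j"
    by (metis linorder_neqE_nat)
  have "coxeter_element ^^ i \<circ> coxeter_element ^^ (j - i) = coxeter_element ^^ i"
    using ij by (metis funpow_add le_add_diff_inverse less_imp_le)
  then have "(coxeter_element ^^ i) ((coxeter_element ^^ (j - i)) x) = (coxeter_element ^^ i) x" for x
    by (simp add: fun_eq_iff)
  then have "coxeter_element ^^ (j - i) = id"
    using weyl_inverse(1)[OF pow[of i]] by (simp add: fun_eq_iff bij_is_inj inj_eq)
  then have "j - i > 0 \<and> coxeter_element ^^ (j - i) = id" using ij by simp
  then have "coxeter_number > 0 \<and> coxeter_element ^^ coxeter_number = id"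
    unfolding coxeter_number_def by (rule LeastI)
  moreover have "coxeter_number \<noteq> 1"
    using \<open>coxeter_element \<noteq> id\<close> calculation by auto
  ultimately show ?thesis by linarith
qed

section \<open>Alcoves and the affine Weyl group\<close>

(* keeps the index in "alcove 1" from being rewritten to "Suc 0" *)
declare One_nat_def [simp del]

subsection \<open>The fundamental alcove\<close>

lemma alcove_1_iff:
  "x \<in> alcove 1 \<longleftrightarrow> x \<in> h_real \<and> (\<forall>\<beta>\<in>pos_roots. 0 < pair x \<beta> \<and> pair x \<beta> < 1)"
proof
  assume x: "x \<in> alcove 1"
  then have s: "\<And>\<alpha>. \<alpha> \<in> simple_roots \<Longrightarrow> pair x \<alpha> > 0" by (simp add: alcove_def)
  have "pair x \<beta> \<le> pair x highest_root" if "\<beta> \<in> pos_roots" for \<beta>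
    using s that by (intro pair_le_highest_root pos_roots_roots) (auto intro: less_imp_le)
  then show "x \<in> h_real \<and> (\<forall>\<beta>\<in>pos_roots. 0 < pair x \<beta> \<and> pair x \<beta> < 1)"
    using x pair_pos_positive[OF s] by (fastforce simp: alcove_def)
qed (auto simp: alcove_def simple_roots_pos highest_root(1))

lemma alcove_1_nonempty: "alcove 1 \<noteq> {}"
proof -
  define t where "t = 1 / (2 * pair two_rho highest_root)"
  have pos: "pair two_rho highest_root > 0" by (rule pair_two_rho_pos[OF highest_root(1)])
  then have "t > 0" by (simp add: t_def)
  then have "complex_of_real t \<cdot> two_rho \<in> alcove 1"
    using pos pair_two_rho_pos[OF simple_roots_pos] h_real_scale[OF two_rho_h_real]
    by (simp add: alcove_def pair_scale_left) (simp add: t_def)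
  then show ?thesis by blast
qed

lemma cauchy_schwarz_root:
  assumes u: "u \<in> h_real" and a: "\<alpha> \<in> roots"
  shows "(pair u \<alpha>)\<^sup>2 \<le> pair u u * pair \<alpha> \<alpha>"
proof -
  define t where "t = pair u \<alpha> / pair \<alpha> \<alpha>"
  have p: "pair \<alpha> \<alpha> > 0" by (rule pair_root_self_pos[OF a])
  have "pair (u - complex_of_real t \<cdot> \<alpha>) (u - complex_of_real t \<cdot> \<alpha>) \<ge> 0"
    by (intro pair_nonneg h_real_diff h_real_scale h_real_roots u a)
  then have "pair u u - 2 * t * pair u \<alpha> + t * t * pair \<alpha> \<alpha> \<ge> 0"
    by (simp add: pair_diff_left pair_diff_right pair_scale_left pair_scale_right pair_sym[of \<alpha> u] algebra_simps)
  moreover have "t * t * pair \<alpha> \<alpha> = t * pair u \<alpha>" using p by (simp add: t_def)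
  ultimately have "t * pair u \<alpha> \<le> pair u u" by simp
  then have "t * pair u \<alpha> * pair \<alpha> \<alpha> \<le> pair u u * pair \<alpha> \<alpha>" using p by (simp add: mult_right_mono)
  moreover have "t * pair u \<alpha> * pair \<alpha> \<alpha> = (pair u \<alpha>)\<^sup>2" using p by (simp add: t_def power2_eq_square)
  ultimately show ?thesis by simp
qed

lemma eclosure_pair_ge:
  assumes x: "x \<in> eclosure S" and S: "S \<subseteq> h_real" and a: "\<alpha> \<in> roots"
    and ge: "\<And>y. y \<in> S \<Longrightarrow> pair y \<alpha> \<ge> c"
  shows "pair x \<alpha> \<ge> c"
proof (rule ccontr)
  assume "\<not> pair x \<alpha> \<ge> c"
  define d where "d = c - pair x \<alpha>"
  have d: "d > 0" using \<open>\<not> pair x \<alpha> \<ge> c\<close> by (simp add: d_def)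
  have p: "pair \<alpha> \<alpha> > 0" by (rule pair_root_self_pos[OF a])
  have xh: "x \<in> h_real" using x by (simp add: eclosure_def)
  have "d\<^sup>2 / pair \<alpha> \<alpha> > 0" using d p by simp
  then obtain y where y: "y \<in> S" "pair (x - y) (x - y) < d\<^sup>2 / pair \<alpha> \<alpha>"
    using x unfolding eclosure_def by blast
  have "(pair (x - y) \<alpha>)\<^sup>2 \<le> pair (x - y) (x - y) * pair \<alpha> \<alpha>"
    using xh y(1) S by (intro cauchy_schwarz_root a h_real_diff) auto
  also have "\<dots> < d\<^sup>2" using y(2) p by (simp add: pos_less_divide_eq)
  finally have "\<bar>pair (x - y) \<alpha>\<bar> < d"
    using d by (metis abs_le_square_iff abs_of_pos linorder_not_less)
  then show False using ge[OF y(1)] by (simp add: pair_diff_left d_def)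
qed

text \<open>The inequalities are closed conditions. Conversely, a point that satisfies them is approached along
  the segment from a point of the open fundamental alcove.\<close>

lemma eclosure_alcove:
  assumes r: "r \<ge> 1"
  shows "eclosure (alcove r) =
    {x \<in> h_real. (\<forall>\<alpha>\<in>simple_roots. pair x \<alpha> \<ge> 0) \<and> pair x highest_root \<le> real r}" (is "?L = ?R")
proof
  have th: "highest_root \<in> roots" using highest_root(1) by (rule pos_roots_roots)
  have sub: "alcove r \<subseteq> h_real" by (auto simp: alcove_def)
  show "?L \<subseteq> ?R"
  proof
    fix x assume x: "x \<in> ?L"
    have "pair x \<alpha> \<ge> 0" if "\<alpha> \<in> simple_roots" for \<alpha>
      using that by (intro eclosure_pair_ge[OF x sub simple_roots_roots]) (auto simp: alcove_def less_imp_le)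
    moreover have "pair x (- highest_root) \<ge> - real r"
      by (intro eclosure_pair_ge[OF x sub roots_minus[OF th]])
        (auto simp: alcove_def pair_minus_right less_imp_le)
    ultimately show "x \<in> ?R" using x by (simp add: eclosure_def pair_minus_right)
  qed
  show "?R \<subseteq> ?L"
  proof
    fix x assume x: "x \<in> ?R"
    obtain x0 where x0: "x0 \<in> alcove 1" using alcove_1_nonempty by blast
    have x0h: "x0 \<in> h_real" using x0 by (simp add: alcove_def)
    define D where "D = pair (x0 - x) (x0 - x)"
    have D: "D \<ge> 0" unfolding D_def using x x0h by (intro pair_nonneg h_real_diff) auto
    have "\<exists>y\<in>alcove r. pair (x - y) (x - y) < e" if e: "e > 0" for e
    proof -
      define t where "t = min 1 (e / (D + 1))"
      have t: "0 < t" "t \<le> 1" using e D by (auto simp: t_def)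
      define y where "y = x + complex_of_real t \<cdot> (x0 - x)"
      have py: "pair y \<alpha> = (1 - t) * pair x \<alpha> + t * pair x0 \<alpha>" for \<alpha>
        by (simp add: y_def pair_add_left pair_scale_left pair_diff_left algebra_simps)
      have "y \<in> h_real" unfolding y_def using x x0h by (intro h_real_add h_real_scale h_real_diff) auto
      moreover have "pair y \<alpha> > 0" if "\<alpha> \<in> simple_roots" for \<alpha>
        unfolding py using that x x0 t by (intro add_nonneg_pos) (auto simp: alcove_def)
      moreover have "pair y highest_root < real r"
      proof -
        have "(1 - t) * pair x highest_root \<le> (1 - t) * real r"
          using x t by (intro mult_left_mono) auto
        moreover have "t * pair x0 highest_root < t * real r"
          using x0 r t by (intro mult_strict_left_mono) (auto simp: alcove_def)
        ultimately show ?thesis unfolding py by (simp add: algebra_simps)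
      qed
      ultimately have ya: "y \<in> alcove r" by (simp add: alcove_def)
      have "x - y = complex_of_real (- t) \<cdot> (x0 - x)" by (simp add: y_def)
      then have "pair (x - y) (x - y) = (- t) * ((- t) * D)"
        by (simp only: pair_scale_left pair_scale_right D_def)
      then have "pair (x - y) (x - y) = t * (t * D)" by simp
      also have "\<dots> \<le> t * D" using t D by (intro mult_left_mono) (auto simp: mult_left_le_one_le)
      also have "\<dots> \<le> e / (D + 1) * D" using D by (intro mult_right_mono) (auto simp: t_def)
      also have "\<dots> < e" using e D by (simp add: field_simps)
      finally show ?thesis using ya by blast
    qed
    then show "x \<in> ?L" using x by (simp add: eclosure_def)
  qed
qed

lemma eclosure_alcove_1_iff:
  "x \<in> eclosure (alcove 1) \<longleftrightarrow> x \<in> h_real \<and> (\<forall>\<beta>\<in>pos_roots. 0 \<le> pair x \<beta> \<and> pair x \<beta> \<le> 1)"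
proof
  assume "x \<in> eclosure (alcove 1)"
  then have x: "x \<in> h_real" "\<And>\<alpha>. \<alpha> \<in> simple_roots \<Longrightarrow> pair x \<alpha> \<ge> 0" "pair x highest_root \<le> 1"
    by (simp_all add: eclosure_alcove)
  then show "x \<in> h_real \<and> (\<forall>\<beta>\<in>pos_roots. 0 \<le> pair x \<beta> \<and> pair x \<beta> \<le> 1)"
    using pair_pos_nonneg[OF x(2)] pair_le_highest_root[OF x(2)] pos_roots_roots by force
qed (auto simp: eclosure_alcove simple_roots_pos highest_root(1))

lemma alcove_subset_eclosure: "alcove 1 \<subseteq> eclosure (alcove 1)"
  by (auto simp: alcove_1_iff eclosure_alcove_1_iff less_imp_le)

subsection \<open>Lattices\<close>

lemma reflection_coroot:
  "x \<in> h_real \<Longrightarrow> \<alpha> \<in> roots \<Longrightarrow> reflection \<alpha> x = x - complex_of_real (pair x \<alpha>) \<cdot> coroot \<alpha>"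
  by (simp add: reflection_h_real coroot_real mult.commute)

lemma pair_coroot: "\<alpha> \<in> roots \<Longrightarrow> pair x (coroot \<alpha>) = 2 / pair \<alpha> \<alpha> * pair x \<alpha>"
  by (simp only: coroot_real pair_scale_right)

lemma coroot_lattice_iff:
  "x \<in> coroot_lattice \<longleftrightarrow> (\<exists>\<gamma>s. set \<gamma>s \<subseteq> roots \<and> x = sum_list (map coroot \<gamma>s))"
proof -
  interpret Z: module "\<lambda>(k::int) x. of_int k \<cdot> x"
    by unfold_locales (simp_all add: scale_right_distrib scale_left_distrib)
  let ?T = "{x. \<exists>\<gamma>s. set \<gamma>s \<subseteq> roots \<and> x = sum_list (map coroot \<gamma>s)}"
  have neg: "- sum_list (map coroot \<gamma>s) = sum_list (map coroot (map uminus \<gamma>s))" for \<gamma>s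
    by (induction \<gamma>s) (simp_all add: coroot_minus)
  have rep: "of_nat k \<cdot> sum_list (map coroot \<gamma>s) = sum_list (map coroot (concat (replicate k \<gamma>s)))" for k \<gamma>s
    by (induction k) (simp_all add: scale_left_distrib)
  have "Z.subspace ?T"
  proof (rule Z.subspaceI, unfold mem_Collect_eq)
    show "\<exists>\<gamma>s. set \<gamma>s \<subseteq> roots \<and> 0 = sum_list (map coroot \<gamma>s)" by (intro exI[of _ "[]"]) simp
  next
    fix x y assume "\<exists>\<gamma>s. set \<gamma>s \<subseteq> roots \<and> x = sum_list (map coroot \<gamma>s)"
      "\<exists>\<gamma>s. set \<gamma>s \<subseteq> roots \<and> y = sum_list (map coroot \<gamma>s)"
    then obtain xs ys where "set xs \<subseteq> roots" "x = sum_list (map coroot xs)"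
      "set ys \<subseteq> roots" "y = sum_list (map coroot ys)" by blast
    then show "\<exists>\<gamma>s. set \<gamma>s \<subseteq> roots \<and> x + y = sum_list (map coroot \<gamma>s)"
      by (intro exI[of _ "xs @ ys"]) simp
  next
    fix k :: int and x assume "\<exists>\<gamma>s. set \<gamma>s \<subseteq> roots \<and> x = sum_list (map coroot \<gamma>s)"
    then obtain \<gamma>s where g: "set \<gamma>s \<subseteq> roots" "x = sum_list (map coroot \<gamma>s)" by blast
    show "\<exists>\<gamma>s. set \<gamma>s \<subseteq> roots \<and> of_int k \<cdot> x = sum_list (map coroot \<gamma>s)"
    proof (cases k)
      case (nonneg n)
      then show ?thesis using g rep[of n \<gamma>s]
        by (intro exI[of _ "concat (replicate n \<gamma>s)"]) (auto split: if_splits)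
    next
      case (neg n)
      have "of_int k \<cdot> x = of_nat (Suc n) \<cdot> (- x)"
        unfolding neg by (simp only: of_int_minus of_int_of_nat_eq scale_minus_left scale_minus_right)
      also have "\<dots> = sum_list (map coroot (concat (replicate (Suc n) (map uminus \<gamma>s))))"
        unfolding g(2) \<open>\<And>\<gamma>s. - sum_list (map coroot \<gamma>s) = sum_list (map coroot (map uminus \<gamma>s))\<close> by (rule rep)
      finally show ?thesis using g(1) roots_minus
        by (intro exI[of _ "concat (replicate (Suc n) (map uminus \<gamma>s))"]) (auto split: if_splits)
    qed
  qed
  moreover have "coroot ` roots \<subseteq> ?T"
  proof clarify
    fix \<alpha> assume "\<alpha> \<in> roots"
    then show "\<exists>\<gamma>s. set \<gamma>s \<subseteq> roots \<and> coroot \<alpha> = sum_list (map coroot \<gamma>s)"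
      by (intro exI[of _ "[\<alpha>]"]) simp
  qed
  ultimately have 1: "coroot_lattice \<subseteq> ?T" unfolding coroot_lattice_def by (intro Z.span_minimal)
  have "set \<gamma>s \<subseteq> roots \<Longrightarrow> sum_list (map coroot \<gamma>s) \<in> coroot_lattice" for \<gamma>s
    unfolding coroot_lattice_def by (induction \<gamma>s) (auto intro: Z.span_zero Z.span_add Z.span_base)
  then show ?thesis using 1 by blast
qed

definition weyl_stable_lattice :: "'g set \<Rightarrow> bool" where
  "weyl_stable_lattice \<Lambda> \<longleftrightarrow> \<Lambda> \<subseteq> coweight_lattice \<and> (\<forall>x\<in>\<Lambda>. - x \<in> \<Lambda>) \<and> (\<forall>x\<in>\<Lambda>. \<forall>y\<in>\<Lambda>. x + y \<in> \<Lambda>) \<and>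
    (\<forall>w\<in>weyl. \<forall>x\<in>\<Lambda>. w x \<in> \<Lambda>)"

lemma coweight_lattice_stable: "weyl_stable_lattice coweight_lattice"
  unfolding weyl_stable_lattice_def
proof (intro conjI ballI)
  show "w x \<in> coweight_lattice" if w: "w \<in> weyl" and x: "x \<in> coweight_lattice" for w x
  proof -
    have "pair (w x) \<alpha> \<in> \<int>" if "\<alpha> \<in> roots" for \<alpha>
      unfolding pair_weyl_left[OF w]
      using x weyl_root[OF weyl_inverse(2)[OF w] that] by (simp add: coweight_lattice_def)
    then show ?thesis using x weyl_h_real[OF w] by (simp add: coweight_lattice_def)
  qed
qed (auto simp: coweight_lattice_def h_real_minus h_real_add pair_minus_left pair_add_left)

lemma coroot_lattice_stable: "weyl_stable_lattice coroot_lattice"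
  unfolding weyl_stable_lattice_def
proof (intro conjI ballI)
  show "coroot_lattice \<subseteq> coweight_lattice"
  proof
    fix x assume "x \<in> coroot_lattice"
    then obtain \<gamma>s where g: "set \<gamma>s \<subseteq> roots" "x = sum_list (map coroot \<gamma>s)"
      by (auto simp: coroot_lattice_iff)
    have int: "pair (coroot \<gamma>) \<alpha> \<in> \<int>" if gr: "\<gamma> \<in> roots" and ar: "\<alpha> \<in> roots" for \<gamma> \<alpha>
    proof -
      obtain n :: int where "2 * pair \<alpha> \<gamma> = of_int n * pair \<gamma> \<gamma>"
        by (rule root_integrality[OF gr ar])
      then have "pair (coroot \<gamma>) \<alpha> = of_int n"
        using pair_coroot[OF gr, of \<alpha>] pair_root_self_pos[OF gr] pair_sym[of \<alpha> "coroot \<gamma>"]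
        by (simp add: field_simps)
      then show ?thesis by simp
    qed
    have "set \<gamma>s \<subseteq> roots \<Longrightarrow> sum_list (map coroot \<gamma>s) \<in> coweight_lattice"
      by (induction \<gamma>s) (auto simp: coweight_lattice_def h_real_0 h_real_add h_real_coroot pair_add_left int)
    then show "x \<in> coweight_lattice" using g by simp
  qed
next
  fix x assume "x \<in> coroot_lattice"
  then obtain \<gamma>s where g: "set \<gamma>s \<subseteq> roots" "x = sum_list (map coroot \<gamma>s)"
    by (auto simp: coroot_lattice_iff)
  have "- x = sum_list (map coroot (map uminus \<gamma>s))"
    unfolding g(2) by (induction \<gamma>s) (simp_all add: coroot_minus)
  then show "- x \<in> coroot_lattice"
    using g(1) roots_minus unfolding coroot_lattice_iff by (intro exI[of _ "map uminus \<gamma>s"]) auto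
next
  fix x y assume "x \<in> coroot_lattice" "y \<in> coroot_lattice"
  then obtain xs ys where "set xs \<subseteq> roots" "x = sum_list (map coroot xs)"
    "set ys \<subseteq> roots" "y = sum_list (map coroot ys)" by (auto simp: coroot_lattice_iff)
  then show "x + y \<in> coroot_lattice"
    unfolding coroot_lattice_iff by (intro exI[of _ "xs @ ys"]) simp
next
  fix w x assume w: "w \<in> weyl" and "x \<in> coroot_lattice"
  then obtain \<gamma>s where g: "set \<gamma>s \<subseteq> roots" "x = sum_list (map coroot \<gamma>s)"
    by (auto simp: coroot_lattice_iff)
  have "w x = sum_list (map coroot (map w \<gamma>s))"
    unfolding g(2) using lin_weyl[OF w] lin_zero[OF lin_weyl[OF w]] coroot_weyl[OF w]
    by (induction \<gamma>s) (simp_all add: lin_iff)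
  then show "w x \<in> coroot_lattice"
    using g(1) weyl_root[OF w] unfolding coroot_lattice_iff by (intro exI[of _ "map w \<gamma>s"]) auto
qed

text \<open>If \<open>\<lambda> = \<gamma>\<^sub>1\<^sup>\<or> + \<cdots> + \<gamma>\<^sub>m\<^sup>\<or>\<close> is nonzero and minuscule, then \<open>(\<lambda>, \<gamma>\<^sub>j) = 1\<close> for some \<open>j\<close>, since
  \<open>(\<lambda>, \<lambda>) > 0\<close>; and \<open>s\<^bsub>\<gamma>\<^sub>j\<^esub> \<lambda> = \<lambda> - \<gamma>\<^sub>j\<^sup>\<or>\<close> is again nonzero and minuscule, with fewer summands.\<close>

lemma coroot_lattice_minuscule_zero:
  assumes "x \<in> coroot_lattice" "\<And>\<alpha>. \<alpha> \<in> roots \<Longrightarrow> \<bar>pair x \<alpha>\<bar> \<le> 1"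
  shows "x = 0"
proof -
  have "set \<gamma>s \<subseteq> roots \<Longrightarrow> (\<forall>\<alpha>\<in>roots. \<bar>pair (sum_list (map coroot \<gamma>s)) \<alpha>\<bar> \<le> 1) \<Longrightarrow>
      sum_list (map coroot \<gamma>s) = 0" for \<gamma>s
  proof (induction "length \<gamma>s" arbitrary: \<gamma>s rule: less_induct)
    case less
    define x where "x = sum_list (map coroot \<gamma>s)"
    have "x \<in> coroot_lattice" using less.prems(1) coroot_lattice_iff x_def by blast
    then have xc: "x \<in> coweight_lattice"
      using coroot_lattice_stable unfolding weyl_stable_lattice_def by blast
    then have xh: "x \<in> h_real" by (simp add: coweight_lattice_def)
    show ?case
    proof (rule ccontr)
      assume "sum_list (map coroot \<gamma>s) \<noteq> 0"
      then have x0: "x \<noteq> 0" by (simp add: x_def)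
      then have "pair x x > 0" using pair_nonneg[OF xh] pair_eq_0_iff[OF xh] by linarith
      moreover have "pair x x = (\<Sum>\<gamma>\<leftarrow>\<gamma>s. pair x (coroot \<gamma>))"
        using pair_sum_list[of x "map coroot \<gamma>s"] by (simp add: x_def[symmetric] comp_def)
      ultimately have "\<not> (\<forall>\<gamma>\<in>set \<gamma>s. pair x (coroot \<gamma>) \<le> 0)"
        using sum_list_nonpos[of "map (\<lambda>\<gamma>. pair x (coroot \<gamma>)) \<gamma>s"] by auto
      then obtain \<gamma> where g: "\<gamma> \<in> set \<gamma>s" "pair x (coroot \<gamma>) > 0" by force
      have gr: "\<gamma> \<in> roots" using g(1) less.prems(1) by blast
      have "pair x \<gamma> > 0"
        using g(2) pair_root_self_pos[OF gr] unfolding pair_coroot[OF gr]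
        by (simp add: zero_less_mult_iff zero_less_divide_iff)
      moreover have "\<bar>pair x \<gamma>\<bar> \<le> 1" using less.prems(2) gr by (simp add: x_def)
      moreover have "pair x \<gamma> \<in> \<int>" using xc gr by (simp add: coweight_lattice_def)
      ultimately have "pair x \<gamma> = 1" by (elim Ints_cases) simp
      then have s: "reflection \<gamma> x = x - coroot \<gamma>" using reflection_coroot[OF xh gr] by simp
      obtain ys zs where l: "\<gamma>s = ys @ \<gamma> # zs" using g(1) by (meson split_list)
      have s': "reflection \<gamma> x = sum_list (map coroot (ys @ zs))"
        unfolding s by (simp add: x_def l algebra_simps)
      have "\<bar>pair (reflection \<gamma> x) \<alpha>\<bar> \<le> 1" if a: "\<alpha> \<in> roots" for \<alpha>
      proof -
        have "pair (reflection \<gamma> x) \<alpha> = pair x (reflection \<gamma> \<alpha>)"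
          using pair_weyl[OF reflection_weyl[OF gr], of x "reflection \<gamma> \<alpha>"]
          by (simp add: reflection_involution[OF gr])
        then show ?thesis using less.prems(2) reflection_root[OF gr a] by (simp add: x_def)
      qed
      then have "sum_list (map coroot (ys @ zs)) = 0"
        unfolding s' using less.prems(1) by (intro less.hyps) (auto simp: l)
      then have "reflection \<gamma> x = 0" unfolding s' .
      then show False
        using reflection_involution[OF gr, of x] lin_zero[OF lin_reflection, of \<gamma>] x0 by simp
    qed
  qed
  then show ?thesis using assms unfolding coroot_lattice_iff by blast
qed

subsection \<open>Groups of affine transformations\<close>

text \<open>For the coroot lattice this is the affine Weyl group, for the coweight lattice the extended one.\<close>

definition weyl_translations :: "'g set \<Rightarrow> ('g \<Rightarrow> 'g) set" where
  "weyl_translations \<Lambda> = {v \<circ> translation x | v x. v \<in> weyl \<and> x \<in> \<Lambda>}"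

lemma affine_weyl_eq: "affine_weyl = weyl_translations coroot_lattice"
  by (simp add: affine_weyl_def weyl_translations_def)

lemma affine_weyl_subset: "affine_weyl \<subseteq> weyl_translations coweight_lattice"
  using coroot_lattice_stable unfolding affine_weyl_eq weyl_translations_def weyl_stable_lattice_def
  by blast

lemma weyl_translations_compose:
  assumes L: "weyl_stable_lattice \<Lambda>" and g: "g \<in> weyl_translations \<Lambda>" and k: "k \<in> weyl_translations \<Lambda>"
  shows "g \<circ> k \<in> weyl_translations \<Lambda>"
proof -
  obtain v x where v: "v \<in> weyl" "x \<in> \<Lambda>" "g = v \<circ> translation x"
    using g unfolding weyl_translations_def by blast
  obtain u y where u: "u \<in> weyl" "y \<in> \<Lambda>" "k = u \<circ> translation y"
    using k unfolding weyl_translations_def by blast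
  have "u (a + y + inv u x) = u (a + y) + x" for a
    using lin_weyl[OF u(1)] u(1) by (simp add: lin_iff)
  then have "g \<circ> k = (v \<circ> u) \<circ> translation (y + inv u x)"
    unfolding v(3) u(3) by (simp add: fun_eq_iff translation_def add.assoc)
  moreover have "y + inv u x \<in> \<Lambda>"
    using L weyl_inverse(2)[OF u(1)] u(2) v(2) unfolding weyl_stable_lattice_def by blast
  ultimately show ?thesis
    unfolding weyl_translations_def using weyl_compose[OF v(1) u(1)] by blast
qed

lemma weyl_translations_inverse:
  assumes L: "weyl_stable_lattice \<Lambda>" and g: "g \<in> weyl_translations \<Lambda>"
  shows "bij g" "inv g \<in> weyl_translations \<Lambda>"
proof -
  obtain v x where v: "v \<in> weyl" "x \<in> \<Lambda>" "g = v \<circ> translation x"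
    using g unfolding weyl_translations_def by blast
  let ?k = "inv v \<circ> translation (- v x)"
  have lin: "lin v" "lin (inv v)" using lin_weyl v(1) weyl_inverse(2) by blast+
  have 1: "g \<circ> ?k = id" "?k \<circ> g = id"
    using lin v(1) lin_minus[OF lin(2)] lin_minus[OF lin(1)]
    by (simp_all add: fun_eq_iff v(3) translation_def lin_iff)
  then show "bij g" using o_bij by blast
  have "inv g = ?k" using 1 by (metis inv_unique_comp)
  moreover have "- v x \<in> \<Lambda>" using L v unfolding weyl_stable_lattice_def by blast
  ultimately show "inv g \<in> weyl_translations \<Lambda>"
    unfolding weyl_translations_def using weyl_inverse(2)[OF v(1)] by blast
qed

lemmas affine_weyl_compose = weyl_translations_compose[OF coroot_lattice_stable, folded affine_weyl_eq]
  and affine_weyl_inverse = weyl_translations_inverse[OF coroot_lattice_stable, folded affine_weyl_eq]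

lemma affine_weyl_inv_apply [simp]:
  assumes "w \<in> affine_weyl"
  shows "w (inv w x) = x" "inv w (w x) = x"
  using affine_weyl_inverse(1)[OF assms] by (simp_all add: bij_is_inj bij_is_surj surj_f_inv_f)

text \<open>Coweights pair integrally with roots, so these groups permute the affine functions
  \<open>x \<mapsto> (\<alpha>, x) + n\<close> with a root \<open>\<alpha>\<close> and an integer \<open>n\<close>.\<close>

lemma weyl_translations_pair:
  assumes g: "g \<in> weyl_translations coweight_lattice" and a: "\<alpha> \<in> roots"
  shows "\<exists>\<beta>\<in>roots. \<exists>n::int. \<forall>y. pair (g y) \<alpha> = pair y \<beta> + of_int n"
proof -
  obtain v x where v: "v \<in> weyl" "x \<in> coweight_lattice" "g = v \<circ> translation x"
    using g unfolding weyl_translations_def by blast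
  have b: "inv v \<alpha> \<in> roots" using weyl_root[OF weyl_inverse(2)[OF v(1)] a] .
  then have "pair x (inv v \<alpha>) \<in> \<int>" using v(2) by (simp add: coweight_lattice_def)
  then obtain n :: int where "pair x (inv v \<alpha>) = of_int n" by (elim Ints_cases)
  then have "pair (g y) \<alpha> = pair y (inv v \<alpha>) + of_int n" for y
    by (simp add: v(3) translation_def pair_weyl_left[OF v(1)] pair_add_left)
  then show ?thesis using b by blast
qed

lemma weyl_translations_h_real:
  assumes g: "g \<in> weyl_translations coweight_lattice" and x: "x \<in> h_real"
  shows "g x \<in> h_real"
proof -
  obtain v y where v: "v \<in> weyl" "y \<in> coweight_lattice" "g = v \<circ> translation y"
    using g unfolding weyl_translations_def by blast
  have "x + y \<in> h_real" using x v(2) by (simp add: coweight_lattice_def h_real_add)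
  then show ?thesis using weyl_h_real[OF v(1)] by (simp add: v(3) translation_def)
qed

text \<open>An interior point determines the integer parts of all roots on its alcove.\<close>

lemma weyl_translations_alcove_subset:
  assumes g: "g \<in> weyl_translations coweight_lattice" and p: "p \<in> alcove 1" "g p \<in> alcove 1"
  shows "g ` eclosure (alcove 1) \<subseteq> eclosure (alcove 1)"
proof clarify
  fix x assume x: "x \<in> eclosure (alcove 1)"
  have "0 \<le> pair (g x) \<alpha> \<and> pair (g x) \<alpha> \<le> 1" if a: "\<alpha> \<in> pos_roots" for \<alpha>
  proof -
    obtain \<beta> n where b: "\<beta> \<in> roots" "\<And>y. pair (g y) \<alpha> = pair y \<beta> + of_int n"
      using weyl_translations_pair[OF g pos_roots_roots[OF a]] by blast
    have gp: "0 < pair p \<beta> + of_int n" "pair p \<beta> + of_int n < 1"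
      using p(2) a by (auto simp: alcove_1_iff b(2))
    from root_pos_or_neg[OF b(1)] show ?thesis
    proof
      assume b': "\<beta> \<in> pos_roots"
      then have "0 < pair p \<beta>" "pair p \<beta> < 1" using p(1) by (auto simp: alcove_1_iff)
      then have "n = 0" using gp by linarith
      then show ?thesis using x b' by (simp add: b(2) eclosure_alcove_1_iff)
    next
      assume b': "- \<beta> \<in> pos_roots"
      then have "0 < pair p (- \<beta>)" "pair p (- \<beta>) < 1" using p(1) by (auto simp: alcove_1_iff)
      then have "n = 1" using gp by (simp add: pair_minus_right)
      moreover have "0 \<le> pair x (- \<beta>)" "pair x (- \<beta>) \<le> 1"
        using x b' by (auto simp: eclosure_alcove_1_iff)
      ultimately show ?thesis by (simp add: b(2) pair_minus_right)
    qed
  qed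
  then show "g x \<in> eclosure (alcove 1)"
    using x weyl_translations_h_real[OF g] by (simp add: eclosure_alcove_1_iff)
qed

lemma weyl_translations_alcove:
  assumes g: "g \<in> weyl_translations coweight_lattice" and p: "p \<in> alcove 1" "g p \<in> alcove 1"
  shows "g ` eclosure (alcove 1) = eclosure (alcove 1)"
proof
  show "g ` eclosure (alcove 1) \<subseteq> eclosure (alcove 1)"
    by (rule weyl_translations_alcove_subset[OF g p])
  note i = weyl_translations_inverse[OF coweight_lattice_stable g]
  have "inv g ` eclosure (alcove 1) \<subseteq> eclosure (alcove 1)"
    using p i(1) by (intro weyl_translations_alcove_subset[OF i(2), of "g p"]) (simp_all add: bij_is_inj)
  then have "g ` inv g ` eclosure (alcove 1) \<subseteq> g ` eclosure (alcove 1)" by (rule image_mono)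
  moreover have "g ` inv g ` X = X" for X
    using i(1) by (simp add: image_image bij_is_surj surj_f_inv_f)
  ultimately show "eclosure (alcove 1) \<subseteq> g ` eclosure (alcove 1)" by simp
qed

text \<open>The image of the origin is a minuscule vector of the coroot lattice, hence \<open>0\<close>; a linear
  transformation that preserves the alcove preserves the positive roots.\<close>

lemma affine_weyl_alcove_id:
  assumes w: "w \<in> affine_weyl" and A: "w ` eclosure (alcove 1) \<subseteq> eclosure (alcove 1)"
  shows "w = id"
proof -
  obtain v x where v: "v \<in> weyl" "x \<in> coroot_lattice" "w = v \<circ> translation x"
    using w unfolding affine_weyl_def by blast
  have "0 \<in> eclosure (alcove 1)" by (simp add: eclosure_alcove_1_iff h_real_0)
  then have "w 0 \<in> eclosure (alcove 1)" using A by blast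
  then have vx: "v x \<in> eclosure (alcove 1)" by (simp add: v(3) translation_def)
  have "v x = 0"
  proof (rule coroot_lattice_minuscule_zero)
    show "v x \<in> coroot_lattice" using coroot_lattice_stable v unfolding weyl_stable_lattice_def by blast
    show "\<bar>pair (v x) \<alpha>\<bar> \<le> 1" if "\<alpha> \<in> roots" for \<alpha>
    proof -
      have "0 \<le> pair (v x) \<beta> \<and> pair (v x) \<beta> \<le> 1" if "\<beta> \<in> pos_roots" for \<beta>
        using vx that unfolding eclosure_alcove_1_iff by blast
      from root_pos_or_neg[OF that] this[of \<alpha>] this[of "- \<alpha>"] show ?thesis
        by (auto simp: pair_minus_right)
    qed
  qed
  then have "inv v (v x) = 0" using lin_zero[OF lin_weyl[OF weyl_inverse(2)[OF v(1)]]] by simp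
  then have x0: "x = 0" using v(1) by simp
  obtain p where p: "p \<in> alcove 1" using alcove_1_nonempty by blast
  have "w p \<in> eclosure (alcove 1)" using p A alcove_subset_eclosure by blast
  then have vp: "v p \<in> eclosure (alcove 1)" by (simp add: v(3) translation_def x0)
  have "v \<alpha> \<in> pos_roots" if a: "\<alpha> \<in> pos_roots" for \<alpha>
  proof (rule ccontr)
    assume "v \<alpha> \<notin> pos_roots"
    then have "- v \<alpha> \<in> pos_roots" using root_pos_or_neg[OF weyl_root[OF v(1) pos_roots_roots[OF a]]] by blast
    then have "pair (v p) (- v \<alpha>) \<ge> 0" using vp unfolding eclosure_alcove_1_iff by blast
    moreover have "pair p \<alpha> > 0" using p a unfolding alcove_1_iff by blast
    ultimately show False by (simp add: pair_minus_right pair_weyl[OF v(1)])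
  qed
  then have "v = id" by (rule weyl_preserving_pos_roots[OF v(1)])
  then show ?thesis by (simp add: v(3) x0 translation_def fun_eq_iff)
qed

lemma affine_reflection_affine_weyl:
  assumes a: "\<alpha> \<in> roots"
  shows "(\<lambda>q. reflection \<alpha> q + of_int k \<cdot> coroot \<alpha>) \<in> affine_weyl"
proof -
  interpret Z: module "\<lambda>(k::int) x. of_int k \<cdot> x"
    by unfold_locales (simp_all add: scale_right_distrib scale_left_distrib)
  have lin: "lin (reflection \<alpha>)" by (rule lin_reflection)
  have "reflection \<alpha> (coroot \<alpha>) = - coroot \<alpha>"
    using coroot_weyl[OF reflection_weyl[OF a], of \<alpha>] by (simp add: reflection_self[OF a] coroot_minus)
  then have eq: "reflection \<alpha> (of_int (- k) \<cdot> coroot \<alpha>) = of_int k \<cdot> coroot \<alpha>"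
    using lin by (simp add: lin_iff lin_minus[OF lin])
  have add: "reflection \<alpha> (x + y) = reflection \<alpha> x + reflection \<alpha> y" for x y
    using lin by (simp add: lin_iff)
  have "(\<lambda>q. reflection \<alpha> q + of_int k \<cdot> coroot \<alpha>) = reflection \<alpha> \<circ> translation (of_int (- k) \<cdot> coroot \<alpha>)"
    by (rule ext) (simp only: comp_apply translation_def add eq)
  moreover have "of_int (- k) \<cdot> coroot \<alpha> \<in> coroot_lattice"
    unfolding coroot_lattice_def using a by (intro Z.span_scale Z.span_base) auto
  ultimately show ?thesis unfolding affine_weyl_def using reflection_weyl[OF a] by blast
qed

text \<open>Reflecting in a hyperplane that separates \<open>q\<close> from \<open>x\<close> brings \<open>q\<close> closer to \<open>x\<close>.\<close>

lemma affine_reflection_distance: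
  fixes k :: int
  assumes q: "q \<in> h_real" and a: "\<alpha> \<in> roots"
  defines "s \<equiv> reflection \<alpha> q + of_int k \<cdot> coroot \<alpha>"
  shows "pair (s - x) (s - x) = pair (q - x) (q - x)
    + 4 * ((pair q \<alpha> - of_int k) * ((pair x \<alpha> - of_int k) / pair \<alpha> \<alpha>))"
proof -
  define c where "c = (pair q \<alpha> - of_int k) * (2 / pair \<alpha> \<alpha>)"
  have p: "pair \<alpha> \<alpha> > 0" by (rule pair_root_self_pos[OF a])
  have "s = q - complex_of_real (pair q \<alpha> - of_int k) \<cdot> coroot \<alpha>"
    unfolding s_def reflection_coroot[OF q a] by (simp add: scale_left_diff_distrib)
  then have sx: "s - x = (q - x) - complex_of_real c \<cdot> \<alpha>"
    unfolding coroot_real[OF a] c_def by simp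
  have "pair (u - complex_of_real c \<cdot> \<alpha>) (u - complex_of_real c \<cdot> \<alpha>)
      = pair u u - 2 * c * pair u \<alpha> + c * c * pair \<alpha> \<alpha>" for u
    by (simp add: pair_diff_left pair_diff_right pair_scale_left pair_scale_right pair_sym[of \<alpha> u]
        algebra_simps)
  then have "pair (s - x) (s - x) = pair (q - x) (q - x) - 2 * c * pair (q - x) \<alpha> + c * c * pair \<alpha> \<alpha>"
    unfolding sx .
  moreover have "c * c * pair \<alpha> \<alpha> - 2 * c * pair (q - x) \<alpha>
      = 4 * ((pair q \<alpha> - of_int k) * ((pair x \<alpha> - of_int k) / pair \<alpha> \<alpha>))"
    using p unfolding c_def pair_diff_left by (simp add: field_simps)
  ultimately show ?thesis by linarith
qed

lemma nonint_distance: "(r::real) \<notin> \<int> \<Longrightarrow> \<exists>e>0. \<forall>n::int. \<bar>r + of_int n\<bar> \<ge> e"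
proof (intro exI conjI allI)
  assume r: "r \<notin> \<int>"
  have "frac r > 0" "frac r < 1" using r by (simp_all add: frac_gt_0_iff frac_lt_1)
  then show "min (frac r) (1 - frac r) > 0" by simp
  fix n :: int
  have "r + of_int n = frac r + of_int (\<lfloor>r\<rfloor> + n)" by (simp add: frac_def)
  moreover have "\<lfloor>r\<rfloor> + n \<ge> 0 \<or> \<lfloor>r\<rfloor> + n \<le> - 1" by linarith
  then have "of_int (\<lfloor>r\<rfloor> + n) \<ge> (0::real) \<or> of_int (\<lfloor>r\<rfloor> + n) \<le> (- 1::real)" by linarith
  ultimately show "\<bar>r + of_int n\<bar> \<ge> min (frac r) (1 - frac r)"
    using \<open>frac r > 0\<close> \<open>frac r < 1\<close> by linarith
qed

lemma finite_lower_bound: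
  assumes "finite S" "\<And>s. s \<in> S \<Longrightarrow> f s > (0::real)"
  shows "\<exists>e>0. \<forall>s\<in>S. f s \<ge> e"
  using assms
proof (induction S rule: finite_induct)
  case empty
  show ?case by (intro exI[of _ 1]) simp
next
  case (insert s S)
  then obtain e where "e > 0" "\<forall>s\<in>S. f s \<ge> e" by auto
  then show ?case using insert.prems[of s] by (intro exI[of _ "min e (f s)"]) (auto simp: min.coboundedI1)
qed

text \<open>As long as \<open>w p\<close> is not in the alcove, reflecting in a wall decreases its distance from a
  fixed point of the alcove. The decrease is bounded below, because \<open>(w p, \<alpha>)\<close> stays away
  from the integers, uniformly in \<open>w\<close>.\<close>

lemma affine_weyl_to_alcove:
  assumes p: "p \<in> h_real" and nonint: "\<And>\<alpha>. \<alpha> \<in> roots \<Longrightarrow> pair p \<alpha> \<notin> \<int>"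
  shows "\<exists>w\<in>affine_weyl. w p \<in> alcove 1"
proof (rule ccontr)
  assume none: "\<not> (\<exists>w\<in>affine_weyl. w p \<in> alcove 1)"
  obtain x where x: "x \<in> alcove 1" using alcove_1_nonempty by blast
  have xh: "x \<in> h_real" using x by (simp add: alcove_def)
  have "\<forall>\<alpha>\<in>roots. \<exists>e>0. \<forall>n::int. \<bar>pair p \<alpha> + of_int n\<bar> \<ge> e"
    using nonint nonint_distance by blast
  then obtain e where e: "\<And>\<alpha>. \<alpha> \<in> roots \<Longrightarrow> e \<alpha> > 0"
    "\<And>\<alpha> n. \<alpha> \<in> roots \<Longrightarrow> \<bar>pair p \<alpha> + of_int n\<bar> \<ge> e \<alpha>" by metis
  obtain E where E: "E > 0" "\<And>\<alpha>. \<alpha> \<in> roots \<Longrightarrow> e \<alpha> \<ge> E"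
    using finite_lower_bound[OF finite_roots, of e] e(1) by blast
  have far: "\<bar>pair (w p) \<alpha> - of_int n\<bar> \<ge> E" if w: "w \<in> affine_weyl" and a: "\<alpha> \<in> roots" for w \<alpha> and n :: int
  proof -
    obtain \<beta> m where b: "\<beta> \<in> roots" "\<And>y. pair (w y) \<alpha> = pair y \<beta> + of_int m"
      using weyl_translations_pair[of w \<alpha>] w affine_weyl_subset a by blast
    show ?thesis using e(2)[OF b(1), of "m - n"] E(2)[OF b(1)] by (simp add: b(2))
  qed
  have pos: "\<And>\<alpha>. \<alpha> \<in> roots \<Longrightarrow> pair \<alpha> \<alpha> > 0" by (rule pair_root_self_pos)
  have th: "highest_root \<in> roots" using highest_root(1) by (rule pos_roots_roots)
  have xs: "pair x \<alpha> > 0" if "\<alpha> \<in> simple_roots" for \<alpha> using x that by (simp add: alcove_def)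
  have xt: "1 - pair x highest_root > 0" using x by (simp add: alcove_def)
  obtain c where c: "c > 0" "\<And>\<alpha>. \<alpha> \<in> simple_roots \<Longrightarrow> pair x \<alpha> / pair \<alpha> \<alpha> \<ge> c"
    using finite_lower_bound[OF finite_simple_roots, of "\<lambda>\<alpha>. pair x \<alpha> / pair \<alpha> \<alpha>"] xs pos simple_roots_roots
    by (metis divide_pos_pos)
  define d where "d = min c ((1 - pair x highest_root) / pair highest_root highest_root)"
  have d: "d > 0" using c(1) xt pos[OF th] by (simp add: d_def)
  define f where "f w = pair (w p - x) (w p - x)" for w
  have step: "\<exists>u\<in>affine_weyl. f u \<le> f w - 4 * E * d" if w: "w \<in> affine_weyl" for w
  proof -
    have wp: "w p \<in> h_real" using weyl_translations_h_real w affine_weyl_subset p by blast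
    have "\<exists>\<alpha>\<in>roots. \<exists>k::int.
      (pair (w p) \<alpha> - of_int k) * ((pair x \<alpha> - of_int k) / pair \<alpha> \<alpha>) \<le> - (E * d)"
    proof (cases "\<exists>\<alpha>\<in>simple_roots. pair (w p) \<alpha> \<le> 0")
      case True
      then obtain \<alpha> where a: "\<alpha> \<in> simple_roots" "pair (w p) \<alpha> \<le> 0" by blast
      have "- pair (w p) \<alpha> \<ge> E" using far[OF w simple_roots_roots[OF a(1)], of 0] a(2) by simp
      moreover have "pair x \<alpha> / pair \<alpha> \<alpha> \<ge> d" using c(2)[OF a(1)] by (simp add: d_def)
      ultimately have "E * d \<le> - pair (w p) \<alpha> * (pair x \<alpha> / pair \<alpha> \<alpha>)"
        using d E(1) by (intro mult_mono) auto
      then show ?thesis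
        by (intro bexI[of _ \<alpha>] exI[of _ 0]) (auto simp: simple_roots_roots[OF a(1)])
    next
      case False
      then have "pair (w p) highest_root \<ge> 1"
        using none w wp by (force simp: alcove_def)
      then have "pair (w p) highest_root - 1 \<ge> E" using far[OF w th, of 1] by simp
      moreover have "(1 - pair x highest_root) / pair highest_root highest_root \<ge> d" by (simp add: d_def)
      ultimately have "E * d \<le> (pair (w p) highest_root - 1) * ((1 - pair x highest_root) / pair highest_root highest_root)"
        using d E(1) by (intro mult_mono) auto
      also have "\<dots> = - ((pair (w p) highest_root - of_int 1) *
          ((pair x highest_root - of_int 1) / pair highest_root highest_root))"
        by (simp only: of_int_1 mult_minus_right[symmetric] minus_divide_left minus_diff_eq)
      finally show ?thesis using th by (intro bexI[of _ highest_root] exI[of _ 1]) simp_all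
    qed
    then obtain \<alpha> and k :: int where a: "\<alpha> \<in> roots"
      "(pair (w p) \<alpha> - of_int k) * ((pair x \<alpha> - of_int k) / pair \<alpha> \<alpha>) \<le> - (E * d)" by blast
    let ?s = "\<lambda>q. reflection \<alpha> q + of_int k \<cdot> coroot \<alpha>"
    have "?s \<circ> w \<in> affine_weyl"
      by (rule affine_weyl_compose[OF affine_reflection_affine_weyl[OF a(1)] w])
    moreover have "f (?s \<circ> w) \<le> f w - 4 * E * d"
      using affine_reflection_distance[OF wp a(1), of k x] a(2) unfolding f_def comp_apply by linarith
    ultimately show ?thesis by blast
  qed
  have "\<exists>w\<in>affine_weyl. f w \<le> f id - real n * (4 * E * d)" for n
  proof (induction n)
    case 0
    have "0 \<in> coroot_lattice" unfolding coroot_lattice_iff by (intro exI[of _ "[]"]) simp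
    then have "id \<circ> translation 0 \<in> affine_weyl" unfolding affine_weyl_def using weyl_id by blast
    then have "id \<in> affine_weyl" by (simp add: translation_def id_def comp_def)
    then show ?case by (intro bexI[of _ id]) simp_all
  next
    case (Suc n)
    then obtain w where w: "w \<in> affine_weyl" "f w \<le> f id - real n * (4 * E * d)" by blast
    obtain u where u: "u \<in> affine_weyl" "f u \<le> f w - 4 * E * d" using step[OF w(1)] by blast
    have "f u \<le> f id - real (Suc n) * (4 * E * d)" using u(2) w(2) by (simp add: algebra_simps)
    then show ?case using u(1) by blast
  qed
  moreover obtain n where "real n * (4 * E * d) > f id"
    using reals_Archimedean3[of "4 * E * d"] E(1) d by fastforce
  ultimately obtain w where w: "w \<in> affine_weyl" "f w < 0" by (metis diff_less_0_iff_less le_less_trans)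
  have "w p \<in> h_real" using weyl_translations_h_real w(1) affine_weyl_subset p by blast
  then have "f w \<ge> 0" unfolding f_def using xh by (intro pair_nonneg h_real_diff)
  then show False using w(2) by simp
qed

section \<open>Inversion sets\<close>

lemma affine_root_inject:
  assumes a: "\<alpha> \<in> roots" and b: "\<beta> \<in> roots" and eq: "affine_root \<alpha> k = affine_root \<beta> l"
  shows "\<alpha> = \<beta>" "k = l"
proof -
  have e: "pair \<alpha> x + of_int k = pair \<beta> x + of_int l" for x
    using fun_cong[OF eq, of x] by (simp add: affine_root_def)
  show kl: "k = l" using e[of 0] by simp
  have "pair (\<alpha> - \<beta>) x = 0" for x using e[of x] by (simp add: kl pair_diff_left)
  then have "\<alpha> - \<beta> = 0"
    by (intro h_real_eq_0I h_real_diff h_real_roots a b)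
  then show "\<alpha> = \<beta>" by simp
qed

lemma pos_affine_rootI:
  "\<alpha> \<in> pos_roots \<Longrightarrow> k \<ge> 0 \<Longrightarrow> affine_root \<alpha> k \<in> pos_affine_roots"
  "\<alpha> \<in> pos_roots \<Longrightarrow> k > 0 \<Longrightarrow> affine_root (- \<alpha>) k \<in> pos_affine_roots"
  unfolding pos_affine_roots_def neg_roots_def by blast+

lemma affine_root_pos_or_neg:
  assumes "\<alpha> \<in> roots"
  shows "affine_root \<alpha> k \<in> pos_affine_roots \<or> affine_root \<alpha> k \<in> neg_affine_roots"
proof -
  have neg: "affine_root \<alpha> k = (\<lambda>x. - affine_root (- \<alpha>) (- k) x)"
    by (simp add: affine_root_def fun_eq_iff pair_minus_left)
  have negI: "affine_root \<alpha> k \<in> neg_affine_roots" if "affine_root (- \<alpha>) (- k) \<in> pos_affine_roots"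
    unfolding neg_affine_roots_def using neg that by blast
  from root_pos_or_neg[OF assms] show ?thesis
  proof
    assume a: "\<alpha> \<in> pos_roots"
    then show ?thesis
      using pos_affine_rootI(1)[OF a, of k] negI[OF pos_affine_rootI(2)[OF a, of "- k"]]
      by (cases "k \<ge> 0") auto
  next
    assume a: "- \<alpha> \<in> pos_roots"
    then show ?thesis
      using pos_affine_rootI(2)[OF a, of k] negI[OF pos_affine_rootI(1)[OF a, of "- k"]]
      by (cases "k > 0") auto
  qed
qed

lemma pos_affine_root_cases:
  assumes "a \<in> pos_affine_roots"
  obtains \<alpha> k where "\<alpha> \<in> pos_roots" "k \<ge> 0" "a = affine_root \<alpha> k"
    | \<alpha> k where "\<alpha> \<in> pos_roots" "k > 0" "a = affine_root (- \<alpha>) k"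
  using assms unfolding pos_affine_roots_def neg_roots_def by blast

lemma affine_root_on_alcove:
  assumes p: "p \<in> alcove 1"
  shows "a \<in> pos_affine_roots \<Longrightarrow> a p > 0" "a \<in> neg_affine_roots \<Longrightarrow> a p < 0"
proof -
  show pos: "a p > 0" if "a \<in> pos_affine_roots" for a
    using that
  proof (cases rule: pos_affine_root_cases)
    case (1 \<alpha> k)
    have "pair p \<alpha> > 0" using p 1(1) unfolding alcove_1_iff by blast
    then show ?thesis using 1 pair_sym[of \<alpha> p] by (simp add: affine_root_def)
  next
    case (2 \<alpha> k)
    have "pair p \<alpha> < 1" using p 2(1) unfolding alcove_1_iff by blast
    moreover have "real_of_int k \<ge> 1" using 2(2) by simp
    ultimately show ?thesis using 2 pair_sym[of \<alpha> p] by (simp add: affine_root_def pair_minus_left)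
  qed
  show "a p < 0" if "a \<in> neg_affine_roots"
    using that pos unfolding neg_affine_roots_def by force
qed

lemma affine_root_comp:
  assumes w: "w \<in> affine_weyl" and a: "\<alpha> \<in> roots"
  shows "\<exists>\<beta>\<in>roots. \<exists>l. (\<lambda>x. affine_root \<alpha> k (w x)) = affine_root \<beta> l"
proof -
  obtain \<beta> n where b: "\<beta> \<in> roots" "\<And>y. pair (w y) \<alpha> = pair y \<beta> + of_int n"
    using weyl_translations_pair[of w \<alpha>] w affine_weyl_subset a by blast
  then have "(\<lambda>x. affine_root \<alpha> k (w x)) = affine_root \<beta> (n + k)"
    by (simp add: affine_root_def fun_eq_iff pair_sym[of \<alpha>] pair_sym[of \<beta>])
  then show ?thesis using b(1) by blast
qed

lemma pos_affine_root_form: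
  assumes "a \<in> pos_affine_roots"
  obtains \<alpha> k where "\<alpha> \<in> roots" "a = affine_root \<alpha> k"
  using assms by (cases rule: pos_affine_root_cases) (use pos_roots_roots roots_minus in blast)+

text \<open>An affine root has constant sign on the open fundamental alcove, so the sign of \<open>w\<inverse> a\<close> is that of
  the value of \<open>a\<close> at any one point of \<open>w C\<^sub>1\<close>.\<close>

lemma inversions_eq:
  assumes w: "w \<in> affine_weyl" and p: "p \<in> alcove 1"
  shows "inversions w = {a \<in> pos_affine_roots. a (w p) < 0}"
proof -
  have "affine_act (inv w) a \<in> neg_affine_roots \<longleftrightarrow> a (w p) < 0" if a: "a \<in> pos_affine_roots" for a
  proof -
    obtain \<alpha> k where ak: "\<alpha> \<in> roots" "a = affine_root \<alpha> k" by (rule pos_affine_root_form[OF a])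
    obtain \<beta> l where b: "\<beta> \<in> roots" "(\<lambda>x. a (w x)) = affine_root \<beta> l"
      using affine_root_comp[OF w ak(1)] ak(2) by blast
    have "affine_act (inv w) a = affine_root \<beta> l"
      unfolding b(2)[symmetric] by (simp add: affine_act_def inv_inv_eq[OF affine_weyl_inverse(1)[OF w]])
    moreover have "a (w p) = affine_root \<beta> l p" using fun_cong[OF b(2), of p] by simp
    ultimately show ?thesis
      using affine_root_pos_or_neg[OF b(1), of l] affine_root_on_alcove[OF p, of "affine_root \<beta> l"] by force
  qed
  then show ?thesis unfolding inversions_def by blast
qed

text \<open>Equal inversion sets mean that all affine roots have the same signs on \<open>w C\<^sub>1\<close> and \<open>u C\<^sub>1\<close>, so that
  \<open>w\<inverse> u\<close> preserves the alcove.\<close>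

lemma inversions_inject:
  assumes w: "w \<in> affine_weyl" and u: "u \<in> affine_weyl" and eq: "inversions w = inversions u"
  shows "w = u"
proof -
  obtain p where p: "p \<in> alcove 1" using alcove_1_nonempty by blast
  have same: "affine_root \<alpha> k (u p) > 0" if a: "\<alpha> \<in> roots" and pos: "affine_root \<alpha> k (w p) > 0" for \<alpha> k
  proof -
    obtain \<beta> l where b: "\<beta> \<in> roots" "(\<lambda>x. affine_root \<alpha> k (u x)) = affine_root \<beta> l"
      using affine_root_comp[OF u a] by blast
    have nz: "affine_root \<alpha> k (u p) \<noteq> 0"
      using fun_cong[OF b(2), of p] affine_root_pos_or_neg[OF b(1), of l]
        affine_root_on_alcove[OF p, of "affine_root \<beta> l"] by auto
    from affine_root_pos_or_neg[OF a, of k] show ?thesis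
    proof
      assume a': "affine_root \<alpha> k \<in> pos_affine_roots"
      then have "affine_root \<alpha> k \<notin> inversions w" using pos by (simp add: inversions_eq[OF w p])
      then have "\<not> affine_root \<alpha> k (u p) < 0" using a' unfolding eq inversions_eq[OF u p] by blast
      then show ?thesis using nz by simp
    next
      assume "affine_root \<alpha> k \<in> neg_affine_roots"
      then obtain c where c: "c \<in> pos_affine_roots" "affine_root \<alpha> k = (\<lambda>x. - c x)"
        unfolding neg_affine_roots_def by blast
      then have "c \<in> inversions w" using pos by (simp add: inversions_eq[OF w p])
      then have "c (u p) < 0" unfolding eq inversions_eq[OF u p] by blast
      then show ?thesis by (simp add: c(2))
    qed
  qed
  define g where "g = inv w \<circ> u"
  have g: "g \<in> affine_weyl" unfolding g_def by (rule affine_weyl_compose[OF affine_weyl_inverse(2)[OF w] u])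
  have gext: "g \<in> weyl_translations coweight_lattice" using g affine_weyl_subset by blast
  have pos: "affine_root \<beta> l (g p) > 0" if b: "\<beta> \<in> roots" and bp: "affine_root \<beta> l p > 0" for \<beta> l
  proof -
    obtain \<alpha> k where a: "\<alpha> \<in> roots" "(\<lambda>x. affine_root \<beta> l (inv w x)) = affine_root \<alpha> k"
      using affine_root_comp[OF affine_weyl_inverse(2)[OF w] b] by blast
    have "affine_root \<alpha> k (w p) > 0" using bp w unfolding a(2)[symmetric] by simp
    then have "affine_root \<alpha> k (u p) > 0" by (rule same[OF a(1)])
    then show ?thesis unfolding a(2)[symmetric] by (simp add: g_def)
  qed
  have "g p \<in> alcove 1"
    unfolding alcove_1_iff
  proof (intro conjI ballI)
    show "g p \<in> h_real" using weyl_translations_h_real[OF gext] p by (simp add: alcove_def)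
    fix \<beta> assume b: "\<beta> \<in> pos_roots"
    have bp: "pair p \<beta> > 0" "pair p \<beta> < 1" using b p unfolding alcove_1_iff by blast+
    show "pair (g p) \<beta> > 0"
      using pos[of \<beta> 0] bp pos_roots_roots[OF b] by (simp add: affine_root_def pair_sym[of \<beta>])
    show "pair (g p) \<beta> < 1"
      using pos[of "- \<beta>" 1] bp roots_minus[OF pos_roots_roots[OF b]]
      by (simp add: affine_root_def pair_minus_left pair_sym[of \<beta>])
  qed
  then have "g = id"
    using weyl_translations_alcove[OF gext p] by (intro affine_weyl_alcove_id[OF g]) simp
  then have "w (g x) = w x" for x by simp
  then show "w = u" using w by (auto simp: g_def)
qed

section \<open>Ideals of the Borel subalgebra\<close>

lemma ad_nilpotent_ideal_eq_span:
  assumes I: "I \<in> ad_nilpotent_ideals"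
  shows "I = span (\<Union>\<alpha>\<in>ideal_roots I. root_space \<alpha>)"
proof -
  have id: "ideal_of I \<bb>" and sub: "I \<subseteq> \<nn>" using I unfolding ad_nilpotent_ideals_def by blast+
  have "cartan_stable I"
    using id cartan_subset_borel unfolding cartan_stable_def ideal_of_def by blast
  moreover have "\<hh> \<inter> I \<subseteq> {0}" using sub borel_decomp(2) by blast
  ultimately have "I = span (\<Union>\<alpha>\<in>{\<alpha>\<in>roots. root_space \<alpha> \<subseteq> I}. root_space \<alpha>)"
    by (rule cartan_stable_span_root_spaces)
  moreover have "{\<alpha>\<in>roots. root_space \<alpha> \<subseteq> I} = ideal_roots I"
    using sub pos_roots_roots unfolding ideal_roots_def pos_roots_def by blast
  ultimately show ?thesis by simp
qed

lemma ideal_of_root_set: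
  assumes P: "\<Phi> \<subseteq> pos_roots"
    and upper: "\<And>\<alpha> \<beta>. \<alpha> \<in> pos_roots \<Longrightarrow> \<beta> \<in> \<Phi> \<Longrightarrow> \<alpha> + \<beta> \<in> roots \<Longrightarrow> \<alpha> + \<beta> \<in> \<Phi>"
  shows "span (\<Union>\<alpha>\<in>\<Phi>. root_space \<alpha>) \<in> ad_nilpotent_ideals"
    and "ideal_roots (span (\<Union>\<alpha>\<in>\<Phi>. root_space \<alpha>)) = \<Phi>"
proof -
  let ?I = "span (\<Union>\<alpha>\<in>\<Phi>. root_space \<alpha>)"
  have in_I: "x \<in> ?I" if "x \<in> root_space \<alpha>" "\<alpha> \<in> \<Phi>" for x \<alpha>
    using that by (intro span_base) blast
  have sub: "?I \<subseteq> \<nn>" unfolding nilrad_eq_span using P by (intro span_mono) blast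
  have br: "\<lbrace>x, y\<rbrace> \<in> ?I" if xy: "x \<in> \<bb>" "y \<in> ?I" for x y
  proof (rule bracket_spans[OF subspace_span _ xy[unfolded borel_eq_span]])
    fix x y assume "x \<in> (\<Union>t\<in>insert 0 pos_roots. root_space t)" "y \<in> (\<Union>\<alpha>\<in>\<Phi>. root_space \<alpha>)"
    then obtain t \<beta> where t: "t \<in> insert 0 pos_roots" "x \<in> root_space t"
      and b: "\<beta> \<in> \<Phi>" "y \<in> root_space \<beta>" by blast
    show "\<lbrace>x, y\<rbrace> \<in> ?I"
    proof (cases "t = 0")
      case True
      then have "\<lbrace>x, y\<rbrace> = killing \<beta> x \<cdot> y"
        using t(2) b(2) root_space_0 by (simp add: root_space_def[of \<beta>])
      then show ?thesis using in_I[OF b(2,1)] by (simp add: span_scale)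
    next
      case False
      then have tp: "t \<in> pos_roots" using t by blast
      have bp: "\<beta> \<in> pos_roots" using b P by blast
      show ?thesis
      proof (cases "\<lbrace>x, y\<rbrace> = 0")
        case nz: False
        have br: "\<lbrace>x, y\<rbrace> \<in> root_space (t + \<beta>)" by (rule bracket_root_space[OF t(2) b(2)])
        have "t + \<beta> \<in> root_sums pos_roots" using tp bp by (intro root_sums_add root_sums_base)
        then have "t + \<beta> \<noteq> 0" using pos_root_sums_nonzero by metis
        moreover have "t + \<beta> \<in> \<hh>" by (intro cartan_add roots_in_cartan pos_roots_roots tp bp)
        ultimately have "t + \<beta> \<in> roots" using rootI br nz by blast
        then show ?thesis using upper[OF tp b(1)] in_I[OF br] by blast
      qed (simp add: span_zero)
    qed
  qed
  show "?I \<in> ad_nilpotent_ideals"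
    unfolding ad_nilpotent_ideals_def ideal_of_def
    using sub nilrad_subset_borel br by auto
  show "ideal_roots ?I = \<Phi>"
  proof
    show "\<Phi> \<subseteq> ideal_roots ?I" using P in_I unfolding ideal_roots_def by blast
    show "ideal_roots ?I \<subseteq> \<Phi>"
    proof
      fix \<alpha> assume "\<alpha> \<in> ideal_roots ?I"
      then have a: "\<alpha> \<in> roots" "root_space \<alpha> \<subseteq> ?I"
        using pos_roots_roots by (auto simp: ideal_roots_def)
      obtain x where x: "x \<in> root_space \<alpha>" "x \<noteq> 0" using a(1) by (rule root_vector)
      have "\<Phi> \<subseteq> \<hh>" using P pos_roots_roots roots_in_cartan by blast
      then show "\<alpha> \<in> \<Phi>"
        using root_space_meets_span[OF _ _ roots_in_cartan[OF a(1)] x] a(2) x(1) by blast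
    qed
  qed
qed

lemma root_power_roots: "\<Phi> \<subseteq> roots \<Longrightarrow> root_power \<Phi> k \<subseteq> roots"
  by (induction \<Phi> k rule: root_power.induct) simp_all

text \<open>The roots of an ideal are the first level of its set \<open>L\<close>, because \<open>- \<alpha> + k \<delta>\<close> determines
  \<open>\<alpha>\<close> and \<open>k\<close>.\<close>

lemma ideal_roots_from_inversions:
  "\<beta> \<in> ideal_roots I \<longleftrightarrow> \<beta> \<in> pos_roots \<and> affine_root (- \<beta>) 1 \<in> ideal_inversions I"
proof
  have sub: "ideal_roots I \<subseteq> roots" using pos_roots_roots by (auto simp: ideal_roots_def)
  assume b: "\<beta> \<in> pos_roots \<and> affine_root (- \<beta>) 1 \<in> ideal_inversions I"
  then obtain k \<alpha> where k: "k \<ge> 1" "\<alpha> \<in> root_power (ideal_roots I) k"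
      "affine_root (- \<beta>) 1 = affine_root (- \<alpha>) (int k)"
    unfolding ideal_inversions_def by auto
  have "- \<beta> = - \<alpha>" "1 = int k"
    using affine_root_inject[OF roots_minus roots_minus k(3)] b pos_roots_roots
      root_power_roots[OF sub] k(2) by blast+
  then have "\<beta> = \<alpha>" "k = Suc 0" by auto
  then show "\<beta> \<in> ideal_roots I" using k(2) by simp
next
  assume b: "\<beta> \<in> ideal_roots I"
  then have "\<beta> \<in> root_power (ideal_roots I) (Suc 0)" by simp
  then have "affine_root (- \<beta>) (int (Suc 0)) \<in> ideal_inversions I"
    unfolding ideal_inversions_def
    by (intro UN_I[of "Suc 0"] CollectI exI[of _ \<beta>] conjI refl) simp_all
  then show "\<beta> \<in> pos_roots \<and> affine_root (- \<beta>) 1 \<in> ideal_inversions I"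
    using b by (simp add: ideal_roots_def)
qed

lemma ideal_inversions_abelian:
  assumes "\<And>\<alpha> \<beta>. \<alpha> \<in> ideal_roots I \<Longrightarrow> \<beta> \<in> ideal_roots I \<Longrightarrow> \<alpha> + \<beta> \<notin> roots"
  shows "ideal_inversions I = {affine_root (- \<alpha>) 1 | \<alpha>. \<alpha> \<in> ideal_roots I}"
proof -
  have empty: "root_power (ideal_roots I) (Suc (Suc k)) = {}" for k
    by (induction k) (use assms in auto)
  have "root_power (ideal_roots I) k = (if k = 1 then ideal_roots I else {})" for k
    using empty by (cases "(ideal_roots I, k)" rule: root_power.cases) (auto simp: One_nat_def)
  then show ?thesis unfolding ideal_inversions_def by (auto split: if_splits)
qed

section \<open>The ideal attached to an element of \<open>Z\<^sub>a\<^sub>b\<close>\<close>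

text \<open>The element \<open>u v\<inverse>\<close> takes the regular dominant point \<open>v q\<close> to a dominant point, so it preserves the
  positive roots.\<close>

lemma chamber_elt_unique:
  assumes v: "v \<in> weyl" "\<And>\<alpha>. \<alpha> \<in> pos_roots \<Longrightarrow> pair (v q) \<alpha> > 0"
    and u: "u \<in> weyl" "\<And>\<alpha>. \<alpha> \<in> pos_roots \<Longrightarrow> pair (u q) \<alpha> \<ge> 0"
  shows "u = v"
proof -
  have g: "u \<circ> inv v \<in> weyl" by (rule weyl_compose[OF u(1) weyl_inverse(2)[OF v(1)]])
  have "u \<circ> inv v = id"
  proof (rule weyl_preserving_pos_roots[OF g])
    fix \<alpha> assume a: "\<alpha> \<in> pos_roots"
    show "(u \<circ> inv v) \<alpha> \<in> pos_roots"
    proof (rule ccontr)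
      assume "(u \<circ> inv v) \<alpha> \<notin> pos_roots"
      then have "- (u \<circ> inv v) \<alpha> \<in> pos_roots"
        using root_pos_or_neg[OF weyl_root[OF g pos_roots_roots[OF a]]] by blast
      then have "pair (u q) (- (u \<circ> inv v) \<alpha>) \<ge> 0" by (rule u(2))
      moreover have "pair (u q) ((u \<circ> inv v) \<alpha>) = pair (v q) \<alpha>"
        using pair_weyl[OF u(1), of q "inv v \<alpha>"] pair_weyl_left[OF v(1), of q \<alpha>] by simp
      ultimately show False using v(2)[OF a] by (simp add: pair_minus_right)
    qed
  qed
  then have "u (inv v (v x)) = v x" for x by (simp add: fun_eq_iff)
  then show ?thesis using v(1) by auto
qed

lemma affine_weyl_determined_by_alcove:
  assumes "w \<in> affine_weyl" "u \<in> affine_weyl" "w ` eclosure (alcove 1) = u ` eclosure (alcove 1)"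
  shows "w = u"
proof -
  have "inv w \<circ> u = id"
  proof (rule affine_weyl_alcove_id)
    show "inv w \<circ> u \<in> affine_weyl"
      by (rule affine_weyl_compose[OF affine_weyl_inverse(2)[OF assms(1)] assms(2)])
    have "(inv w \<circ> u) ` eclosure (alcove 1) = inv w ` w ` eclosure (alcove 1)"
      unfolding image_comp[symmetric] assms(3) ..
    then show "(inv w \<circ> u) ` eclosure (alcove 1) \<subseteq> eclosure (alcove 1)"
      using assms(1) by (simp add: image_image)
  qed
  then have "w (inv w (u x)) = w x" for x by (simp add: fun_eq_iff)
  then show ?thesis using assms(1) by auto
qed

text \<open>On \<open>v (z + C\<^sub>1)\<close> every positive root takes values in \<open>[0, 2]\<close>, so \<open>F z\<close> inverts exactly the
  \<open>- \<beta> + \<delta>\<close> with \<open>\<beta> > 1\<close> there. These \<open>\<beta>\<close> form an upper set in which no two sum to a root.\<close>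

theorem z_ideal_Z_ab:
  assumes z: "z \<in> Z_ab"
  defines "S \<equiv> uminus ` inv (v_elt z) ` level_roots z (- 2) \<union> inv (v_elt z) ` level_roots z 1"
  shows "ideal_roots (z_ideal z) = S"
    and "z_ideal z = span (\<Union>\<alpha>\<in>S. root_space \<alpha>)"
proof -
  have zc: "z \<in> coweight_lattice" using z by (simp add: Z_ab_def)
  have zh: "z \<in> h_real" using zc by (simp add: coweight_lattice_def)
  have zint: "pair z \<alpha> \<in> \<int>" if "\<alpha> \<in> roots" for \<alpha> using zc that by (simp add: coweight_lattice_def)
  have zval: "pair z \<beta> = 0 \<or> pair z \<beta> = - 1 \<or> pair z \<beta> = 1 \<or> pair z \<beta> = - 2" if "\<beta> \<in> pos_roots" for \<beta>
    using z that by (auto simp: Z_ab_def)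
  obtain p where p: "p \<in> alcove 1" using alcove_1_nonempty by blast
  have ph: "p \<in> h_real" using p by (simp add: alcove_def)
  have pval: "0 < pair p \<beta>" "pair p \<beta> < 1" if "\<beta> \<in> pos_roots" for \<beta>
    using p that unfolding alcove_1_iff by blast+
  have nonint: "pair (z + p) \<alpha> \<notin> \<int>" if a: "\<alpha> \<in> roots" for \<alpha>
  proof
    assume "pair (z + p) \<alpha> \<in> \<int>"
    then have "pair (z + p) \<alpha> - pair z \<alpha> \<in> \<int>" using zint[OF a] by (rule Ints_diff)
    then have "pair p \<alpha> \<in> \<int>" by (simp add: pair_add_left)
    then obtain n :: int where n: "pair p \<alpha> = of_int n" by (elim Ints_cases)
    from root_pos_or_neg[OF a] show False
      using pval[of \<alpha>] pval[of "- \<alpha>"] unfolding n pair_minus_right by auto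
  qed
  obtain v where v: "v \<in> weyl" and dom: "\<And>\<alpha>. \<alpha> \<in> pos_roots \<Longrightarrow> pair (v (z + p)) \<alpha> > 0"
    using weyl_dominant[of "z + p"] nonint by (metis Ints_0)
  define q where "q = v (z + p)"
  have qh: "q \<in> h_real" unfolding q_def by (intro weyl_h_real[OF v] h_real_add zh ph)
  have pv: "pair (v (z + x)) \<beta> = pair z (inv v \<beta>) + pair x (inv v \<beta>)" for x \<beta>
    by (simp add: pair_weyl_left[OF v] pair_add_left)
  note iv = weyl_inverse(2)[OF v]
  \<comment> \<open>\<open>(p, \<gamma>)\<close> lies strictly between \<open>0\<close> and \<open>1\<close> for positive \<open>\<gamma>\<close>, so the sign at \<open>v (z + p)\<close> is decided
    by the integer \<open>(z, \<gamma>)\<close>.\<close>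
  have cases: "(inv v \<beta> \<in> pos_roots \<and> (pair z (inv v \<beta>) = 0 \<or> pair z (inv v \<beta>) = 1)) \<or>
      (- inv v \<beta> \<in> pos_roots \<and> (pair z (- inv v \<beta>) = - 1 \<or> pair z (- inv v \<beta>) = - 2))"
    if b: "\<beta> \<in> pos_roots" for \<beta>
    using root_pos_or_neg[OF weyl_root[OF iv pos_roots_roots[OF b]]]
  proof
    assume g: "inv v \<beta> \<in> pos_roots"
    have "pair z (inv v \<beta>) + pair p (inv v \<beta>) > 0" using dom[OF b] by (simp add: pv)
    then show ?thesis using g zval[OF g] pval[OF g] by auto
  next
    assume g: "- inv v \<beta> \<in> pos_roots"
    have "pair z (- inv v \<beta>) + pair p (- inv v \<beta>) < 0"
      using dom[OF b] by (simp add: pv pair_minus_right)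
    then show ?thesis using g zval[OF g] pval[OF g] by auto
  qed
  have range: "0 \<le> pair (v (z + x)) \<beta> \<and> pair (v (z + x)) \<beta> \<le> 2"
    if x: "x \<in> eclosure (alcove 1)" and b: "\<beta> \<in> pos_roots" for x \<beta>
  proof -
    have xval: "0 \<le> pair x \<gamma>" "pair x \<gamma> \<le> 1" if "\<gamma> \<in> pos_roots" for \<gamma>
      using x that unfolding eclosure_alcove_1_iff by blast+
    from cases[OF b] show ?thesis
      unfolding pv using xval[of "inv v \<beta>"] xval[of "- inv v \<beta>"] by (auto simp: pair_minus_right)
  qed
  have pcl: "p \<in> eclosure (alcove 1)" using p alcove_subset_eclosure by blast
  have h1: "coxeter_number \<ge> 1" using coxeter_number_ge_2 by simp
  \<comment> \<open>The highest root is at most \<open>2\<close> on \<open>v (z + C\<^sub>1)\<close>, and \<open>2 \<le> h\<close>.\<close>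
  have chamber: "chamber_elt z = v"
    unfolding chamber_elt_def
  proof (rule the_equality)
    have "v (z + x) \<in> eclosure (alcove coxeter_number)" if x: "x \<in> eclosure (alcove 1)" for x
    proof -
      have "x \<in> h_real" using x by (simp add: eclosure_def)
      then have "v (z + x) \<in> h_real" by (intro weyl_h_real[OF v] h_real_add zh)
      moreover have "real coxeter_number \<ge> 2" using coxeter_number_ge_2 by simp
      ultimately show ?thesis
        using range[OF x] simple_roots_pos highest_root(1) by (force simp: eclosure_alcove[OF h1])
    qed
    then show "v \<in> weyl \<and> v ` translation z ` eclosure (alcove 1) \<subseteq> eclosure (alcove coxeter_number)"
      using v by (auto simp: translation_def add.commute)
  next
    fix u assume u: "u \<in> weyl \<and> u ` translation z ` eclosure (alcove 1) \<subseteq> eclosure (alcove coxeter_number)"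
    then have "u (translation z p) \<in> eclosure (alcove coxeter_number)" using pcl by blast
    then have "\<And>\<alpha>. \<alpha> \<in> simple_roots \<Longrightarrow> pair (u (z + p)) \<alpha> \<ge> 0"
      by (simp add: eclosure_alcove[OF h1] translation_def add.commute)
    then have "pair (u (z + p)) \<alpha> \<ge> 0" if "\<alpha> \<in> pos_roots" for \<alpha> using that by (rule pair_pos_nonneg)
    then show "u = v" using u by (intro chamber_elt_unique[OF v dom]) auto
  qed
  have vz: "inv (v_elt z) = v"
    unfolding v_elt_def chamber by (rule inv_inv_eq[OF weyl_inverse(1)[OF v]])
  have "pair q \<alpha> \<notin> \<int>" if "\<alpha> \<in> roots" for \<alpha>
    unfolding q_def pair_weyl_left[OF v] by (rule nonint[OF weyl_root[OF iv that]])
  then obtain w' where w': "w' \<in> affine_weyl" "w' q \<in> alcove 1"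
    using affine_weyl_to_alcove[OF qh] by blast
  define w where "w = inv w'"
  have w: "w \<in> affine_weyl" unfolding w_def by (rule affine_weyl_inverse(2)[OF w'(1)])
  have wA: "v ` translation z ` eclosure (alcove 1) = w ` eclosure (alcove 1)"
  proof -
    have "v \<circ> translation z \<in> weyl_translations coweight_lattice"
      unfolding weyl_translations_def using v zc by blast
    then have g: "w' \<circ> (v \<circ> translation z) \<in> weyl_translations coweight_lattice"
      using weyl_translations_compose[OF coweight_lattice_stable] w'(1) affine_weyl_subset by blast
    have "(w' \<circ> (v \<circ> translation z)) p \<in> alcove 1"
      using w'(2) by (simp add: q_def translation_def add.commute)
    then have "(w' \<circ> (v \<circ> translation z)) ` eclosure (alcove 1) = eclosure (alcove 1)"
      by (rule weyl_translations_alcove[OF g p])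
    then have "w ` eclosure (alcove 1) = w ` w' ` v ` translation z ` eclosure (alcove 1)"
      by (simp add: image_comp)
    then show ?thesis using w'(1) by (simp add: w_def image_image)
  qed
  have F: "F z = w"
    unfolding F_def chamber
    by (rule the_equality) (use w wA affine_weyl_determined_by_alcove in auto)
  define \<Phi> where "\<Phi> = {\<beta> \<in> pos_roots. pair q \<beta> > 1}"
  have q2: "pair q \<beta> \<le> 2" if "\<beta> \<in> pos_roots" for \<beta>
    using range[OF pcl that] by (simp add: q_def)
  have q0: "pair q \<beta> > 0" if "\<beta> \<in> pos_roots" for \<beta>
    using dom[OF that] by (simp add: q_def)
  have inv_w: "inversions w = {affine_root (- \<beta>) 1 | \<beta>. \<beta> \<in> \<Phi>}"
  proof -
    have "w (w' q) = q" using w'(1) by (simp add: w_def)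
    then have "inversions w = {a \<in> pos_affine_roots. a q < 0}"
      using inversions_eq[OF w w'(2)] by simp
    also have "\<dots> = {affine_root (- \<beta>) 1 | \<beta>. \<beta> \<in> \<Phi>}"
    proof (intro equalityI subsetI)
      fix a assume a: "a \<in> {a \<in> pos_affine_roots. a q < 0}"
      then have "a \<in> pos_affine_roots" by simp
      then show "a \<in> {affine_root (- \<beta>) 1 | \<beta>. \<beta> \<in> \<Phi>}"
      proof (cases rule: pos_affine_root_cases)
        case (1 \<alpha> k)
        then have "a q > 0" using q0[OF 1(1)] by (simp add: affine_root_def pair_sym[of \<alpha>])
        then show ?thesis using a by simp
      next
        case (2 \<alpha> k)
        have "pair q \<alpha> > of_int k"
          using a 2 by (simp add: affine_root_def pair_minus_left pair_sym[of \<alpha>])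
        then have "real_of_int k < 2" "pair q \<alpha> > 1" using q2[OF 2(1)] 2(2) by linarith+
        then have "k = 1" using 2(2) by linarith
        then show ?thesis using 2 \<open>pair q \<alpha> > 1\<close> by (auto simp: \<Phi>_def)
      qed
    next
      fix a assume "a \<in> {affine_root (- \<beta>) 1 | \<beta>. \<beta> \<in> \<Phi>}"
      then obtain \<beta> where b: "a = affine_root (- \<beta>) 1" "\<beta> \<in> pos_roots" "pair q \<beta> > 1"
        by (auto simp: \<Phi>_def)
      have "a \<in> pos_affine_roots" unfolding b(1) by (rule pos_affine_rootI(2)[OF b(2)]) simp
      moreover have "a q < 0"
        using b by (simp add: affine_root_def pair_minus_left pair_sym[of \<beta>])
      ultimately show "a \<in> {a \<in> pos_affine_roots. a q < 0}" by simp
    qed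
    finally show ?thesis .
  qed
  have \<Phi>_pos: "\<Phi> \<subseteq> pos_roots" by (auto simp: \<Phi>_def)
  have sum_pos: "\<alpha> + \<beta> \<in> pos_roots" if "\<alpha> \<in> pos_roots" "\<beta> \<in> pos_roots" "\<alpha> + \<beta> \<in> roots" for \<alpha> \<beta>
    by (rule pos_roots_closed[OF root_sums_add[OF root_sums_base[OF that(1)] root_sums_base[OF that(2)]] that(3)])
  have upper: "\<alpha> + \<beta> \<in> \<Phi>" if "\<alpha> \<in> pos_roots" "\<beta> \<in> \<Phi>" "\<alpha> + \<beta> \<in> roots" for \<alpha> \<beta>
  proof -
    have "\<beta> \<in> pos_roots" "pair q \<beta> > 1" using that(2) by (auto simp: \<Phi>_def)
    then show ?thesis
      using sum_pos[OF that(1) _ that(3)] q0[OF that(1)] by (simp add: \<Phi>_def pair_add_right)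
  qed
  have abelian: "\<alpha> + \<beta> \<notin> roots" if "\<alpha> \<in> \<Phi>" "\<beta> \<in> \<Phi>" for \<alpha> \<beta>
  proof
    assume "\<alpha> + \<beta> \<in> roots"
    then have "\<alpha> + \<beta> \<in> pos_roots" using that by (intro sum_pos) (auto simp: \<Phi>_def)
    then show False using q2[of "\<alpha> + \<beta>"] that by (simp add: \<Phi>_def pair_add_right)
  qed
  let ?I = "span (\<Union>\<alpha>\<in>\<Phi>. root_space \<alpha>)"
  have I: "?I \<in> ad_nilpotent_ideals" and I\<Phi>: "ideal_roots ?I = \<Phi>"
    using ideal_of_root_set[OF \<Phi>_pos upper] by blast+
  have inv_I: "inversions w = ideal_inversions ?I"
    using ideal_inversions_abelian[of ?I] abelian unfolding I\<Phi> inv_w by simp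
  have unique: "u = w" if "u \<in> affine_weyl \<and> inversions u = ideal_inversions ?I" for u
    using inversions_inject[of u w] that w inv_I by simp
  have elt_I: "ideal_elt ?I = Some w"
  proof -
    have "\<exists>!w. w \<in> affine_weyl \<and> inversions w = ideal_inversions ?I"
      by (rule ex1I[of _ w]) (rule conjI[OF w inv_I], rule unique)
    moreover have "(THE w. w \<in> affine_weyl \<and> inversions w = ideal_inversions ?I) = w"
      by (rule the_equality) (rule conjI[OF w inv_I], rule unique)
    ultimately show ?thesis using I by (simp add: ideal_elt_def)
  qed
  have zI: "z_ideal z = ?I"
    unfolding z_ideal_def F
  proof (rule the_equality)
    show "ideal_elt ?I = Some w" by (rule elt_I)
    fix J assume J: "ideal_elt J = Some w"
    then have J': "J \<in> ad_nilpotent_ideals" "\<exists>!w. w \<in> affine_weyl \<and> inversions w = ideal_inversions J"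
      "(THE w. w \<in> affine_weyl \<and> inversions w = ideal_inversions J) = w"
      by (auto simp: ideal_elt_def split: if_splits)
    have "inversions w = ideal_inversions J" using theI'[OF J'(2)] unfolding J'(3) by blast
    then have "ideal_roots J = ideal_roots ?I"
      using ideal_roots_from_inversions[of _ J] ideal_roots_from_inversions[of _ ?I] inv_I by auto
    then show "J = ?I" using ad_nilpotent_ideal_eq_span[OF J'(1)] I\<Phi> by simp
  qed
  have S: "S = \<Phi>"
  proof (intro equalityI subsetI)
    have posI: "\<beta> \<in> \<Phi>" if b: "\<beta> \<in> roots" and gt: "pair q \<beta> > 1" for \<beta>
    proof -
      have "\<beta> \<in> pos_roots"
        using root_pos_or_neg[OF b] q0[of "- \<beta>"] gt by (auto simp: pair_minus_right)
      then show ?thesis using gt by (simp add: \<Phi>_def)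
    qed
    fix \<beta> assume "\<beta> \<in> S"
    then consider \<gamma> where "\<gamma> \<in> level_roots z (- 2)" "\<beta> = - v \<gamma>" | \<gamma> where "\<gamma> \<in> level_roots z 1" "\<beta> = v \<gamma>"
      unfolding S_def vz by blast
    then show "\<beta> \<in> \<Phi>"
    proof cases
      case 1
      then have g: "\<gamma> \<in> pos_roots" "pair z \<gamma> = - 2" by (auto simp: level_roots_def pair_sym[of \<gamma>])
      have "pair q \<beta> = 2 - pair p \<gamma>"
        unfolding 1(2) q_def pair_minus_right pair_weyl[OF v] by (simp add: pair_add_left g(2))
      then show ?thesis using pval[OF g(1)] g(1) unfolding 1(2)
        by (intro posI roots_minus weyl_root[OF v] pos_roots_roots) auto
    next
      case 2
      then have g: "\<gamma> \<in> pos_roots" "pair z \<gamma> = 1" by (auto simp: level_roots_def pair_sym[of \<gamma>])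
      have "pair q \<beta> = 1 + pair p \<gamma>"
        unfolding 2(2) q_def pair_weyl[OF v] by (simp add: pair_add_left g(2))
      then show ?thesis using pval[OF g(1)] g(1) unfolding 2(2)
        by (intro posI weyl_root[OF v] pos_roots_roots) auto
    qed
  next
    fix \<beta> assume "\<beta> \<in> \<Phi>"
    then have b: "\<beta> \<in> pos_roots" "pair q \<beta> > 1" by (auto simp: \<Phi>_def)
    have qb: "pair q \<beta> = pair z (inv v \<beta>) + pair p (inv v \<beta>)" by (simp add: q_def pv)
    from cases[OF b(1)] show "\<beta> \<in> S"
    proof
      assume g: "inv v \<beta> \<in> pos_roots \<and> (pair z (inv v \<beta>) = 0 \<or> pair z (inv v \<beta>) = 1)"
      then have "pair z (inv v \<beta>) = 1" using b(2) pval[of "inv v \<beta>"] by (auto simp: qb)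
      then have "inv v \<beta> \<in> level_roots z 1" using g by (simp add: level_roots_def pair_sym[of _ z])
      then have "v (inv v \<beta>) \<in> v ` level_roots z 1" by (rule imageI)
      then show ?thesis using v by (simp add: S_def vz)
    next
      assume g: "- inv v \<beta> \<in> pos_roots \<and> (pair z (- inv v \<beta>) = - 1 \<or> pair z (- inv v \<beta>) = - 2)"
      then have "pair z (- inv v \<beta>) = - 2"
        using b(2) pval[of "- inv v \<beta>"] by (auto simp: qb pair_minus_right)
      then have "- inv v \<beta> \<in> level_roots z (- 2)" using g by (simp add: level_roots_def pair_sym[of _ z])
      then have "- v (- inv v \<beta>) \<in> uminus ` v ` level_roots z (- 2)" by (intro imageI)
      then show ?thesis using v lin_minus[OF lin_weyl[OF v]] by (simp add: S_def vz)
    qed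
  qed
  show "ideal_roots (z_ideal z) = S" unfolding zI I\<Phi> S ..
  show "z_ideal z = span (\<Union>\<alpha>\<in>S. root_space \<alpha>)" unfolding zI S ..
qed

end

theorem proposition1p7:
  fixes L :: "('g::ab_group_add, 'm) borel_lie_algebra_scheme" and z :: 'g
  assumes "simple_lie_borel L"
    and "z \<in> simple_lie_borel.Z_ab L"
  shows "let v = simple_lie_borel.v_elt L z;
             S = uminus ` inv v ` simple_lie_borel.level_roots L z (- 2)
               \<union> inv v ` simple_lie_borel.level_roots L z 1
         in simple_lie_borel.ideal_roots L (simple_lie_borel.z_ideal L z) = S
          \<and> simple_lie_borel.z_ideal L z =
              module.span (scale L) (\<Union>\<alpha>\<in>S. simple_lie_borel.root_space L \<alpha>)"
proof -
  interpret simple_lie_borel L by (rule assms(1))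
  show ?thesis unfolding Let_def using z_ideal_Z_ab[OF assms(2)] by blast
qed

end
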